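(* Let $\gamma:S^1\to\mathbb{R}^2$ be a strictly convex $C^4$-regular closed curve. Then $\gamma$ has at least three clean maximal sextactic points and at least three clean minimal sextactic points.
   Context: $S^1=\mathbb{R}/2\pi\mathbb{Z}$. A strictly convex curve is a simple closed regular curve bounding a convex region, with nowhere vanishing curvature. The affine plane $\mathbb{R}^2$ is regarded as a subset of the real projective plane $P^2$. A conic given by a quadratic equation $Q=0$ meets $\gamma$ at $t$ with multiplicity at least $k$ (for $k\le 5$) if $Q\circ\gamma$ and its first $k-1$ derivatives vanish at $t$. The osculating conic $C_t$ of $\gamma$ at $t$ is the unique (nondegenerate) conic meeting $\gamma$ with multiplicity at least five in $t$. A nondegenerate conic is inscribed in $\gamma$ if it is contained in the closed disc bounded by $\gamma$; it is circumscribed about $\gamma$ if $\gamma$ is contained in the closed disc bounded by the conic in $P^2$. A point $t\in S^1$ is a clean maximal (resp. clean minimal) sextactic point of $\gamma$ if $C_t$ is inscribed (resp. circumscribed) and $\{r\in S^1:\gamma(r)\in C_t\}$ is connected. *)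

theory Defs
  imports "HOL-Analysis.Analysis"
begin

section \<open>Closed plane curves\<close>

definition vderiv :: "(real \<Rightarrow> 'a::real_normed_vector) \<Rightarrow> real \<Rightarrow> 'a"
  where "vderiv f = (\<lambda>t. vector_derivative f (at t))"

definition C_k_curve :: "nat \<Rightarrow> (real \<Rightarrow> 'a::real_normed_vector) \<Rightarrow> bool"
  where "C_k_curve k f \<longleftrightarrow>
    (\<forall>j<k. \<forall>t. ((vderiv ^^ j) f) differentiable (at t)) \<and> continuous_on UNIV ((vderiv ^^ k) f)"

text \<open>A map on \<open>\<real> / 2 \<pi> \<int>\<close> is represented by a \<open>2 \<pi>\<close>-periodic function on the reals,
  and a point of \<open>\<real> / 2 \<pi> \<int>\<close> by its representative in \<open>{0..<2 * pi}\<close>.\<close>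

definition simple_closed_curve :: "(real \<Rightarrow> 'a) \<Rightarrow> bool"
  where "simple_closed_curve \<gamma> \<longleftrightarrow>
    (\<forall>t. \<gamma> (t + 2 * pi) = \<gamma> t) \<and> inj_on \<gamma> {0..<2 * pi}"

text \<open>A property of points of \<open>\<real> / 2 \<pi> \<int>\<close> (a \<open>2 \<pi>\<close>-periodic set of reals) is connected
  iff its image on the unit circle is, \<open>cis\<close> inducing a homeomorphism onto that circle.\<close>

definition connected_on_circle :: "real set \<Rightarrow> bool"
  where "connected_on_circle T \<longleftrightarrow> connected (cis ` T)"

definition C_k_regular :: "nat \<Rightarrow> (real \<Rightarrow> 'a::real_normed_vector) \<Rightarrow> bool"
  where "C_k_regular k \<gamma> \<longleftrightarrow> C_k_curve k \<gamma> \<and> (\<forall>t. vderiv \<gamma> t \<noteq> 0)"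

definition curvature :: "(real \<Rightarrow> real^2) \<Rightarrow> real \<Rightarrow> real"
  where "curvature \<gamma> t =
    (vderiv \<gamma> t $ 1 * vderiv (vderiv \<gamma>) t $ 2 - vderiv \<gamma> t $ 2 * vderiv (vderiv \<gamma>) t $ 1)
      / norm (vderiv \<gamma> t) ^ 3"

definition closed_region :: "(real \<Rightarrow> real^2) \<Rightarrow> (real^2) set"
  where "closed_region \<gamma> = range \<gamma> \<union> inside (range \<gamma>)"

definition strictly_convex :: "(real \<Rightarrow> real^2) \<Rightarrow> bool"
  where "strictly_convex \<gamma> \<longleftrightarrow>
    simple_closed_curve \<gamma> \<and> convex (closed_region \<gamma>) \<and> (\<forall>t. curvature \<gamma> t \<noteq> 0)"


section \<open>The real projective plane\<close>

text \<open>Points are the one-dimensional linear subspaces of \<open>\<real>\<^sup>3\<close>; the topology is the quotient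
  topology of \<open>\<real>\<^sup>3 - {0}\<close>.\<close>

definition proj_pt :: "real^3 \<Rightarrow> (real^3) set"
  where "proj_pt v = span {v}"

definition proj_plane :: "(real^3) set topology"
  where "proj_plane = topology (\<lambda>U. U \<subseteq> proj_pt ` (- {0}) \<and> open {v. v \<noteq> 0 \<and> proj_pt v \<in> U})"

lemma openin_proj_plane:
  "openin proj_plane U \<longleftrightarrow> U \<subseteq> proj_pt ` (- {0}) \<and> open {v. v \<noteq> 0 \<and> proj_pt v \<in> U}"
proof -
  have "istopology (\<lambda>U. U \<subseteq> proj_pt ` (- {0}) \<and> open {v. v \<noteq> 0 \<and> proj_pt v \<in> U})"
    unfolding istopology_def
  proof (intro conjI allI impI; (elim conjE)?)
    fix S T
    assume "open {v. v \<noteq> 0 \<and> proj_pt v \<in> S}" "open {v. v \<noteq> 0 \<and> proj_pt v \<in> T}"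
    then have "open ({v. v \<noteq> 0 \<and> proj_pt v \<in> S} \<inter> {v. v \<noteq> 0 \<and> proj_pt v \<in> T})"
      by (rule open_Int)
    also have "\<dots> = {v. v \<noteq> 0 \<and> proj_pt v \<in> S \<inter> T}"
      by auto
    finally show "open {v. v \<noteq> 0 \<and> proj_pt v \<in> S \<inter> T}" .
  next
    fix K
    assume "\<forall>S\<in>K. S \<subseteq> proj_pt ` (- {0}) \<and> open {v. v \<noteq> 0 \<and> proj_pt v \<in> S}"
    then have "open (\<Union>S\<in>K. {v. v \<noteq> 0 \<and> proj_pt v \<in> S})"
      by blast
    also have "\<dots> = {v. v \<noteq> 0 \<and> proj_pt v \<in> \<Union>K}"
      by auto
    finally show "open {v. v \<noteq> 0 \<and> proj_pt v \<in> \<Union>K}" .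
  qed auto
  then show ?thesis
    by (simp add: proj_plane_def topology_inverse')
qed

lemma topspace_proj_plane: "topspace proj_plane = proj_pt ` (- {0})"
proof -
  have "{v :: real^3. v \<noteq> 0 \<and> proj_pt v \<in> proj_pt ` (- {0})} = - {0}"
    by auto
  then have "openin proj_plane (proj_pt ` (- {0}))"
    by (simp add: openin_proj_plane open_Compl)
  then show ?thesis
    by (meson openin_proj_plane openin_subset openin_topspace subset_antisym)
qed

lemma quotient_map_proj_pt: "quotient_map (top_of_set (- {0})) proj_plane proj_pt"
  unfolding quotient_map_def topspace_proj_plane
  by (auto simp: openin_proj_plane openin_open_eq open_Compl Int_def conj_commute)

definition homog :: "real^2 \<Rightarrow> real^3"
  where "homog p = vector [p $ 1, p $ 2, 1]"

definition affine_pt :: "real^2 \<Rightarrow> (real^3) set"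
  where "affine_pt p = proj_pt (homog p)"


section \<open>Conics\<close>

text \<open>A quadratic equation is given by the symmetric matrix of its homogenisation; the conic is
  nondegenerate iff this matrix is invertible.\<close>

definition quad_form :: "real^3^3 \<Rightarrow> real^3 \<Rightarrow> real"
  where "quad_form A v = v \<bullet> (A *v v)"

definition affine_quadric :: "real^3^3 \<Rightarrow> real^2 \<Rightarrow> real"
  where "affine_quadric A p = quad_form A (homog p)"

definition nondegenerate_quadric :: "real^3^3 \<Rightarrow> bool"
  where "nondegenerate_quadric A \<longleftrightarrow> transpose A = A \<and> invertible A"

definition conic :: "real^3^3 \<Rightarrow> (real^3) set set"
  where "conic A = {proj_pt v | v. v \<noteq> 0 \<and> quad_form A v = 0}"

definition meets_with_multiplicity :: "real^3^3 \<Rightarrow> (real \<Rightarrow> real^2) \<Rightarrow> real \<Rightarrow> nat \<Rightarrow> bool"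
  where "meets_with_multiplicity A \<gamma> t k \<longleftrightarrow>
    (\<forall>j<k. (deriv ^^ j) (affine_quadric A \<circ> \<gamma>) t = 0)"

definition osculating_conic :: "(real \<Rightarrow> real^2) \<Rightarrow> real \<Rightarrow> (real^3) set set"
  where "osculating_conic \<gamma> t =
    (THE C. \<exists>A. nondegenerate_quadric A \<and> meets_with_multiplicity A \<gamma> t 5 \<and> C = conic A)"

text \<open>A nonempty nondegenerate conic separates the projective plane into an open disc and an open
  Moebius strip. Hence exactly one set \<open>D\<close> is an embedded closed disc with the conic as its
  boundary circle.\<close>

definition closed_disc_bounded_by :: "(real^3) set set \<Rightarrow> (real^3) set set \<Rightarrow> bool"
  where "closed_disc_bounded_by C D \<longleftrightarrow>
    (\<exists>f. embedding_map (top_of_set (cball (0 :: real^2) 1)) proj_plane f \<and>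
         f ` sphere 0 1 = C \<and> f ` cball 0 1 = D)"

definition inscribed :: "(real^3) set set \<Rightarrow> (real \<Rightarrow> real^2) \<Rightarrow> bool"
  where "inscribed C \<gamma> \<longleftrightarrow> C \<subseteq> affine_pt ` closed_region \<gamma>"

definition circumscribed :: "(real^3) set set \<Rightarrow> (real \<Rightarrow> real^2) \<Rightarrow> bool"
  where "circumscribed C \<gamma> \<longleftrightarrow>
    (\<exists>D. closed_disc_bounded_by C D \<and> affine_pt ` range \<gamma> \<subseteq> D)"


section \<open>Clean sextactic points\<close>

definition clean_maximal_sextactic :: "(real \<Rightarrow> real^2) \<Rightarrow> real \<Rightarrow> bool"
  where "clean_maximal_sextactic \<gamma> t \<longleftrightarrow>
    inscribed (osculating_conic \<gamma> t) \<gamma> \<and>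
    connected_on_circle {r. affine_pt (\<gamma> r) \<in> osculating_conic \<gamma> t}"

definition clean_minimal_sextactic :: "(real \<Rightarrow> real^2) \<Rightarrow> real \<Rightarrow> bool"
  where "clean_minimal_sextactic \<gamma> t \<longleftrightarrow>
    circumscribed (osculating_conic \<gamma> t) \<gamma> \<and>
    connected_on_circle {r. affine_pt (\<gamma> r) \<in> osculating_conic \<gamma> t}"

end

theory Submission
  imports Defs
begin

text \<open>The idea is to look at the conics from the points where they touch the curve. Let \<open>X\<close>, \<open>Y\<close> be the
affine coordinates with origin \<open>\<gamma> s\<close> and axes \<open>\<gamma>' s\<close>, \<open>\<gamma>'' s\<close>. The projective map \<open>u = X / Y\<close>, \<open>w = 1 / Y\<close>
sends the tangent at \<open>s\<close> to infinity, the curve without \<open>\<gamma> s\<close> to the graph of a function of \<open>u\<close> over the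
whole real line, and the conics tangent to \<open>\<gamma>\<close> at \<open>s\<close> to the parabolas \<open>w = a + b u + d u\<^sup>2\<close>. The osculating
conic is the parabola to which the graph is asymptotic at both ends. Let \<open>H s t\<close> be the height of the
curve over that parabola. Then the osculating conic is inscribed iff \<open>H s \<le> 0\<close> and circumscribed iff
\<open>H s \<ge> 0\<close>. A sign \<open>eps\<close> exchanges the two conditions, and everything in between is done for both at once.

Let \<open>M s\<close> be the maximum of \<open>eps * H s t\<close> over \<open>t\<close>, and \<open>A s\<close> the set where it is attained. The
conic \<open>F s = 0\<close> that corresponds to the osculating parabola shifted by \<open>eps * M s\<close> is the extremal one among the
conics that meet \<open>\<gamma>\<close> at \<open>s\<close> with multiplicity four; it touches \<open>\<gamma>\<close> at the points of \<open>A s\<close>. The point \<open>s\<close> is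
clean iff \<open>M s = 0\<close> and \<open>A s\<close> is an arc, possibly a single point.

The step (\<open>step_conic_right\<close>, \<open>step_conic_left\<close>). Let \<open>p \<in> A s\<close>, and suppose that some point between \<open>s\<close>
and \<open>p\<close> is not in \<open>A s\<close>. In the picture at \<open>s\<close>, choose between \<open>s\<close> and \<open>p\<close> a point \<open>x\<close> where the second
derivative of the gap \<open>eps * H s\<close> with respect to \<open>u\<close> is greatest. By Taylor's formula the parabola with the
same 2-jet at \<open>x\<close> lies above the gap up to \<open>p\<close>, and being convex it exceeds \<open>M s\<close> from \<open>p\<close> on. So it is the
extremal conic of \<open>x\<close>, it touches the curve at \<open>s\<close>, and it does not touch it beyond \<open>p\<close>: the contacts have
been confined to a smaller arc. Two conics are compared in this way only if they touch the curve at a common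
point, so that the comparison is one of two parabolas over the same axis.

Repetition. The relation \<open>improves\<close> says that the arc spanned by \<open>s\<close> and its contacts has become smaller
and that, outside this arc, the new form is nonnegative wherever the old one was. The second half is what
survives a passage to the limit: if a limit conic touched the curve outside an earlier arc, then its form
would have the wrong sign at points of the plane where the earlier form is positive. So every increasing
sequence has an upper bound, and \<open>ordering_principle\<close> gives an arc that cannot be shortened. By the step,
its base point is clean (\<open>clean_in_window\<close>).

Counting (\<open>three_clean\<close>). There is a clean point \<open>p\<close>. If \<open>A p\<close> contains a proper arc, then \<open>\<gamma>\<close> runs on a
conic there and all points of the arc are clean. Otherwise the maximum of the second derivative of the gap
of \<open>p\<close> over the whole line gives a point \<open>s\<close> whose extremal conic touches \<open>\<gamma>\<close> at \<open>p\<close>. The step, applied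
on either side of \<open>s\<close> and followed by the repetition with the circle cut at \<open>p\<close>, produces a clean point in
each of the two open arcs between \<open>s\<close> and \<open>p\<close>. With \<open>p\<close> these are three.

That the curve becomes a graph over the whole line means that it lies strictly on one side of each tangent
(\<open>curve_above_tangent\<close>); this follows from the convexity of the region and the Jordan curve theorem. The
translation back to the projective plane is direct: if \<open>H s \<le> 0\<close>, each point of the osculating conic lies
on a chord of the curve (\<open>inscribed_if\<close>), and if \<open>H s \<ge> 0\<close>, a linear map of \<open>\<real>\<^sup>3\<close> that brings the
osculating form to diagonal shape embeds the unit disc as the disc that contains the curve
(\<open>circumscribed_if\<close>).\<close>

section \<open>Convexity with respect to a decreasing coordinate\<close>

lemma nondecreasing_if_deriv_nonneg:
  fixes f f' :: "real \<Rightarrow> real"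
  assumes D: "\<And>t. t \<in> {a<..<b} \<Longrightarrow> (f has_real_derivative f' t) (at t)"
    and "\<And>t. t \<in> {c<..<d} \<Longrightarrow> 0 \<le> f' t" and "a < c" "d < b" "c \<le> d"
  shows "f c \<le> f d"
proof (cases "c = d")
  case False
  then have "c < d" using assms by simp
  have "\<exists>l z. c < z \<and> z < d \<and> (f has_real_derivative l) (at z) \<and> f d - f c = (d - c) * l"
  proof (rule MVT)
    show "c < d" by fact
    show "continuous_on {c..d} f"
      by (intro continuous_at_imp_continuous_on ballI DERIV_isCont[OF assms(1)])
        (use assms in \<open>auto\<close>)
    fix x assume "c < x" "x < d"
    then show "f differentiable (at x)"
      using D[of x] assms(3,4) unfolding real_differentiable_def by force
  qed
  then obtain l z where lz: "c < z" "z < d" "(f has_real_derivative l) (at z)" "f d - f c = (d - c) * l"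
    by auto
  have "l = f' z"
    using lz assms by (intro DERIV_unique[OF lz(3) assms(1)]) auto
  then have "0 \<le> (d - c) * l"
    using assms(2)[of z] lz \<open>c < d\<close> by auto
  then show ?thesis using lz by simp
qed simp

text \<open>\<open>z\<close> and \<open>e\<close> are the first and second derivatives of \<open>h\<close> with respect to the decreasing coordinate \<open>u\<close>.
If \<open>e\<close> is greatest at \<open>x\<close>, then the difference of the 2-jet at \<open>x\<close> and \<open>h\<close> is convex in \<open>u\<close> with a double
zero at \<open>x\<close>.\<close>

lemma jet_dominates:
  fixes u u' h z e :: "real \<Rightarrow> real"
  assumes du: "\<And>t. t \<in> {a<..<b} \<Longrightarrow> (u has_real_derivative u' t) (at t)"
    and neg: "\<And>t. t \<in> {a<..<b} \<Longrightarrow> u' t < 0"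
    and dh: "\<And>t. t \<in> {a<..<b} \<Longrightarrow> (h has_real_derivative u' t * z t) (at t)"
    and dz: "\<And>t. t \<in> {a<..<b} \<Longrightarrow> (z has_real_derivative u' t * e t) (at t)"
    and x: "a < c" "c \<le> x" "x \<le> d" "d < b"
    and le: "\<And>t. t \<in> {c..d} \<Longrightarrow> e t \<le> e x"
    and t: "t \<in> {c..d}"
  shows "h t \<le> h x + z x * (u t - u x) + e x / 2 * (u t - u x)\<^sup>2"
    and "t \<le> x \<Longrightarrow> z t \<le> z x + e x * (u t - u x)"
    and "x \<le> t \<Longrightarrow> z x + e x * (u t - u x) \<le> z t"
proof -
  \<comment> \<open>the slope in \<open>u\<close> of the difference of the jet and \<open>h\<close>\<close>
  define g where "g t = z x + e x * (u t - u x) - z t" for t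
  have dg: "(g has_real_derivative u' t * (e x - e t)) (at t)" if "t \<in> {a<..<b}" for t
    unfolding g_def
    by (rule derivative_eq_intros du[OF that] dz[OF that] refl | simp add: algebra_simps)+
  have dgm: "((\<lambda>t. - g t) has_real_derivative - (u' t * (e x - e t))) (at t)" if "t \<in> {a<..<b}" for t
    using dg[OF that] by (rule DERIV_minus)
  have g1: "0 \<le> g t" if "c \<le> t" "t \<le> x" for t
  proof -
    have "- g t \<le> - g x"
      by (rule nondecreasing_if_deriv_nonneg[OF dgm])
        (use that x le neg in \<open>auto simp: mult_nonpos_nonneg less_imp_le\<close>)
    then show ?thesis by (simp add: g_def)
  qed
  have g2: "g t \<le> 0" if "x \<le> t" "t \<le> d" for t
  proof -
    have "- g x \<le> - g t"
      by (rule nondecreasing_if_deriv_nonneg[OF dgm])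
        (use that x le neg in \<open>auto simp: mult_nonpos_nonneg less_imp_le\<close>)
    then show ?thesis by (simp add: g_def)
  qed
  show "t \<le> x \<Longrightarrow> z t \<le> z x + e x * (u t - u x)"
    using g1[of t] t by (simp add: g_def)
  show "x \<le> t \<Longrightarrow> z x + e x * (u t - u x) \<le> z t"
    using g2[of t] t by (simp add: g_def)
  define G where "G t = h x + z x * (u t - u x) + e x / 2 * (u t - u x)\<^sup>2 - h t" for t
  have dG: "(G has_real_derivative u' t * g t) (at t)" if "t \<in> {a<..<b}" for t
    unfolding G_def g_def
    by (rule derivative_eq_intros du[OF that] dh[OF that] refl | simp add: algebra_simps)+
  have dGm: "((\<lambda>t. - G t) has_real_derivative - (u' t * g t)) (at t)" if "t \<in> {a<..<b}" for t
    using dG[OF that] by (rule DERIV_minus)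
  have "0 \<le> G t"
  proof (cases "t \<le> x")
    case True
    have "- G t \<le> - G x"
      by (rule nondecreasing_if_deriv_nonneg[OF dGm])
        (use True t x g1 neg in \<open>auto simp: mult_nonpos_nonneg less_imp_le\<close>)
    then show ?thesis by (simp add: G_def)
  next
    case False
    have "G x \<le> G t"
      by (rule nondecreasing_if_deriv_nonneg[OF dG])
        (use False t x g2 neg in \<open>auto simp: mult_nonpos_nonpos less_imp_le\<close>)
    then show ?thesis by (simp add: G_def)
  qed
  then show "h t \<le> h x + z x * (u t - u x) + e x / 2 * (u t - u x)\<^sup>2"
    by (simp add: G_def)
qed

lemma interior_max:
  fixes u' h z e :: "real \<Rightarrow> real"
  assumes neg: "\<And>t. t \<in> {a<..<b} \<Longrightarrow> u' t < 0"
    and dh: "\<And>t. t \<in> {a<..<b} \<Longrightarrow> (h has_real_derivative u' t * z t) (at t)"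
    and dz: "\<And>t. t \<in> {a<..<b} \<Longrightarrow> (z has_real_derivative u' t * e t) (at t)"
    and x: "x \<in> {a<..<b}" and mx: "\<And>t. t \<in> {a<..<b} \<Longrightarrow> h t \<le> h x"
  shows "z x = 0" and "e x \<le> 0"
proof -
  define d where "d = min (x - a) (b - x)"
  have d: "0 < d" "\<And>t. \<bar>x - t\<bar> < d \<Longrightarrow> t \<in> {a<..<b}"
    using x by (auto simp: d_def)
  have "u' x * z x = 0"
    by (rule DERIV_local_max[OF dh[OF x] d(1)]) (use d mx in auto)
  then show z0: "z x = 0" using neg[OF x] by simp
  show "e x \<le> 0"
  proof (rule ccontr)
    assume "\<not> e x \<le> 0"
    then have "u' x * e x < 0" using neg[OF x] by (simp add: mult_neg_pos)
    from DERIV_neg_dec_left[OF dz[OF x] this] obtain k where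
      k: "0 < k" "\<And>y. 0 < y \<Longrightarrow> y < k \<Longrightarrow> z x < z (x - y)" by blast
    define y where "y = min d k / 2"
    have y: "0 < y" "y < d" "y < k" using d k by (auto simp: y_def)
    have dhm: "((\<lambda>t. - h t) has_real_derivative - (u' t * z t)) (at t)" if "t \<in> {a<..<b}" for t
      using dh[OF that] by (rule DERIV_minus)
    have zp: "0 < z t" if "t \<in> {x-y<..<x}" for t
      using k(2)[of "x - t"] that y z0 by auto
    have inab: "t \<in> {a<..<b}" if "t \<in> {x-y..x}" for t
      using d(2)[of t] that y by auto
    have "h x < h (x - y)"
    proof (rule DERIV_neg_imp_decreasing_open[of "x - y" x h])
      show "x - y < x" using y by simp
      fix t assume "x - y < t" "t < x"
      then show "\<exists>l. (h has_real_derivative l) (at t) \<and> l < 0"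
        using dh[of t] inab[of t] zp[of t] neg[of t] by (auto intro!: exI[of _ "u' t * z t"] mult_neg_pos)
    next
      show "continuous_on {x - y..x} h"
        by (intro continuous_at_imp_continuous_on ballI DERIV_isCont[OF dh[OF inab]])
    qed
    then show False using mx[of "x - y"] inab[of "x - y"] y by auto
  qed
qed

text \<open>As \<open>t\<close> tends to \<open>s\<close> the coordinate \<open>u\<close> tends to infinity, so a slope that stays below a negative constant
would force \<open>h\<close> down to minus infinity.\<close>

lemma slope_nonneg_if_bounded_below:
  fixes u u' h z :: "real \<Rightarrow> real"
  assumes du: "\<And>t. t \<in> {s<..<b} \<Longrightarrow> (u has_real_derivative u' t) (at t)"
    and neg: "\<And>t. t \<in> {s<..<b} \<Longrightarrow> u' t < 0"
    and dh: "\<And>t. t \<in> {s<..<b} \<Longrightarrow> (h has_real_derivative u' t * z t) (at t)"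
    and u: "filterlim u at_top (at_right s)"
    and B: "\<And>t. t \<in> {s<..<b} \<Longrightarrow> B \<le> h t"
    and x: "s < x" "x < b" and mono: "\<And>t. t \<in> {s<..<x} \<Longrightarrow> z t \<le> z x"
  shows "0 \<le> z x"
proof (rule ccontr)
  assume "\<not> 0 \<le> z x"
  then have zn: "z x < 0" by simp
  define k where "k t = h t - z x * u t" for t
  have dk: "(k has_real_derivative u' t * (z t - z x)) (at t)" if "t \<in> {s<..<b}" for t
    unfolding k_def
    by (rule derivative_eq_intros du[OF that] dh[OF that] refl | simp add: algebra_simps)+
  have kle: "k t \<le> k x" if "s < t" "t \<le> x" for t
    by (rule nondecreasing_if_deriv_nonneg[OF dk])
      (use that x mono neg in \<open>auto intro!: mult_nonpos_nonpos simp: less_imp_le\<close>)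
  have "eventually (\<lambda>t. u t > (B - k x) / z x) (at_right s)"
    using u by (simp add: filterlim_at_top_dense)
  moreover have "eventually (\<lambda>t. t \<in> {s<..<x}) (at_right s)"
    using eventually_at_right_real[OF x(1)] by simp
  ultimately have "eventually (\<lambda>t. u t > (B - k x) / z x \<and> t \<in> {s<..<x}) (at_right s)"
    by (rule eventually_conj)
  then obtain t where t: "u t > (B - k x) / z x" "t \<in> {s<..<x}"
    using eventually_happens'[OF trivial_limit_at_right_real] by blast
  have "h t < B"
    using kle[of t] t zn by (simp add: k_def field_simps)
  then show False using B[of t] t x by auto
qed

text \<open>This is the analytic core. If \<open>e\<close> were nonpositive between \<open>s\<close> and \<open>p\<close>, then \<open>h\<close> would be concave in \<open>u\<close>
there, bounded at infinity and stationary at \<open>p\<close>, hence constant. So \<open>e\<close> has a positive maximum at some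
\<open>x\<close>, strictly between \<open>s\<close> and \<open>p\<close> because \<open>e s = 0\<close> and \<open>e p \<le> 0\<close>. The 2-jet at \<open>x\<close> is then a convex
parabola which lies below \<open>M\<close> at \<open>x\<close> and at or above it at \<open>p\<close>, and so above it from there on.\<close>

lemma jet_exceeding_right:
  fixes u u' h z e :: "real \<Rightarrow> real"
  assumes du: "\<And>t. t \<in> {s<..<q} \<Longrightarrow> (u has_real_derivative u' t) (at t)"
    and neg: "\<And>t. t \<in> {s<..<q} \<Longrightarrow> u' t < 0"
    and dh: "\<And>t. t \<in> {s<..<q} \<Longrightarrow> (h has_real_derivative u' t * z t) (at t)"
    and dz: "\<And>t. t \<in> {s<..<q} \<Longrightarrow> (z has_real_derivative u' t * e t) (at t)"
    and p: "s < p" "p < q"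
    and ce: "continuous_on {s..p} e" "e s = 0"
    and u: "filterlim u at_top (at_right s)"
    and B: "\<And>t. t \<in> {s<..<q} \<Longrightarrow> B \<le> h t"
    and M: "\<And>t. t \<in> {s<..<q} \<Longrightarrow> h t \<le> M" "h p = M"
    and m: "m \<in> {s<..<p}" "h m < M"
  obtains x where "x \<in> {s<..<p}"
    "\<And>t. t \<in> {s<..p} \<Longrightarrow> h t \<le> h x + z x * (u t - u x) + e x / 2 * (u t - u x)\<^sup>2"
    "\<And>v. v \<le> u p \<Longrightarrow> M < h x + z x * (v - u x) + e x / 2 * (v - u x)\<^sup>2"
proof -
  have mxp: "z p = 0" "e p \<le> 0"
    by (rule interior_max[OF neg dh dz, of s q p]; use p M in auto)+
  have "\<exists>t\<in>{s<..<p}. 0 < e t"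
  proof (rule ccontr)
    assume "\<not> ?thesis"
    then have e0: "e t \<le> 0" if "t \<in> {s<..<p}" for t using that by force
    have zmono: "z t \<le> z r" if "s < t" "t \<le> r" "r \<le> p" for t r
      by (rule nondecreasing_if_deriv_nonneg[OF dz])
        (use that p e0 neg in \<open>auto intro!: mult_nonpos_nonpos simp: less_imp_le\<close>)
    have z0: "z t = 0" if "s < t" "t \<le> p" for t
    proof (rule antisym)
      show "z t \<le> 0" using zmono[of t p] that mxp by simp
      show "0 \<le> z t"
        by (rule slope_nonneg_if_bounded_below[OF du neg dh u B, of q])
          (use that p zmono in auto)
    qed
    have dhm: "((\<lambda>t. - h t) has_real_derivative - (u' t * z t)) (at t)" if "t \<in> {s<..<q}" for t
      using dh[OF that] by (rule DERIV_minus)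
    have "- h m \<le> - h p"
      by (rule nondecreasing_if_deriv_nonneg[OF dhm]) (use m p z0 in auto)
    then show False using m M by simp
  qed
  then obtain r where r: "r \<in> {s<..<p}" "0 < e r" by blast
  obtain x where x: "x \<in> {s..p}" "\<And>t. t \<in> {s..p} \<Longrightarrow> e t \<le> e x"
    using continuous_attains_sup[of "{s..p}" e] ce p by auto
  have ex: "0 < e x" using x(2)[of r] r by auto
  then have xs: "s < x" "x < p"
    using x ce mxp by (auto simp: less_le)
  have hx: "h x < M"
  proof (rule ccontr)
    assume "\<not> h x < M"
    then have "h x = M" using M(1)[of x] xs p by auto
    then have "e x \<le> 0"
      by (intro interior_max(2)[OF neg dh dz, of s q x]) (use xs p M in auto)
    then show False using ex by simp
  qed
  define P where "P v = h x + z x * (v - u x) + e x / 2 * (v - u x)\<^sup>2" for v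
  have P1: "h t \<le> P (u t)" if "t \<in> {s<..p}" for t
    unfolding P_def
    by (rule jet_dominates(1)[OF du neg dh dz, of s q "min t x" x p])
      (use that xs p x in auto)
  have slope: "z x + e x * (u t - u x) \<le> z t" if "t \<in> {x..p}" for t
    by (rule jet_dominates(3)[OF du neg dh dz, of s q x x p])
      (use that xs p x in auto)
  have upx: "u p < u x"
  proof (rule DERIV_neg_imp_decreasing[OF xs(2), of u])
    fix t assume "x \<le> t" "t \<le> p"
    then show "\<exists>l. (u has_real_derivative l) (at t) \<and> l < 0"
      using du[of t] neg[of t] xs p by auto
  qed
  define L where "L = z x + e x * (u p - u x)"
  have L0: "L \<le> 0" using slope[of p] xs mxp by (simp add: L_def)
  have Pexp: "P v = P (u p) + L * (v - u p) + e x / 2 * (v - u p)\<^sup>2" for v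
    unfolding P_def L_def by (simp add: field_simps power2_eq_square)
  have Pp: "M \<le> P (u p)" using P1[of p] p M by simp
  \<comment> \<open>equality at \<open>p\<close> would force the jet and \<open>h\<close> to agree from \<open>x\<close> to \<open>p\<close>, hence slope 0 at \<open>p\<close>\<close>
  have MP: "M < P (u p)"
  proof (rule ccontr)
    assume "\<not> M < P (u p)"
    then have eq: "P (u p) = M" using Pp by simp
    define G where "G t = P (u t) - h t" for t
    have dG: "(G has_real_derivative u' t * (z x + e x * (u t - u x) - z t)) (at t)" if "t \<in> {s<..<q}" for t
      unfolding G_def P_def
      by (rule derivative_eq_intros du[OF that] dh[OF that] refl | simp add: algebra_simps)+
    have G0: "G t = 0" if "t \<in> {x..p}" for t
    proof (rule antisym)
      have "G t \<le> G p"
        by (rule nondecreasing_if_deriv_nonneg[OF dG])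
          (use that xs p slope neg in \<open>auto intro!: mult_nonpos_nonpos simp: less_imp_le\<close>)
      then show "G t \<le> 0" using eq M by (simp add: G_def)
      show "0 \<le> G t" using P1[of t] that xs by (auto simp: G_def)
    qed
    have "u' p * (L - z p) = 0"
    proof -
      have D: "(G has_real_derivative u' p * (L - z p)) (at p)"
        using dG[of p] p by (simp add: L_def)
      show ?thesis
      proof (rule ccontr)
        assume n: "u' p * (L - z p) \<noteq> 0"
        then have "L < 0" using mxp L0 by (auto simp: less_le)
        then have "0 < u' p * (L - z p)" using neg[of p] p mxp by (simp add: mult_neg_neg)
        from DERIV_pos_inc_left[OF D this] obtain k where
          k: "0 < k" "\<And>y. 0 < y \<Longrightarrow> y < k \<Longrightarrow> G (p - y) < G p" by blast
        define y where "y = min k (p - x) / 2"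
        have "0 < y" "y < k" "y < p - x" using k xs by (auto simp: y_def)
        then show False using k(2)[of y] G0[of "p - y"] G0[of p] xs by auto
      qed
    qed
    then have "L = 0" using neg[of p] p mxp by auto
    then have "P (u x) = M + e x / 2 * (u x - u p)\<^sup>2" using Pexp[of "u x"] eq by simp
    moreover have "P (u x) = h x" by (simp add: P_def)
    moreover have "0 \<le> e x / 2 * (u x - u p)\<^sup>2" using ex by simp
    ultimately show False using hx by simp
  qed
  have P2: "M < P v" if "v \<le> u p" for v
  proof -
    have "0 \<le> L * (v - u p)" using L0 that by (simp add: mult_nonpos_nonpos)
    moreover have "0 \<le> e x / 2 * (v - u p)\<^sup>2" using ex by simp
    ultimately show ?thesis using Pexp[of v] MP by linarith
  qed
  show ?thesis
    using that[of x] xs P1 P2 unfolding P_def by auto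
qed

text \<open>The mirror image, obtained by the substitution \<open>t \<mapsto> - t\<close>, \<open>u \<mapsto> - u\<close>, which leaves second derivatives
unchanged.\<close>

lemma jet_exceeding_left:
  fixes u u' h z e :: "real \<Rightarrow> real"
  assumes du: "\<And>t. t \<in> {q<..<s} \<Longrightarrow> (u has_real_derivative u' t) (at t)"
    and neg: "\<And>t. t \<in> {q<..<s} \<Longrightarrow> u' t < 0"
    and dh: "\<And>t. t \<in> {q<..<s} \<Longrightarrow> (h has_real_derivative u' t * z t) (at t)"
    and dz: "\<And>t. t \<in> {q<..<s} \<Longrightarrow> (z has_real_derivative u' t * e t) (at t)"
    and p: "q < p" "p < s"
    and ce: "continuous_on {p..s} e" "e s = 0"
    and u: "filterlim u at_bot (at_left s)"
    and B: "\<And>t. t \<in> {q<..<s} \<Longrightarrow> B \<le> h t"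
    and M: "\<And>t. t \<in> {q<..<s} \<Longrightarrow> h t \<le> M" "h p = M"
    and m: "m \<in> {p<..<s}" "h m < M"
  obtains x where "x \<in> {p<..<s}"
    "\<And>t. t \<in> {p..<s} \<Longrightarrow> h t \<le> h x + z x * (u t - u x) + e x / 2 * (u t - u x)\<^sup>2"
    "\<And>v. u p \<le> v \<Longrightarrow> M < h x + z x * (v - u x) + e x / 2 * (v - u x)\<^sup>2"
proof -
  have D: "((\<lambda>t. - f (-t)) has_real_derivative d (-t)) (at t)"
    if "(f has_real_derivative d (-t)) (at (-t))" for f d and t :: real
  proof -
    have "((\<lambda>t. f (- t)) has_real_derivative d (-t) * - 1) (at t)"
      by (rule DERIV_chain2[of f _ uminus, OF that]) (auto intro!: derivative_eq_intros)
    from DERIV_minus[OF this] show ?thesis by simp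
  qed
  have D': "((\<lambda>t. f (-t)) has_real_derivative - d (-t)) (at t)"
    if "(f has_real_derivative d (-t)) (at (-t))" for f d and t :: real
    using DERIV_minus[OF D[of f d t, OF that]] by simp
  obtain x where x: "x \<in> {-s<..<-p}"
    "\<And>t. t \<in> {-s<..-p} \<Longrightarrow> h (- t) \<le> h (- x) + - z (- x) * (- u (- t) - - u (- x)) + e (- x) / 2 * (- u (- t) - - u (- x))\<^sup>2"
    "\<And>v. v \<le> - u (- (- p)) \<Longrightarrow> M < h (- x) + - z (- x) * (v - - u (- x)) + e (- x) / 2 * (v - - u (- x))\<^sup>2"
  proof (rule jet_exceeding_right[of "-s" "-q" "\<lambda>t. - u (-t)" "\<lambda>t. u' (-t)" "\<lambda>t. h (-t)" "\<lambda>t. - z (-t)" "\<lambda>t. e (-t)" "-p" B M "-m"])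
    fix t assume t: "t \<in> {-s<..<-q}"
    then have t': "-t \<in> {q<..<s}" by auto
    show "((\<lambda>t. - u (-t)) has_real_derivative u' (-t)) (at t)" by (rule D[of u u' t, OF du[OF t']])
    show "u' (-t) < 0" by (rule neg[OF t'])
    show "((\<lambda>t. h (-t)) has_real_derivative u' (-t) * - z (-t)) (at t)"
      using D'[of h "\<lambda>r. u' r * z r" t, OF dh[OF t']] by simp
    show "((\<lambda>t. - z (-t)) has_real_derivative u' (-t) * e (-t)) (at t)"
      using D[of z "\<lambda>r. u' r * e r" t, OF dz[OF t']] by simp
    show "B \<le> h (-t)" "h (-t) \<le> M" using B[OF t'] M(1)[OF t'] by auto
  next
    show "continuous_on {-s..-p} (\<lambda>t. e (-t))"
      by (rule continuous_on_compose2[OF ce(1)]) (auto intro!: continuous_intros)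
    have "filterlim (\<lambda>t. u (- t)) at_bot (at_right (-s))"
      using u by (subst (asm) filterlim_at_left_to_right) simp
    then show "filterlim (\<lambda>t. - u (- t)) at_top (at_right (-s))"
      by (simp add: filterlim_uminus_at_top)
  qed (use p m M ce in auto)
  show ?thesis
  proof (rule that[of "-x"])
    show "-x \<in> {p<..<s}" using x by auto
    show "h t \<le> h (- x) + z (- x) * (u t - u (- x)) + e (- x) / 2 * (u t - u (- x))\<^sup>2" if "t \<in> {p..<s}" for t
      using x(2)[of "-t"] that by (simp add: algebra_simps power2_eq_square)
    show "M < h (- x) + z (- x) * (v - u (- x)) + e (- x) / 2 * (v - u (- x))\<^sup>2" if "u p \<le> v" for v
      using x(3)[of "-v"] that by (simp add: algebra_simps power2_eq_square)
  qed
qed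

text \<open>The same argument over the whole line: a nonconstant function of \<open>u\<close> that is bounded below is not concave,
and so \<open>e\<close> has a positive maximum, away from the ends where it vanishes.\<close>

lemma jet_dominates_globally:
  fixes u u' h z e :: "real \<Rightarrow> real"
  assumes du: "\<And>t. t \<in> {s<..<q} \<Longrightarrow> (u has_real_derivative u' t) (at t)"
    and neg: "\<And>t. t \<in> {s<..<q} \<Longrightarrow> u' t < 0"
    and dh: "\<And>t. t \<in> {s<..<q} \<Longrightarrow> (h has_real_derivative u' t * z t) (at t)"
    and dz: "\<And>t. t \<in> {s<..<q} \<Longrightarrow> (z has_real_derivative u' t * e t) (at t)"
    and ce: "continuous_on {s..q} e" "e s = 0" "e q = 0"
    and u: "filterlim u at_top (at_right s)" "filterlim u at_bot (at_left q)"
    and B: "\<And>t. t \<in> {s<..<q} \<Longrightarrow> B \<le> h t"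
    and m: "m \<in> {s<..<q}" "r \<in> {s<..<q}" "h m \<noteq> h r"
  obtains x where "x \<in> {s<..<q}"
    "\<And>t. t \<in> {s<..<q} \<Longrightarrow> h t \<le> h x + z x * (u t - u x) + e x / 2 * (u t - u x)\<^sup>2"
proof -
  have D: "((\<lambda>t. - f (-t)) has_real_derivative d (-t)) (at t)"
    if "(f has_real_derivative d (-t)) (at (-t))" for f d and t :: real
  proof -
    have "((\<lambda>t. f (- t)) has_real_derivative d (-t) * - 1) (at t)"
      by (rule DERIV_chain2[of f _ uminus, OF that]) (auto intro!: derivative_eq_intros)
    from DERIV_minus[OF this] show ?thesis by simp
  qed
  have "\<exists>t\<in>{s<..<q}. 0 < e t"
  proof (rule ccontr)
    assume "\<not> ?thesis"
    then have e0: "e t \<le> 0" if "t \<in> {s<..<q}" for t using that by force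
    have zmono: "z t \<le> z r" if "s < t" "t \<le> r" "r < q" for t r
      by (rule nondecreasing_if_deriv_nonneg[OF dz])
        (use that e0 neg in \<open>auto intro!: mult_nonpos_nonpos simp: less_imp_le\<close>)
    have z0: "z t = 0" if "t \<in> {s<..<q}" for t
    proof (rule antisym)
      show "0 \<le> z t"
        by (rule slope_nonneg_if_bounded_below[OF du neg dh u(1) B, of q])
          (use that zmono in auto)
      have "0 \<le> - z (- (- t))"
      proof (rule slope_nonneg_if_bounded_below[of "-q" "-s" "\<lambda>t. - u (-t)" "\<lambda>t. u' (-t)" "\<lambda>t. h (-t)" "\<lambda>t. - z (-t)" B "-t"])
        fix t assume t: "t \<in> {-q<..<-s}"
        then have t': "-t \<in> {s<..<q}" by auto
        show "((\<lambda>t. - u (-t)) has_real_derivative u' (-t)) (at t)" by (rule D[of u u' t, OF du[OF t']])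
        show "u' (-t) < 0" by (rule neg[OF t'])
        show "((\<lambda>t. h (-t)) has_real_derivative u' (-t) * - z (-t)) (at t)"
          using DERIV_minus[OF D[of h "\<lambda>r. u' r * z r" t, OF dh[OF t']]] by simp
        show "B \<le> h (-t)" using B[OF t'] by auto
      next
        have "filterlim (\<lambda>t. u (- t)) at_bot (at_right (-q))"
          using u(2) by (subst (asm) filterlim_at_left_to_right) simp
        then show "filterlim (\<lambda>t. - u (- t)) at_top (at_right (-q))"
          by (simp add: filterlim_uminus_at_top)
        show "- z (- r) \<le> - z (- (- t))" if "r \<in> {-q<..<-t}" for r
          using zmono[of t "-r"] that \<open>t \<in> {s<..<q}\<close> by auto
      qed (use that in auto)
      then show "z t \<le> 0" by simp
    qed
    have const: "h a \<le> h b" if "s < a" "a \<le> b" "b < q" for a b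
      by (rule nondecreasing_if_deriv_nonneg[OF dh]) (use that z0 in auto)
    have dhm: "((\<lambda>t. - h t) has_real_derivative - (u' t * z t)) (at t)" if "t \<in> {s<..<q}" for t
      using dh[OF that] by (rule DERIV_minus)
    have const': "- h a \<le> - h b" if "s < a" "a \<le> b" "b < q" for a b
      by (rule nondecreasing_if_deriv_nonneg[OF dhm]) (use that z0 in auto)
    show False
      using const[of m r] const'[of m r] const[of r m] const'[of r m] m by (cases "m \<le> r") auto
  qed
  then obtain r where r: "r \<in> {s<..<q}" "0 < e r" by blast
  obtain x where x: "x \<in> {s..q}" "\<And>t. t \<in> {s..q} \<Longrightarrow> e t \<le> e x"
    using continuous_attains_sup[of "{s..q}" e] ce r by auto
  have ex: "0 < e x" using x(2)[of r] r by auto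
  then have xs: "s < x" "x < q"
    using x ce by (auto simp: less_le)
  show ?thesis
  proof (rule that[of x])
    show "x \<in> {s<..<q}" using xs by simp
    show "h t \<le> h x + z x * (u t - u x) + e x / 2 * (u t - u x)\<^sup>2" if t: "t \<in> {s<..<q}" for t
    proof (rule jet_dominates(1)[OF du neg dh dz, of s q "min t x" x "max t x"])
      show "s < min t x" "min t x \<le> x" "x \<le> max t x" "max t x < q" "t \<in> {min t x..max t x}"
        using t xs by auto
      show "e r \<le> e x" if "r \<in> {min t x..max t x}" for r
        using that t xs x(2)[of r] by (cases "t \<le> x") auto
    qed auto
  qed
qed

text \<open>The ordering principle of Brezis and Browder: along a sequence in which each step nearly exhausts the
possible decrease of \<open>l\<close>, any upper bound admits no further decrease.\<close>

lemma ordering_principle: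
  fixes r :: "'a \<Rightarrow> 'a \<Rightarrow> bool" and l :: "'a \<Rightarrow> real"
  assumes refl: "\<And>x. D x \<Longrightarrow> r x x"
    and trans: "\<And>x y z. r x y \<Longrightarrow> r y z \<Longrightarrow> r x z"
    and mono: "\<And>x y. r x y \<Longrightarrow> l y \<le> l x"
    and low: "\<And>x. B \<le> l x"
    and seq: "\<And>f :: nat \<Rightarrow> 'a. (\<And>n. r (f n) (f (Suc n))) \<Longrightarrow> \<exists>y. \<forall>n. r (f n) y"
    and D: "D x0" "\<And>x y. r x y \<Longrightarrow> D y"
  obtains y where "r x0 y" "\<And>x. r y x \<Longrightarrow> l y \<le> l x"
proof -
  have "\<exists>y. r x y \<and> (\<forall>w. r x w \<longrightarrow> l y \<le> l w + 1 / real (Suc n))" if "D x" for x and n :: nat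
  proof -
    define S where "S = l ` {w. r x w}"
    have S: "S \<noteq> {}" "bdd_below S"
      using refl that low by (auto simp: S_def bdd_below_def)
    have "Inf S < Inf S + 1 / real (Suc n)" by simp
    from cInf_lessD[OF S(1) this] obtain y where y: "r x y" "l y < Inf S + 1 / real (Suc n)"
      by (auto simp: S_def)
    have "l y \<le> l w + 1 / real (Suc n)" if "r x w" for w
      using cInf_lower[of "l w" S] S that y by (auto simp: S_def)
    with y show ?thesis by blast
  qed
  note ex = this
  define nxt where "nxt n x = (SOME y. r x y \<and> (\<forall>w. r x w \<longrightarrow> l y \<le> l w + 1 / real (Suc n)))" for n x
  have nxt: "r x (nxt n x)" "r x w \<Longrightarrow> l (nxt n x) \<le> l w + 1 / real (Suc n)" if "D x" for x n w
    using someI_ex[OF ex[OF that, of n]] unfolding nxt_def by blast+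
  define f where "f = rec_nat x0 (\<lambda>n x. nxt n x)"
  have f: "f 0 = x0" "\<And>n. f (Suc n) = nxt n (f n)" by (auto simp: f_def)
  have Df: "D (f n)" for n
  proof (induction n)
    case (Suc n)
    show ?case unfolding f(2) by (rule D(2)[OF nxt(1)[OF Suc]])
  qed (simp add: f D(1))
  obtain y where y: "\<And>n. r (f n) y" using seq[of f, unfolded f(2), OF nxt(1)[OF Df]] by blast
  show ?thesis
  proof (rule that)
    show "r x0 y" using y[of 0] unfolding f(1) .
    fix x assume "r y x"
    have "l y \<le> l x + 1 / real (Suc n)" for n
    proof -
      have "l y \<le> l (f (Suc n))" using mono y by blast
      also have "\<dots> \<le> l x + 1 / real (Suc n)"
        unfolding f(2) by (rule nxt(2)[OF Df trans[OF y \<open>r y x\<close>]])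
      finally show ?thesis .
    qed
    moreover have "(\<lambda>n. l x + 1 / real (Suc n)) \<longlonglongrightarrow> l x + 0"
      by (intro tendsto_intros LIMSEQ_Suc[OF lim_1_over_n])
    ultimately have "l y \<le> l x + 0"
      by (intro LIMSEQ_le_const) auto
    then show "l y \<le> l x" by simp
  qed
qed

section \<open>Periodic functions and Taylor expansions\<close>

lemma periodic_int:
  fixes f :: "real \<Rightarrow> 'a"
  assumes "\<And>t. f (t + c) = f t"
  shows "f (t + c * of_int n) = f t"
proof (induction n rule: int_induct[where k = 0])
  case (step1 i)
  then show ?case using assms[of "t + c * of_int i"] by (simp add: algebra_simps)
next
  case (step2 i)
  then show ?case using assms[of "t + c * of_int (i - 1)"] by (simp add: algebra_simps)
qed simp

lemma taylor_vanishing2: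
  fixes f0 f1 f2 :: "real \<Rightarrow> real"
  assumes "\<And>t. (f0 has_real_derivative f1 t) (at t)" "\<And>t. (f1 has_real_derivative f2 t) (at t)"
    and "f0 s = 0" "f1 s = 0"
  shows "\<exists>r. \<bar>r - s\<bar> \<le> \<bar>t - s\<bar> \<and> f0 t = f2 r / 2 * (t - s)\<^sup>2"
proof (cases "t = s")
  case False
  define D where "D = (\<lambda>j::nat. if j = 0 then f0 else if j = 1 then f1 else f2)"
  have "\<exists>r. (if t < s then t < r \<and> r < s else s < r \<and> r < t) \<and>
      D 0 t = (\<Sum>m<2. D m s / fact m * (t - s) ^ m) + D 2 r / fact 2 * (t - s) ^ 2"
    by (rule Taylor[where a = "min s t" and b = "max s t"])
      (use assms False in \<open>auto simp: D_def less_Suc_eq numeral_2_eq_2\<close>)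
  then obtain r where "if t < s then t < r \<and> r < s else s < r \<and> r < t"
      "f0 t = f2 r / 2 * (t - s)\<^sup>2"
    using assms by (auto simp: D_def numeral_2_eq_2)
  then show ?thesis by (intro exI[of _ r]) (auto split: if_splits)
qed (use assms in \<open>auto intro!: exI[of _ s]\<close>)

lemma taylor_vanishing4:
  fixes f0 f1 f2 f3 f4 :: "real \<Rightarrow> real"
  assumes "\<And>t. (f0 has_real_derivative f1 t) (at t)" "\<And>t. (f1 has_real_derivative f2 t) (at t)"
    "\<And>t. (f2 has_real_derivative f3 t) (at t)" "\<And>t. (f3 has_real_derivative f4 t) (at t)"
    and "f0 s = 0" "f1 s = 0" "f2 s = 0" "f3 s = 0"
  shows "\<exists>r. \<bar>r - s\<bar> \<le> \<bar>t - s\<bar> \<and> f0 t = f4 r / 24 * (t - s) ^ 4"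
proof (cases "t = s")
  case False
  define D where "D = (\<lambda>j::nat. if j = 0 then f0 else if j = 1 then f1 else if j = 2 then f2
    else if j = 3 then f3 else f4)"
  have "\<exists>r. (if t < s then t < r \<and> r < s else s < r \<and> r < t) \<and>
      D 0 t = (\<Sum>m<4. D m s / fact m * (t - s) ^ m) + D 4 r / fact 4 * (t - s) ^ 4"
  proof (rule Taylor[where a = "min s t" and b = "max s t"])
    show "\<forall>m t'. m < 4 \<and> min s t \<le> t' \<and> t' \<le> max s t \<longrightarrow> (D m has_real_derivative D (Suc m) t') (at t')"
    proof (intro allI impI)
      fix m :: nat and t' assume "m < 4 \<and> min s t \<le> t' \<and> t' \<le> max s t"
      then have "m = 0 \<or> m = 1 \<or> m = 2 \<or> m = 3" by auto
      then show "(D m has_real_derivative D (Suc m) t') (at t')"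
        using assms by (auto simp: D_def)
    qed
  qed (use assms False in auto)
  moreover have "(\<Sum>m<4. D m s / fact m * (t - s) ^ m) = 0"
  proof (rule sum.neutral, intro ballI)
    fix m :: nat assume "m \<in> {..<4}"
    then have "m = 0 \<or> m = 1 \<or> m = 2 \<or> m = 3" by auto
    then show "D m s / fact m * (t - s) ^ m = 0"
      using assms by (auto simp: D_def)
  qed
  ultimately obtain r where "if t < s then t < r \<and> r < s else s < r \<and> r < t"
      "f0 t = f4 r / 24 * (t - s) ^ 4"
    by (auto simp: D_def fact_numeral)
  then show ?thesis by (intro exI[of _ r]) (auto split: if_splits)
qed (use assms in \<open>auto intro!: exI[of _ s]\<close>)

lemma second_order_limit:
  fixes f0 f1 f2 :: "real \<Rightarrow> real"
  assumes "\<And>t. (f0 has_real_derivative f1 t) (at t)" "\<And>t. (f1 has_real_derivative f2 t) (at t)"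
    and "f0 s = 0" "f1 s = 0" and c: "isCont f2 s"
  shows "((\<lambda>t. f0 t / (t - s)\<^sup>2) \<longlongrightarrow> f2 s / 2) (at s)"
proof -
  have "\<forall>t. \<exists>r. \<bar>r - s\<bar> \<le> \<bar>t - s\<bar> \<and> f0 t = f2 r / 2 * (t - s)\<^sup>2"
    using taylor_vanishing2[OF assms(1-4)] by blast
  then obtain r where r: "\<And>t. \<bar>r t - s\<bar> \<le> \<bar>t - s\<bar>" "\<And>t. f0 t = f2 (r t) / 2 * (t - s)\<^sup>2"
    by metis
  have "((\<lambda>t. r t - s) \<longlongrightarrow> 0) (at s)"
  proof (rule Lim_null_comparison)
    show "eventually (\<lambda>t. norm (r t - s) \<le> \<bar>t - s\<bar>) (at s)" using r by simp
    have "((\<lambda>t. \<bar>t - s\<bar>) \<longlongrightarrow> \<bar>s - s\<bar>) (at s)" by (intro tendsto_intros)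
    then show "((\<lambda>t. \<bar>t - s\<bar>) \<longlongrightarrow> 0) (at s)" by simp
  qed
  then have "(r \<longlongrightarrow> s) (at s)" by (simp add: LIM_zero_iff)
  then have "((\<lambda>t. f2 (r t) / 2) \<longlongrightarrow> f2 s / 2) (at s)"
    by (intro tendsto_intros isCont_tendsto_compose[OF c]) auto
  moreover have "eventually (\<lambda>t. f2 (r t) / 2 = f0 t / (t - s)\<^sup>2) (at s)"
    by (auto simp: eventually_at r intro!: exI[of _ 1])
  ultimately show ?thesis by (rule Lim_transform_eventually)
qed

section \<open>Moving frames and osculating conics\<close>

text \<open>The curve is given by its coordinates and their first four derivatives. Convexity enters in the form that
the curve stays strictly on one side of each of its tangents. Dividing by the determinant of the first two
derivatives makes this inequality invariant under a change of orientation.\<close>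

locale oval =
  fixes x0 x1 x2 x3 x4 y0 y1 y2 y3 y4 :: "real \<Rightarrow> real"
  assumes dx [derivative_intros]:
      "\<And>t. (x0 has_real_derivative x1 t) (at t)" "\<And>t. (x1 has_real_derivative x2 t) (at t)"
      "\<And>t. (x2 has_real_derivative x3 t) (at t)" "\<And>t. (x3 has_real_derivative x4 t) (at t)"
    and dy [derivative_intros]:
      "\<And>t. (y0 has_real_derivative y1 t) (at t)" "\<And>t. (y1 has_real_derivative y2 t) (at t)"
      "\<And>t. (y2 has_real_derivative y3 t) (at t)" "\<And>t. (y3 has_real_derivative y4 t) (at t)"
    and cont4: "continuous_on UNIV x4" "continuous_on UNIV y4"
    and per: "\<And>t. x0 (t + 2 * pi) = x0 t" "\<And>t. x1 (t + 2 * pi) = x1 t" "\<And>t. x2 (t + 2 * pi) = x2 t"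
      "\<And>t. x3 (t + 2 * pi) = x3 t" "\<And>t. x4 (t + 2 * pi) = x4 t"
      "\<And>t. y0 (t + 2 * pi) = y0 t" "\<And>t. y1 (t + 2 * pi) = y1 t" "\<And>t. y2 (t + 2 * pi) = y2 t"
      "\<And>t. y3 (t + 2 * pi) = y3 t" "\<And>t. y4 (t + 2 * pi) = y4 t"
    and k_nz: "\<And>s. x1 s * y2 s - y1 s * x2 s \<noteq> 0"
    and convex: "\<And>s t. (\<forall>n::int. t \<noteq> s + 2 * pi * of_int n) \<Longrightarrow>
      0 < (x1 s * (y0 t - y0 s) - y1 s * (x0 t - x0 s)) / (x1 s * y2 s - y1 s * x2 s)"
begin

text \<open>\<open>cX s\<close> and \<open>cY s\<close> are the coordinates of a vector with respect to the first two derivatives of the curve at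
\<open>s\<close>, and \<open>X s\<close> and \<open>Y s\<close> the corresponding affine coordinates with origin on the curve. Along the curve
\<open>X s\<close> starts like \<open>t - s\<close> and \<open>Y s\<close> like \<open>(t - s)\<^sup>2 / 2\<close>. The abbreviations below denote these coordinate
functions and their derivatives with respect to \<open>t\<close>.\<close>

definition k :: "real \<Rightarrow> real" where "k s = x1 s * y2 s - y1 s * x2 s"
definition cX :: "real \<Rightarrow> real \<Rightarrow> real \<Rightarrow> real" where "cX s p q = (p * y2 s - q * x2 s) / k s"
definition cY :: "real \<Rightarrow> real \<Rightarrow> real \<Rightarrow> real" where "cY s p q = (x1 s * q - y1 s * p) / k s"
definition X :: "real \<Rightarrow> real \<Rightarrow> real \<Rightarrow> real" where "X s p q = cX s (p - x0 s) (q - y0 s)"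
definition Y :: "real \<Rightarrow> real \<Rightarrow> real \<Rightarrow> real" where "Y s p q = cY s (p - x0 s) (q - y0 s)"

abbreviation X0 where "X0 s t \<equiv> X s (x0 t) (y0 t)"
abbreviation Y0 where "Y0 s t \<equiv> Y s (x0 t) (y0 t)"
abbreviation X1 where "X1 s t \<equiv> cX s (x1 t) (y1 t)"
abbreviation Y1 where "Y1 s t \<equiv> cY s (x1 t) (y1 t)"
abbreviation X2 where "X2 s t \<equiv> cX s (x2 t) (y2 t)"
abbreviation Y2 where "Y2 s t \<equiv> cY s (x2 t) (y2 t)"
abbreviation X3 where "X3 s t \<equiv> cX s (x3 t) (y3 t)"
abbreviation Y3 where "Y3 s t \<equiv> cY s (x3 t) (y3 t)"
abbreviation X4 where "X4 s t \<equiv> cX s (x4 t) (y4 t)"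
abbreviation Y4 where "Y4 s t \<equiv> cY s (x4 t) (y4 t)"

text \<open>The coefficients of the osculating form are found by expanding \<open>a Y\<^sup>2 + b X Y - Y + d X\<^sup>2\<close> along the curve
and equating the coefficients of orders two, three and four to zero, which gives \<open>d = 1 / 2\<close>, \<open>b\<close> and \<open>a\<close>
in turn.\<close>

definition cb :: "real \<Rightarrow> real" where "cb s = Y3 s s / 3"
definition ca :: "real \<Rightarrow> real" where "ca s = Y4 s s / 6 - 2 * (Y3 s s)\<^sup>2 / 9 - 2 * X3 s s / 3"

definition osc :: "real \<Rightarrow> real \<Rightarrow> real \<Rightarrow> real" where
  "osc s p q = ca s * (Y s p q)\<^sup>2 + cb s * X s p q * Y s p q - Y s p q + (X s p q)\<^sup>2 / 2"

text \<open>In the coordinates \<open>u = X / Y\<close>, \<open>w = 1 / Y\<close> this is the height of the curve over the osculating parabola.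
At \<open>t = s\<close> the quotient is \<open>0 / 0 = 0\<close>, which is also its limit.\<close>

definition H :: "real \<Rightarrow> real \<Rightarrow> real" where
  "H s t = - osc s (x0 t) (y0 t) / (Y0 s t)\<^sup>2"

definition far :: "real \<Rightarrow> real \<Rightarrow> bool" where
  "far s t \<longleftrightarrow> (\<forall>n::int. t \<noteq> s + 2 * pi * of_int n)"

lemma not_farE: assumes "\<not> far s t" obtains n :: int where "t = s + 2 * pi * of_int n"
  using assms by (auto simp: far_def)

lemma k_nonzero [simp]: "k s \<noteq> 0"
  using k_nz by (simp add: k_def)

lemma far_sym: "far s t \<longleftrightarrow> far t s"
proof -
  have "far t s" if "far s t" for s t
    unfolding far_def
  proof
    fix n :: int
    show "s \<noteq> t + 2 * pi * of_int n" using that[unfolded far_def, rule_format, of "-n"] by auto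
  qed
  then show ?thesis by blast
qed

lemma far_window: "s < t \<Longrightarrow> t < s + 2 * pi \<Longrightarrow> far s t"
  unfolding far_def
proof
  fix n :: int assume st: "s < t" "t < s + 2 * pi"
  show "t \<noteq> s + 2 * pi * of_int n"
  proof
    assume eq: "t = s + 2 * pi * of_int n"
    then have "0 < 2 * pi * real_of_int n" "2 * pi * real_of_int n < 2 * pi * 1" using st by auto
    then have "0 < n" "n < 1" by (auto simp: zero_less_mult_iff)
    then show False by simp
  qed
qed

lemma far_window': "s - 2 * pi < t \<Longrightarrow> t < s \<Longrightarrow> far s t"
  using far_window[of t s] far_sym by auto

lemma Y0_pos: "far s t \<Longrightarrow> 0 < Y0 s t"
  using convex[of t s] by (simp add: Y_def cY_def k_def far_def)

lemma frame_at_self [simp]: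
  "X s (x0 s) (y0 s) = 0" "Y s (x0 s) (y0 s) = 0" "X1 s s = 1" "Y1 s s = 0" "X2 s s = 0" "Y2 s s = 1"
proof -
  have "x1 s * y2 s - y1 s * x2 s = k s" by (simp add: k_def)
  then show "X s (x0 s) (y0 s) = 0" "Y s (x0 s) (y0 s) = 0" "X1 s s = 1" "Y1 s s = 0" "X2 s s = 0" "Y2 s s = 1"
    by (simp_all add: X_def Y_def cX_def cY_def algebra_simps)
qed

lemma point_in_frame: "p = x0 s + X s p q * x1 s + Y s p q * x2 s"
  "q = y0 s + X s p q * y1 s + Y s p q * y2 s"
proof -
  have "((p - x0 s) * y2 s - (q - y0 s) * x2 s) * x1 s + (x1 s * (q - y0 s) - y1 s * (p - x0 s)) * x2 s
      = k s * (p - x0 s)"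
    "((p - x0 s) * y2 s - (q - y0 s) * x2 s) * y1 s + (x1 s * (q - y0 s) - y1 s * (p - x0 s)) * y2 s
      = k s * (q - y0 s)"
    by (simp_all add: k_def algebra_simps)
  note * = this
  have "X s p q * x1 s + Y s p q * x2 s = p - x0 s" "X s p q * y1 s + Y s p q * y2 s = q - y0 s"
    using * k_nonzero[of s] by (simp_all add: X_def Y_def cX_def cY_def add_divide_distrib[symmetric])
  then show "p = x0 s + X s p q * x1 s + Y s p q * x2 s"
    "q = y0 s + X s p q * y1 s + Y s p q * y2 s" by linarith+
qed

lemma change_frame:
  "X s p q = X0 s r + X r p q * X1 s r + Y r p q * X2 s r"
  "Y s p q = Y0 s r + X r p q * Y1 s r + Y r p q * Y2 s r"
proof -
  define a b where "a = X r p q" and "b = Y r p q"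
  have p: "p = x0 r + a * x1 r + b * x2 r" "q = y0 r + a * y1 r + b * y2 r"
    unfolding a_def b_def by (rule point_in_frame)+
  show "X s p q = X0 s r + X r p q * X1 s r + Y r p q * X2 s r"
    unfolding a_def[symmetric] b_def[symmetric] unfolding p
    by (simp add: X_def cX_def algebra_simps add_divide_distrib diff_divide_distrib)
  show "Y s p q = Y0 s r + X r p q * Y1 s r + Y r p q * Y2 s r"
    unfolding a_def[symmetric] b_def[symmetric] unfolding p
    by (simp add: Y_def cY_def algebra_simps add_divide_distrib diff_divide_distrib)
qed

lemma frame_derivs [derivative_intros]:
  "((\<lambda>t. X0 s t) has_real_derivative X1 s t) (at t)" "((\<lambda>t. Y0 s t) has_real_derivative Y1 s t) (at t)"
  "((\<lambda>t. X1 s t) has_real_derivative X2 s t) (at t)" "((\<lambda>t. Y1 s t) has_real_derivative Y2 s t) (at t)"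
  "((\<lambda>t. X2 s t) has_real_derivative X3 s t) (at t)" "((\<lambda>t. Y2 s t) has_real_derivative Y3 s t) (at t)"
  "((\<lambda>t. X3 s t) has_real_derivative X4 s t) (at t)" "((\<lambda>t. Y3 s t) has_real_derivative Y4 s t) (at t)"
  unfolding X_def Y_def cX_def cY_def
  by (rule derivative_eq_intros refl | simp add: cX_def cY_def)+

lemma curve_tendsto [tendsto_intros]:
  assumes "(a \<longlongrightarrow> s) F"
  shows "((\<lambda>n. x0 (a n)) \<longlongrightarrow> x0 s) F" "((\<lambda>n. x1 (a n)) \<longlongrightarrow> x1 s) F" "((\<lambda>n. x2 (a n)) \<longlongrightarrow> x2 s) F"
    "((\<lambda>n. x3 (a n)) \<longlongrightarrow> x3 s) F" "((\<lambda>n. x4 (a n)) \<longlongrightarrow> x4 s) F"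
    "((\<lambda>n. y0 (a n)) \<longlongrightarrow> y0 s) F" "((\<lambda>n. y1 (a n)) \<longlongrightarrow> y1 s) F" "((\<lambda>n. y2 (a n)) \<longlongrightarrow> y2 s) F"
    "((\<lambda>n. y3 (a n)) \<longlongrightarrow> y3 s) F" "((\<lambda>n. y4 (a n)) \<longlongrightarrow> y4 s) F"
  using cont4 by (auto intro!: isCont_tendsto_compose[OF _ assms] DERIV_isCont[OF dx(1)]
      DERIV_isCont[OF dx(2)] DERIV_isCont[OF dx(3)] DERIV_isCont[OF dx(4)] DERIV_isCont[OF dy(1)]
      DERIV_isCont[OF dy(2)] DERIV_isCont[OF dy(3)] DERIV_isCont[OF dy(4)] simp: continuous_on_eq_continuous_at)

lemma frame_tendsto [tendsto_intros]:
  assumes "(a \<longlongrightarrow> s) F" "(f \<longlongrightarrow> p) F" "(g \<longlongrightarrow> q) F"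
  shows "((\<lambda>n. cX (a n) (f n) (g n)) \<longlongrightarrow> cX s p q) F" "((\<lambda>n. cY (a n) (f n) (g n)) \<longlongrightarrow> cY s p q) F"
    "((\<lambda>n. X (a n) (f n) (g n)) \<longlongrightarrow> X s p q) F" "((\<lambda>n. Y (a n) (f n) (g n)) \<longlongrightarrow> Y s p q) F"
proof -
  have k: "((\<lambda>n. k (a n)) \<longlongrightarrow> k s) F"
    unfolding k_def by (intro tendsto_intros assms)
  have *: "((\<lambda>n. cX (a n) (f n) (g n)) \<longlongrightarrow> cX s p q) F" "((\<lambda>n. cY (a n) (f n) (g n)) \<longlongrightarrow> cY s p q) F"
    if "(f \<longlongrightarrow> p) F" "(g \<longlongrightarrow> q) F" for f g p q
    unfolding cX_def cY_def by (intro tendsto_intros assms that k k_nonzero)+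
  show "((\<lambda>n. cX (a n) (f n) (g n)) \<longlongrightarrow> cX s p q) F" "((\<lambda>n. cY (a n) (f n) (g n)) \<longlongrightarrow> cY s p q) F"
    by (rule *[OF assms(2,3)])+
  show "((\<lambda>n. X (a n) (f n) (g n)) \<longlongrightarrow> X s p q) F" "((\<lambda>n. Y (a n) (f n) (g n)) \<longlongrightarrow> Y s p q) F"
    unfolding X_def Y_def by (intro * tendsto_intros assms)+
qed

lemma osc_tendsto [tendsto_intros]:
  assumes "(a \<longlongrightarrow> s) F" "(f \<longlongrightarrow> p) F" "(g \<longlongrightarrow> q) F"
  shows "((\<lambda>n. osc (a n) (f n) (g n)) \<longlongrightarrow> osc s p q) F"
  unfolding osc_def ca_def cb_def by (intro tendsto_intros assms) auto

text \<open>The derivatives of the osculating form along the curve, written out with the product rule.\<close>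

definition osc4 :: "real \<Rightarrow> real \<Rightarrow> real" where
  "osc4 s t = ca s * (2 * Y0 s t * Y4 s t + 8 * Y1 s t * Y3 s t + 6 * (Y2 s t)\<^sup>2)
    + cb s * (X4 s t * Y0 s t + 4 * X3 s t * Y1 s t + 6 * X2 s t * Y2 s t + 4 * X1 s t * Y3 s t + X0 s t * Y4 s t)
    - Y4 s t + (X0 s t * X4 s t + 4 * X1 s t * X3 s t + 3 * (X2 s t)\<^sup>2)"

definition osc1 :: "real \<Rightarrow> real \<Rightarrow> real" where
  "osc1 s t = ca s * (2 * Y0 s t * Y1 s t) + cb s * (X1 s t * Y0 s t + X0 s t * Y1 s t)
    - Y1 s t + X0 s t * X1 s t"

definition osc2 :: "real \<Rightarrow> real \<Rightarrow> real" where
  "osc2 s t = ca s * (2 * Y0 s t * Y2 s t + 2 * (Y1 s t)\<^sup>2)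
    + cb s * (X2 s t * Y0 s t + 2 * X1 s t * Y1 s t + X0 s t * Y2 s t)
    - Y2 s t + (X0 s t * X2 s t + (X1 s t)\<^sup>2)"

definition osc3 :: "real \<Rightarrow> real \<Rightarrow> real" where
  "osc3 s t = ca s * (2 * Y0 s t * Y3 s t + 6 * Y1 s t * Y2 s t)
    + cb s * (X3 s t * Y0 s t + 3 * X2 s t * Y1 s t + 3 * X1 s t * Y2 s t + X0 s t * Y3 s t)
    - Y3 s t + (X0 s t * X3 s t + 3 * X1 s t * X2 s t)"

lemma osc_derivs:
  "((\<lambda>t. osc s (x0 t) (y0 t)) has_real_derivative osc1 s t) (at t)"
  "((\<lambda>t. osc1 s t) has_real_derivative osc2 s t) (at t)"
  "((\<lambda>t. osc2 s t) has_real_derivative osc3 s t) (at t)"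
  "((\<lambda>t. osc3 s t) has_real_derivative osc4 s t) (at t)"
  unfolding osc_def osc1_def osc2_def osc3_def osc4_def
  by (rule derivative_eq_intros refl | simp add: algebra_simps power2_eq_square)+

lemma osc_contact: "osc s (x0 s) (y0 s) = 0" "osc1 s s = 0" "osc2 s s = 0" "osc3 s s = 0" "osc4 s s = 0"
  by (simp_all add: osc_def osc1_def osc2_def osc3_def osc4_def ca_def cb_def field_simps power2_eq_square)

lemma osc4_tendsto [tendsto_intros]:
  assumes "(a \<longlongrightarrow> s) F" "(b \<longlongrightarrow> t) F"
  shows "((\<lambda>n. osc4 (a n) (b n)) \<longlongrightarrow> osc4 s t) F"
  unfolding osc4_def ca_def cb_def by (intro tendsto_intros assms) auto

lemma curve_periodic:
  "x0 (t + 2 * pi * of_int n) = x0 t" "y0 (t + 2 * pi * of_int n) = y0 t"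
  "x1 (t + 2 * pi * of_int n) = x1 t" "y1 (t + 2 * pi * of_int n) = y1 t"
  "x2 (t + 2 * pi * of_int n) = x2 t" "y2 (t + 2 * pi * of_int n) = y2 t"
  by (rule periodic_int, rule per)+

lemma frame_periodic:
  "X (s + 2 * pi * of_int n) = X s" "Y (s + 2 * pi * of_int n) = Y s" "osc (s + 2 * pi * of_int n) = osc s"
proof -
  have "X (s + 2 * pi) = X s" "Y (s + 2 * pi) = Y s" "osc (s + 2 * pi) = osc s" for s
    by (intro ext; simp add: X_def Y_def osc_def cX_def cY_def k_def ca_def cb_def per)+
  then show "X (s + 2 * pi * of_int n) = X s" "Y (s + 2 * pi * of_int n) = Y s" "osc (s + 2 * pi * of_int n) = osc s"
    by (auto intro: periodic_int)
qed

lemma H_periodic: "H s (t + 2 * pi * of_int n) = H s t" "H (s + 2 * pi * of_int n) t = H s t"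
  by (simp_all add: H_def curve_periodic frame_periodic)

lemma H_self [simp]: "H s s = 0"
  by (simp add: H_def)

lemma H_not_far: "\<not> far s t \<Longrightarrow> H s t = 0"
  using H_periodic(1)[of s s] by (auto elim!: not_farE)

text \<open>Joint continuity on the diagonal is what four continuous derivatives are good for: by Taylor's formula the
numerator is a fourth derivative times \<open>(t - s)\<^sup>4 / 24\<close>, that derivative tends to zero because it vanishes
on the diagonal, and the denominator is of the exact order \<open>(t - s)\<^sup>4\<close>.\<close>

lemma H_tendsto_diag:
  assumes a: "(a \<longlongrightarrow> s) F" and b: "(b \<longlongrightarrow> s) F"
  shows "((\<lambda>n. H (a n) (b n)) \<longlongrightarrow> 0) F"
proof -
  have "\<forall>n. \<exists>r. \<bar>r - a n\<bar> \<le> \<bar>b n - a n\<bar> \<and> osc (a n) (x0 (b n)) (y0 (b n)) = osc4 (a n) r / 24 * (b n - a n) ^ 4"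
    by (intro allI taylor_vanishing4[OF osc_derivs]) (simp_all add: osc_contact)
  then obtain r where r: "\<And>n. \<bar>r n - a n\<bar> \<le> \<bar>b n - a n\<bar>"
    "\<And>n. osc (a n) (x0 (b n)) (y0 (b n)) = osc4 (a n) (r n) / 24 * (b n - a n) ^ 4" by metis
  have "\<forall>n. \<exists>r. \<bar>r - a n\<bar> \<le> \<bar>b n - a n\<bar> \<and> Y (a n) (x0 (b n)) (y0 (b n)) = Y2 (a n) r / 2 * (b n - a n)\<^sup>2"
    by (intro allI taylor_vanishing2[OF frame_derivs(2) frame_derivs(4)]) simp_all
  then obtain q where q: "\<And>n. \<bar>q n - a n\<bar> \<le> \<bar>b n - a n\<bar>"
    "\<And>n. Y0 (a n) (b n) = Y2 (a n) (q n) / 2 * (b n - a n)\<^sup>2" by metis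
  have ba: "((\<lambda>n. \<bar>b n - a n\<bar>) \<longlongrightarrow> 0) F"
    using tendsto_rabs[OF tendsto_diff[OF b a]] by simp
  have lim: "(f \<longlongrightarrow> s) F" if "\<And>n. \<bar>f n - a n\<bar> \<le> \<bar>b n - a n\<bar>" for f
  proof -
    have "((\<lambda>n. f n - a n) \<longlongrightarrow> 0) F"
      by (rule Lim_null_comparison[OF _ ba]) (use that in auto)
    from tendsto_add[OF this a] show ?thesis by simp
  qed
  have "((\<lambda>n. - osc4 (a n) (r n) / (6 * (Y2 (a n) (q n))\<^sup>2)) \<longlongrightarrow> - osc4 s s / (6 * (Y2 s s)\<^sup>2)) F"
    by (intro tendsto_intros a lim[OF r(1)] lim[OF q(1)]) simp
  then have L: "((\<lambda>n. - osc4 (a n) (r n) / (6 * (Y2 (a n) (q n))\<^sup>2)) \<longlongrightarrow> 0) F"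
    by (simp add: osc_contact)
  have bound: "norm (H (a n) (b n)) \<le> norm (- osc4 (a n) (r n) / (6 * (Y2 (a n) (q n))\<^sup>2))" for n
  proof (cases "b n = a n")
    case False
    have p4: "(c / 2 * d\<^sup>2)\<^sup>2 = c\<^sup>2 / 4 * d ^ 4" for c d :: real
      by (simp add: power_mult_distrib power_divide flip: power_mult)
    have "H (a n) (b n) = - osc4 (a n) (r n) / (6 * (Y2 (a n) (q n))\<^sup>2)"
      using False unfolding H_def r(2) q(2) p4 by (cases "Y2 (a n) (q n) = 0") (auto simp: field_simps)
    then show ?thesis by simp
  qed auto
  show ?thesis
    by (rule Lim_null_comparison[OF always_eventually tendsto_norm_zero[OF L]]) (use bound in auto)
qed

lemma H_tendsto [tendsto_intros]:
  assumes a: "(a \<longlongrightarrow> s) F" and b: "(b \<longlongrightarrow> t) F"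
  shows "((\<lambda>n. H (a n) (b n)) \<longlongrightarrow> H s t) F"
proof (cases "far s t")
  case True
  then show ?thesis
    unfolding H_def using Y0_pos[OF True] by (intro tendsto_intros a b) auto
next
  case False
  then obtain n :: int where n: "t = s + 2 * pi * of_int n" by (rule not_farE)
  have "((\<lambda>i. b i + 2 * pi * of_int (- n)) \<longlongrightarrow> t + 2 * pi * of_int (- n)) F"
    by (intro tendsto_intros b)
  then have "((\<lambda>i. b i + 2 * pi * of_int (- n)) \<longlongrightarrow> s) F" by (simp add: n)
  from H_tendsto_diag[OF a this] show ?thesis
    unfolding H_periodic using H_not_far[OF False] by simp
qed

end

section \<open>Tangent conics as parabolas\<close>

lemma window_rep: "\<exists>n::int. s \<le> t + 2 * pi * of_int n \<and> t + 2 * pi * of_int n < s + 2 * pi"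
proof -
  define n where "n = \<lfloor>(t - s) / (2 * pi)\<rfloor>"
  have "of_int n \<le> (t - s) / (2 * pi)" "(t - s) / (2 * pi) < of_int n + 1"
    unfolding n_def by linarith+
  then have "2 * pi * of_int n \<le> t - s" "t - s < 2 * pi * of_int n + 2 * pi"
    by (simp_all add: field_simps)
  then show ?thesis by (intro exI[of _ "- n"]) auto
qed

text \<open>The parabola with the 2-jet of the curve at \<open>x\<close>, in the picture at \<open>s\<close>, is the conic of the pencil spanned by
the pair of tangents at \<open>s\<close> and \<open>x\<close> and the doubled chord that meets the curve at \<open>x\<close> with multiplicity three. Here
\<open>X\<close>, \<open>Y\<close> are coordinates at \<open>s\<close> and \<open>a\<close>, \<open>b\<close> those at \<open>x\<close>. Up to the factor \<open>Y0 * K / N\<close> the right-hand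
side starts with \<open>a\<^sup>2 / 2 - b\<close>, as the osculating form at \<open>x\<close> does.\<close>

lemma tangent_conic_algebra:
  fixes X0 X1 X2 Y0 Y1 Y2 a b N K U E X Y :: real
  assumes nz: "Y0 \<noteq> 0" "N \<noteq> 0" and N: "N = X0 * Y1 - X1 * Y0" and K: "K = X1 * Y2 - X2 * Y1"
    and U: "U = X0 / Y0" and E: "E = Y0 ^ 3 * K / N ^ 3"
    and X: "X = X0 + a * X1 + b * X2" and Y: "Y = Y0 + a * Y1 + b * Y2"
  shows "Y\<^sup>2 / Y0 - Y + Y1 / N * Y * (X - U * Y) + E / 2 * (X - U * Y)\<^sup>2 =
    (Y0 * K / N) * (a\<^sup>2 / 2 - b) + (E / 2 * (X2 - U * Y2)\<^sup>2 - K * Y2 / N) * b\<^sup>2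
      + (- E * (N / Y0) * (X2 - U * Y2) - K * Y1 / N) * a * b"
proof -
  have "N * (Y - Y0) + Y1 * (X * Y0 - X0 * Y) = - K * b * Y0"
    unfolding N K X Y by (simp add: algebra_simps)
  then have "(N * (Y - Y0) + Y1 * (X * Y0 - X0 * Y)) * Y / (N * Y0) = - K * b * Y / N"
    using nz by simp
  moreover have "(N * (Y - Y0) + Y1 * (X * Y0 - X0 * Y)) * Y / (N * Y0) = Y\<^sup>2 / Y0 - Y + Y1 / N * Y * (X - U * Y)"
    unfolding U using nz by (simp add: field_simps power2_eq_square)
  ultimately have 1: "Y\<^sup>2 / Y0 - Y + Y1 / N * Y * (X - U * Y) = - K * b * Y / N" by simp
  have "X * Y0 - X0 * Y = - N * a + (X2 * Y0 - X0 * Y2) * b"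
    unfolding N X Y by (simp add: algebra_simps)
  then have "(X * Y0 - X0 * Y) / Y0 = (- N * a + (X2 * Y0 - X0 * Y2) * b) / Y0" by simp
  moreover have "(X * Y0 - X0 * Y) / Y0 = X - U * Y"
    unfolding U using nz by (simp add: field_simps)
  moreover have "(- N * a + (X2 * Y0 - X0 * Y2) * b) / Y0 = - (N / Y0) * a + (X2 - U * Y2) * b"
    unfolding U using nz by (simp add: field_simps)
  ultimately have 2: "X - U * Y = - (N / Y0) * a + (X2 - U * Y2) * b" by simp
  define W where "W = X2 - U * Y2"
  have 3: "E / 2 * (N / Y0)\<^sup>2 = Y0 * K / N / 2"
    unfolding E using nz by (simp add: field_simps power2_eq_square power3_eq_cube)
  have "E / 2 * (X - U * Y)\<^sup>2 = E / 2 * (N / Y0)\<^sup>2 * a\<^sup>2 - E * (N / Y0) * W * a * b + E / 2 * W\<^sup>2 * b\<^sup>2"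
    unfolding 2 W_def[symmetric] by (simp add: algebra_simps power2_eq_square)
  also have "\<dots> = Y0 * K / N / 2 * a\<^sup>2 - E * (N / Y0) * W * a * b + E / 2 * W\<^sup>2 * b\<^sup>2"
    unfolding 3 ..
  finally show ?thesis
    unfolding 1 W_def[symmetric] unfolding Y by (simp add: algebra_simps power2_eq_square add_divide_distrib diff_divide_distrib)
qed

context oval begin

text \<open>Along the curve \<open>U s\<close> is the coordinate \<open>u\<close>. It has the derivative \<open>- N / Y\<^sup>2\<close> with respect to \<open>t\<close>. The
slope of the curve in the \<open>u\<close>-\<open>w\<close>-plane is \<open>Y1 / N\<close>, and its second derivative with respect to \<open>u\<close> is \<open>E\<close>.\<close>

definition U :: "real \<Rightarrow> real \<Rightarrow> real" where "U s t = X0 s t / Y0 s t"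
definition N :: "real \<Rightarrow> real \<Rightarrow> real" where "N s t = X0 s t * Y1 s t - X1 s t * Y0 s t"
definition K :: "real \<Rightarrow> real \<Rightarrow> real" where "K s t = X1 s t * Y2 s t - X2 s t * Y1 s t"
definition E :: "real \<Rightarrow> real \<Rightarrow> real" where "E s t = Y0 s t ^ 3 * K s t / N s t ^ 3"

lemma K_eq: "K s t = k t / k s"
proof -
  have "(x1 t * y2 s - y1 t * x2 s) * (x1 s * y2 t - y1 s * x2 t) - (x2 t * y2 s - y2 t * x2 s) * (x1 s * y1 t - y1 s * x1 t)
     = k t * k s" by (simp add: k_def algebra_simps)
  then have "K s t = k t * k s / (k s * k s)"
    by (simp add: K_def cX_def cY_def flip: diff_divide_distrib)
  then show ?thesis by simp
qed

lemma N_eq: "N s t = K s t * Y0 t s"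
proof -
  have "((x0 t - x0 s) * y2 s - (y0 t - y0 s) * x2 s) * (x1 s * y1 t - y1 s * x1 t)
      - (x1 t * y2 s - y1 t * x2 s) * (x1 s * (y0 t - y0 s) - y1 s * (x0 t - x0 s))
    = k s * (x1 t * (y0 s - y0 t) - y1 t * (x0 s - x0 t))" by (simp add: k_def algebra_simps)
  then have "N s t = k s * (x1 t * (y0 s - y0 t) - y1 t * (x0 s - x0 t)) / (k s * k s)"
    by (simp add: N_def X_def Y_def cX_def cY_def flip: diff_divide_distrib)
  then show ?thesis by (simp add: K_eq Y_def cY_def)
qed

lemma K_pos: "0 < K s t"
proof (rule ccontr)
  assume "\<not> 0 < K s t"
  then have neg: "k t / k s < 0" unfolding K_eq
    by (metis divide_eq_0_iff k_nonzero linorder_neqE_linordered_idom)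
  have "continuous_on UNIV k"
    unfolding k_def continuous_on_def by (intro ballI tendsto_intros)
  then have "connected (range k)" using connected_UNIV by (rule connected_continuous_image)
  then have "0 \<in> range k"
    using neg connectedD_interval[of "range k" "k s" "k t" 0] connectedD_interval[of "range k" "k t" "k s" 0]
    by (auto simp: divide_less_0_iff)
  then show False by (metis k_nonzero imageE)
qed

lemma far_iff_pos: "far s t \<longleftrightarrow> 0 < Y0 s t"
proof
  show "far s t" if "0 < Y0 s t"
  proof (rule ccontr)
    assume "\<not> far s t"
    then obtain n :: int where "t = s + 2 * pi * of_int n" by (rule not_farE)
    then show False using that by (simp add: curve_periodic)
  qed
qed (rule Y0_pos)

lemma eventually_far: "far s t \<Longrightarrow> eventually (far s) (at t)"
  unfolding far_iff_pos[abs_def] by (rule order_tendstoD(1)[where y = "Y0 s t"]) (intro tendsto_intros)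

lemma N_pos: "far s t \<Longrightarrow> 0 < N s t"
  unfolding N_eq using Y0_pos[OF far_sym[THEN iffD1]] K_pos by (intro mult_pos_pos) auto

lemma X0_first_order: "((\<lambda>t. X0 s t / (t - s)) \<longlongrightarrow> 1) (at s)"
  using frame_derivs(1)[of s s] by (simp add: has_field_derivative_iff)

lemma Y0_second_order: "((\<lambda>t. Y0 s t / (t - s)\<^sup>2) \<longlongrightarrow> 1 / 2) (at s)"
  using second_order_limit[OF frame_derivs(2) frame_derivs(4), of s s] DERIV_isCont[OF frame_derivs(6)] by simp

lemma N_second_order: "((\<lambda>t. N s t / (t - s)\<^sup>2) \<longlongrightarrow> 1 / 2) (at s)"
proof -
  have 1: "((\<lambda>t. N s t) has_real_derivative X0 s t * Y2 s t - X2 s t * Y0 s t) (at t)" for t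
    unfolding N_def by (rule derivative_eq_intros refl | simp add: algebra_simps)+
  have 2: "((\<lambda>t. X0 s t * Y2 s t - X2 s t * Y0 s t) has_real_derivative
      K s t + X0 s t * Y3 s t - X3 s t * Y0 s t) (at t)" for t
    unfolding K_def by (rule derivative_eq_intros refl | simp add: algebra_simps)+
  have 3: "isCont (\<lambda>t. K s t + X0 s t * Y3 s t - X3 s t * Y0 s t) s"
    unfolding isCont_def K_def by (intro tendsto_intros)
  show ?thesis
    using second_order_limit[OF 1 2 _ _ 3] by (simp add: N_def K_def)
qed

lemma U_times: "((\<lambda>t. U s t * (t - s)) \<longlongrightarrow> 2) (at s)"
proof -
  have "((\<lambda>t. X0 s t / (t - s) / (Y0 s t / (t - s)\<^sup>2)) \<longlongrightarrow> 1 / (1 / 2)) (at s)"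
    by (intro tendsto_intros X0_first_order Y0_second_order) simp
  moreover have "eventually (\<lambda>t. X0 s t / (t - s) / (Y0 s t / (t - s)\<^sup>2) = U s t * (t - s)) (at s)"
  proof -
    have "x / d / (y / d\<^sup>2) = x / y * d" if "d \<noteq> 0" for x y d :: real
      using that by (cases "y = 0") (auto simp: field_simps power2_eq_square)
    then show ?thesis by (auto simp: eventually_at U_def intro!: exI[of _ 1])
  qed
  ultimately show ?thesis using Lim_transform_eventually by fastforce
qed

lemma U_at_right: "filterlim (U s) at_top (at_right s)"
proof -
  have "filterlim (\<lambda>t. t - s) (at_right 0) (at_right s)"
    unfolding filterlim_at by (auto simp: eventually_at_filter intro!: tendsto_eq_intros)
  from filterlim_compose[OF filterlim_inverse_at_top_right this]
  have "filterlim (\<lambda>t. inverse (t - s)) at_top (at_right s)" .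
  from filterlim_tendsto_pos_mult_at_top[OF tendsto_mono[OF at_le[OF subset_UNIV] U_times] _ this]
  have "filterlim (\<lambda>t. U s t * (t - s) * inverse (t - s)) at_top (at_right s)" by simp
  then show ?thesis
    by (rule filterlim_mono_eventually) (auto simp: eventually_at_filter field_simps)
qed

lemma U_at_left: "filterlim (U s) at_bot (at_left s)"
proof -
  have "filterlim (\<lambda>t. s - t) (at_right 0) (at_left s)"
    unfolding filterlim_at by (auto simp: eventually_at_filter intro!: tendsto_eq_intros)
  from filterlim_compose[OF filterlim_inverse_at_top_right this]
  have "filterlim (\<lambda>t. inverse (s - t)) at_top (at_left s)" .
  from filterlim_tendsto_pos_mult_at_top[OF tendsto_mono[OF at_le[OF subset_UNIV] U_times] _ this]
  have "filterlim (\<lambda>t. U s t * (t - s) * inverse (s - t)) at_top (at_left s)" by simp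
  then have "filterlim (\<lambda>t. - U s t) at_top (at_left s)"
    by (rule filterlim_mono_eventually) (auto simp: eventually_at_filter field_simps)
  then show ?thesis by (simp add: filterlim_uminus_at_top)
qed

lemma U_periodic: "U s (t + 2 * pi * of_int n) = U s t"
  by (simp add: U_def curve_periodic)

lemma U_at_left_next: "filterlim (U s) at_bot (at_left (s + 2 * pi))"
proof -
  have "filterlim (\<lambda>t. t + 2 * pi * of_int (- 1)) (at_left s) (at_left (s + 2 * pi))"
    unfolding filterlim_at by (auto simp: eventually_at_filter intro!: tendsto_eq_intros)
  from filterlim_compose[OF U_at_left this] show ?thesis
    unfolding U_periodic .
qed

lemma E_tendsto: "(E s \<longlongrightarrow> 1) (at s)"
proof -
  have "((\<lambda>t. (Y0 s t / (t - s)\<^sup>2) ^ 3 * K s t / (N s t / (t - s)\<^sup>2) ^ 3) \<longlongrightarrow> (1 / 2) ^ 3 * K s s / (1 / 2) ^ 3) (at s)"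
    unfolding K_def by (intro tendsto_intros Y0_second_order N_second_order) simp
  moreover have "eventually (\<lambda>t. (Y0 s t / (t - s)\<^sup>2) ^ 3 * K s t / (N s t / (t - s)\<^sup>2) ^ 3 = E s t) (at s)"
  proof -
    have "(x / d) ^ 3 * l / (y / d) ^ 3 = x ^ 3 * l / y ^ 3" if "d \<noteq> 0" for x y d l :: real
      using that by (cases "y = 0") (auto simp: field_simps)
    then show ?thesis by (auto simp: eventually_at E_def intro!: exI[of _ 1])
  qed
  ultimately show ?thesis using Lim_transform_eventually by (fastforce simp: K_def)
qed

lemma U_deriv:
  assumes "far s t"
  shows "(U s has_real_derivative - N s t / (Y0 s t)\<^sup>2) (at t)"
proof -
  have "((\<lambda>t. X0 s t / Y0 s t) has_real_derivative - N s t / (Y0 s t)\<^sup>2) (at t)"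
    using Y0_pos[OF assms]
    by (auto intro!: derivative_eq_intros simp: N_def power2_eq_square)
  then show ?thesis unfolding U_def[abs_def] .
qed

lemma U_decreasing: "s < t \<Longrightarrow> t < r \<Longrightarrow> r < s + 2 * pi \<Longrightarrow> U s r < U s t"
  "s - 2 * pi < t \<Longrightarrow> t < r \<Longrightarrow> r < s \<Longrightarrow> U s r < U s t"
proof -
  have *: "U s r < U s t" if "t < r" and f: "\<And>w. t \<le> w \<Longrightarrow> w \<le> r \<Longrightarrow> far s w" for t r
  proof (rule DERIV_neg_imp_decreasing[OF \<open>t < r\<close>, of "U s"])
    fix w assume "t \<le> w" "w \<le> r"
    from f[OF this] show "\<exists>y. (U s has_real_derivative y) (at w) \<and> y < 0"
      using U_deriv[of s w] N_pos[of s w] Y0_pos[of s w] by (auto intro!: exI[of _ "- N s w / (Y0 s w)\<^sup>2"] divide_neg_pos)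
  qed
  show "s < t \<Longrightarrow> t < r \<Longrightarrow> r < s + 2 * pi \<Longrightarrow> U s r < U s t"
    by (rule *) (auto intro!: far_window)
  show "s - 2 * pi < t \<Longrightarrow> t < r \<Longrightarrow> r < s \<Longrightarrow> U s r < U s t"
    by (rule *) (auto intro!: far_window')
qed

lemma H_eq: "far s t \<Longrightarrow> H s t = 1 / Y0 s t - ca s - cb s * U s t - (U s t)\<^sup>2 / 2"
proof -
  have "- (a * y\<^sup>2 + b * x * y - y + x\<^sup>2 / 2) / y\<^sup>2 = 1 / y - a - b * (x / y) - (x / y)\<^sup>2 / 2" if "y \<noteq> 0" for a b x y :: real
    using that by (simp add: field_simps power2_eq_square)
  note * = this
  assume "far s t"
  then have "Y0 s t \<noteq> 0" using Y0_pos by fastforce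
  from *[OF this] show "H s t = 1 / Y0 s t - ca s - cb s * U s t - (U s t)\<^sup>2 / 2"
    unfolding H_def osc_def U_def .
qed

end

section \<open>Extremal conics and the step between them\<close>

text \<open>The sign \<open>eps\<close> is \<open>1\<close> for inscribed and \<open>- 1\<close> for circumscribed conics.\<close>

locale signed_oval = oval +
  fixes eps :: real
  assumes eps: "eps = 1 \<or> eps = - 1"
begin

text \<open>\<open>gap_slope\<close> and \<open>gap_bend\<close> are the first and second derivatives of \<open>gap\<close> with respect to \<open>u\<close>. At the point
\<open>s\<close> itself, which corresponds to \<open>u = \<infinity>\<close>, the second derivative is given its limit \<open>0\<close>.\<close>

definition gap where "gap s t = eps * H s t"
definition gap_slope where "gap_slope s t = eps * (Y1 s t / N s t - cb s - U s t)"
definition gap_bend where "gap_bend s t = (if far s t then eps * (E s t - 1) else 0)"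

lemma gap_deriv:
  assumes "far s t"
  shows "(gap s has_real_derivative - N s t / (Y0 s t)\<^sup>2 * gap_slope s t) (at t)"
proof -
  note pos = Y0_pos[OF assms] N_pos[OF assms]
  have dU: "(U s has_real_derivative - N s t / (Y0 s t)\<^sup>2) (at t)" by (rule U_deriv[OF assms])
  have "((\<lambda>t. 1 / Y0 s t) has_real_derivative - (Y1 s t / (Y0 s t)\<^sup>2)) (at t)"
    using DERIV_inverse_fun[OF frame_derivs(2), of s t] pos by (simp add: power2_eq_square field_simps)
  moreover have "((\<lambda>t. (U s t)\<^sup>2 / 2) has_real_derivative U s t * (- N s t / (Y0 s t)\<^sup>2)) (at t)"
    using DERIV_cdivide[OF DERIV_power[OF dU, of 2], of 2] by (simp add: mult.commute)
  ultimately have "((\<lambda>t. eps * (1 / Y0 s t - ca s - cb s * U s t - (U s t)\<^sup>2 / 2)) has_real_derivative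
      eps * (- (Y1 s t / (Y0 s t)\<^sup>2) - 0 - cb s * (- N s t / (Y0 s t)\<^sup>2) - U s t * (- N s t / (Y0 s t)\<^sup>2))) (at t)"
    by (intro DERIV_cmult DERIV_diff DERIV_const dU)
  moreover have "eps * (- (Y1 s t / (Y0 s t)\<^sup>2) - 0 - cb s * (- N s t / (Y0 s t)\<^sup>2) - U s t * (- N s t / (Y0 s t)\<^sup>2))
    = - N s t / (Y0 s t)\<^sup>2 * gap_slope s t"
  proof -
    have "e * (- (y / Y) - 0 - c * (- n / Y) - u * (- n / Y)) = - n / Y * (e * (y / n - c - u))"
      if "n \<noteq> 0" for e y Y c n u :: real
      using that by (simp add: divide_simps) (simp add: algebra_simps)
    from this[of "N s t"] show ?thesis using pos unfolding gap_slope_def by simp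
  qed
  ultimately have "((\<lambda>t. eps * (1 / Y0 s t - ca s - cb s * U s t - (U s t)\<^sup>2 / 2)) has_real_derivative
      - N s t / (Y0 s t)\<^sup>2 * gap_slope s t) (at t)"
    by simp
  then show ?thesis
  proof (rule DERIV_cong_ev[THEN iffD1, rotated -1])
    have "eventually (\<lambda>r. eps * (1 / Y0 s r - ca s - cb s * U s r - (U s r)\<^sup>2 / 2) = gap s r) (at t)"
      using eventually_far[OF assms] by eventually_elim (simp add: gap_def H_eq)
    then show "eventually (\<lambda>r. eps * (1 / Y0 s r - ca s - cb s * U s r - (U s r)\<^sup>2 / 2) = gap s r) (nhds t)"
      unfolding eventually_nhds_conv_at using assms by (simp add: gap_def H_eq)
  qed auto
qed

lemma gap_slope_deriv:
  assumes "far s t"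
  shows "(gap_slope s has_real_derivative - N s t / (Y0 s t)\<^sup>2 * gap_bend s t) (at t)"
proof -
  note pos = Y0_pos[OF assms] N_pos[OF assms]
  have N: "((\<lambda>t. N s t) has_real_derivative X0 s t * Y2 s t - X2 s t * Y0 s t) (at t)"
    unfolding N_def by (rule derivative_eq_intros refl | simp add: algebra_simps)+
  have "((\<lambda>t. Y1 s t / N s t) has_real_derivative
      (Y2 s t * N s t - Y1 s t * (X0 s t * Y2 s t - X2 s t * Y0 s t)) / (N s t * N s t)) (at t)"
    using pos by (auto intro!: derivative_eq_intros N)
  moreover have "Y2 s t * N s t - Y1 s t * (X0 s t * Y2 s t - X2 s t * Y0 s t) = - Y0 s t * K s t"
    by (simp add: N_def K_def algebra_simps)
  moreover have "- Y0 s t * K s t / (N s t * N s t) = - N s t / (Y0 s t)\<^sup>2 * E s t"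
    using pos by (simp add: E_def field_simps power2_eq_square power3_eq_cube)
  ultimately have V: "((\<lambda>t. Y1 s t / N s t) has_real_derivative - N s t / (Y0 s t)\<^sup>2 * E s t) (at t)"
    by simp
  have "((\<lambda>t. eps * (Y1 s t / N s t - cb s - U s t)) has_real_derivative - N s t / (Y0 s t)\<^sup>2 * gap_bend s t) (at t)"
    using DERIV_cmult[OF DERIV_diff[OF DERIV_diff[OF V DERIV_const] U_deriv[OF assms]], of eps "cb s"] assms
    by (simp add: gap_bend_def algebra_simps diff_divide_distrib)
  then show ?thesis unfolding gap_slope_def[abs_def] .
qed

lemma gap_bend_periodic: "gap_bend s (t + 2 * pi * of_int n) = gap_bend s t"
proof -
  have "far s (t + 2 * pi * of_int n) \<longleftrightarrow> far s t"
  proof -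
    have "far s t" if "far s (t + 2 * pi * of_int n)" for t and n :: int
      unfolding far_def
    proof
      fix m :: int show "t \<noteq> s + 2 * pi * of_int m"
        using that[unfolded far_def, rule_format, of "m + n"] by (auto simp: algebra_simps)
    qed
    from this[of t n] this[of "t + 2 * pi * of_int n" "-n"] show ?thesis by auto
  qed
  moreover have "E s (t + 2 * pi * of_int n) = E s t"
    by (simp add: E_def N_def K_def curve_periodic)
  ultimately show ?thesis by (simp add: gap_bend_def)
qed

lemma gap_bend_self [simp]: "gap_bend s s = 0"
  by (simp add: gap_bend_def far_def exI[of _ 0])

lemma gap_bend_isCont: "isCont (gap_bend s) t"
proof -
  have self: "isCont (gap_bend s) s"
  proof -
    have "(gap_bend s \<longlongrightarrow> 0) (at s)"
    proof (rule Lim_null_comparison)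
      show "eventually (\<lambda>t. norm (gap_bend s t) \<le> \<bar>eps * (E s t - 1)\<bar>) (at s)"
        by (rule always_eventually) (auto simp: gap_bend_def)
      have "((\<lambda>t. \<bar>eps * (E s t - 1)\<bar>) \<longlongrightarrow> \<bar>eps * (1 - 1)\<bar>) (at s)"
        by (intro tendsto_intros E_tendsto)
      then show "((\<lambda>t. \<bar>eps * (E s t - 1)\<bar>) \<longlongrightarrow> 0) (at s)" by simp
    qed
    then show ?thesis unfolding isCont_def gap_bend_self .
  qed
  show ?thesis
  proof (cases "far s t")
    case True
    have "eventually (\<lambda>r. eps * (E s r - 1) = gap_bend s r) (at t)"
      using eventually_far[OF True] by eventually_elim (simp add: gap_bend_def)
    moreover have "((\<lambda>r. eps * (E s r - 1)) \<longlongrightarrow> eps * (E s t - 1)) (at t)"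
      unfolding E_def N_def K_def using N_pos[OF True] by (intro tendsto_intros) (auto simp: N_def)
    ultimately show ?thesis unfolding isCont_def using True Lim_transform_eventually
      by (fastforce simp: gap_bend_def[of s t])
  next
    case False
    then obtain n :: int where n: "t = s + 2 * pi * of_int n" by (rule not_farE)
    have "((\<lambda>r. r + 2 * pi * of_int (- n)) \<longlongrightarrow> t + 2 * pi * of_int (- n)) (at t)"
      by (intro tendsto_intros)
    then have "((\<lambda>r. r + 2 * pi * of_int (- n)) \<longlongrightarrow> s) (at t)" by (simp add: n)
    from isCont_tendsto_compose[OF self this] show ?thesis
      unfolding isCont_def gap_bend_periodic n by simp
  qed
qed

text \<open>\<open>F s\<close> is the least form \<open>eps * osc s + c * Y\<^sup>2\<close> that is nonnegative on the curve. Besides \<open>s\<close>, its zeros on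
the curve are the points of \<open>A s\<close>. The point \<open>s\<close> itself belongs to \<open>A s\<close> exactly if \<open>M s = 0\<close>.\<close>

definition M where "M s = Sup (range (gap s))"
definition A where "A s = {t. gap s t = M s}"
definition F where "F s p q = eps * osc s p q + M s * (Y s p q)\<^sup>2"

lemma gap_periodic: "gap s (t + 2 * pi * of_int n) = gap s t" "gap (s + 2 * pi * of_int n) t = gap s t"
  by (simp_all add: gap_def H_periodic)

lemma gap_tendsto [tendsto_intros]:
  "(a \<longlongrightarrow> s) G \<Longrightarrow> (b \<longlongrightarrow> t) G \<Longrightarrow> ((\<lambda>n. gap (a n) (b n)) \<longlongrightarrow> gap s t) G"
  unfolding gap_def by (intro tendsto_intros)

lemma gap_continuous: "continuous_on S (gap s)"
  unfolding continuous_on_def by (intro ballI tendsto_intros)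

lemma gap_bounded: obtains B where "\<And>t. B \<le> gap s t"
proof -
  have "{0..2 * pi} \<noteq> {}" by simp
  from continuous_attains_inf[OF compact_Icc this gap_continuous]
  obtain w where "\<forall>t\<in>{0..2 * pi}. gap s w \<le> gap s t" by blast
  then have w: "\<And>t. t \<in> {0..2*pi} \<Longrightarrow> gap s w \<le> gap s t" by blast
  show ?thesis
  proof (rule that)
    fix t
    obtain n :: int where n: "0 \<le> t + 2 * pi * of_int n" "t + 2 * pi * of_int n < 0 + 2 * pi"
      using window_rep by blast
    show "gap s w \<le> gap s t"
      using w[of "t + 2 * pi * of_int n"] n by (simp add: gap_periodic)
  qed
qed

lemma M_is_max: "gap s t \<le> M s" "\<exists>t. gap s t = M s" "\<And>B. (\<And>t. gap s t \<le> B) \<Longrightarrow> M s \<le> B"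
proof -
  have "{0..2 * pi} \<noteq> {}" by simp
  from continuous_attains_sup[OF compact_Icc this gap_continuous]
  obtain w where "\<forall>t\<in>{0..2 * pi}. gap s t \<le> gap s w" by blast
  then have w: "\<And>t. t \<in> {0..2*pi} \<Longrightarrow> gap s t \<le> gap s w" by blast
  have w': "gap s t \<le> gap s w" for t
  proof -
    obtain n :: int where n: "0 \<le> t + 2 * pi * of_int n" "t + 2 * pi * of_int n < 0 + 2 * pi"
      using window_rep by blast
    show "gap s t \<le> gap s w"
      using w[of "t + 2 * pi * of_int n"] n by (simp add: gap_periodic)
  qed
  have "M s = gap s w"
    unfolding M_def by (rule cSup_eq_maximum) (use w' in auto)
  then show "gap s t \<le> M s" "\<exists>t. gap s t = M s" "\<And>B. (\<And>t. gap s t \<le> B) \<Longrightarrow> M s \<le> B"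
    using w' by auto
qed

lemma A_periodic: "t + 2 * pi * of_int n \<in> A s \<longleftrightarrow> t \<in> A s"
  by (simp add: A_def gap_periodic)

lemma F_on_curve: "F s (x0 t) (y0 t) = (Y0 s t)\<^sup>2 * (M s - gap s t)"
proof (cases "Y0 s t = 0")
  case True
  have "\<not> far s t" using True Y0_pos[of s t] by auto
  then obtain n :: int where n: "t = s + 2 * pi * of_int n" by (rule not_farE)
  show ?thesis by (simp add: n curve_periodic F_def osc_contact)
qed (simp add: F_def gap_def H_def field_simps)

lemma F_nonneg: "0 \<le> F s (x0 t) (y0 t)"
  using M_is_max(1)[of s t] by (simp add: F_on_curve)

lemma F_zero_iff: "far s t \<Longrightarrow> F s (x0 t) (y0 t) = 0 \<longleftrightarrow> t \<in> A s"
  using Y0_pos[of s t] by (auto simp: F_on_curve A_def)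

text \<open>A form with the 2-jet of the osculating form at \<open>x\<close> becomes, in the picture at \<open>x\<close>, an affine function
\<open>a' + b' u\<close> above the gap. Since the gap is bounded while \<open>u\<close> takes arbitrarily large values of both
signs, \<open>b' = 0\<close>; and since there is another contact at \<open>r\<close>, the constant \<open>a'\<close> is the maximum of the gap.\<close>

lemma recognise_F:
  assumes c: "0 < c"
    and R: "\<And>p q. R p q = eps * c * ((X x p q)\<^sup>2 / 2 - Y x p q) + a * (Y x p q)\<^sup>2 + b * X x p q * Y x p q"
    and nonneg: "\<And>t. 0 \<le> R (x0 t) (y0 t)"
    and r: "far x r" "R (x0 r) (y0 r) = 0"
  shows "r \<in> A x" and "R p q = c * F x p q"
proof -
  define a' b' where "a' = a / c - eps * ca x" and "b' = b / c - eps * cb x"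
  have a: "a = c * (a' + eps * ca x)" "b = c * (b' + eps * cb x)"
    using c by (simp_all add: a'_def b'_def)
  have R': "R p q = c * (eps * osc x p q + a' * (Y x p q)\<^sup>2 + b' * X x p q * Y x p q)" for p q
    unfolding R a osc_def by (simp add: algebra_simps)
  have on: "R (x0 t) (y0 t) = c * (Y0 x t)\<^sup>2 * (a' + b' * U x t - gap x t)" if "far x t" for t
    unfolding R' using Y0_pos[OF that] by (simp add: gap_def H_def U_def field_simps power2_eq_square)
  have le: "gap x t \<le> a' + b' * U x t" if "far x t" for t
  proof -
    have "0 < c * (Y0 x t)\<^sup>2" using Y0_pos[OF that] c by simp
    moreover have "0 \<le> c * (Y0 x t)\<^sup>2 * (a' + b' * U x t - gap x t)"
      using nonneg[of t] on[OF that] by simp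
    ultimately show ?thesis by (simp add: zero_le_mult_iff)
  qed
  obtain B where B: "\<And>t. B \<le> gap x t" using gap_bounded by blast
  have "eventually (\<lambda>t. t \<in> {x<..<x + 2 * pi}) (at_right x)"
    by (rule eventually_at_right_real) simp
  then have evr: "eventually (\<lambda>t. far x t) (at_right x)"
    by eventually_elim (auto intro!: far_window)
  have "eventually (\<lambda>t. t \<in> {x - 2 * pi<..<x}) (at_left x)"
    by (rule eventually_at_left_real) simp
  then have evl: "eventually (\<lambda>t. far x t) (at_left x)"
    by eventually_elim (auto intro!: far_window')
  have b0: "b' = 0"
  proof (rule ccontr)
    assume "b' \<noteq> 0"
    then consider "b' < 0" | "0 < b'" by linarith
    then show False
    proof cases
      case 1
      have "eventually (\<lambda>t. (B - a') / b' < U x t) (at_right x)"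
        using U_at_right by (simp add: filterlim_at_top_dense)
      then have "eventually (\<lambda>t. False) (at_right x)"
        using evr
      proof eventually_elim
        case (elim t)
        then have "a' + b' * U x t < B" using 1 by (simp add: field_simps)
        then show False using le[OF elim(2)] B[of t] by linarith
      qed
      then show False by simp
    next
      case 2
      have "eventually (\<lambda>t. U x t < (B - a') / b') (at_left x)"
        using U_at_left by (simp add: filterlim_at_bot_dense)
      then have "eventually (\<lambda>t. False) (at_left x)"
        using evl
      proof eventually_elim
        case (elim t)
        then have "a' + b' * U x t < B" using 2 by (simp add: field_simps)
        then show False using le[OF elim(2)] B[of t] by linarith
      qed
      then show False by simp
    qed
  qed
  have a0: "0 \<le> a'"
  proof (rule tendsto_upperbound)
    have "((\<lambda>t. gap x t) \<longlongrightarrow> gap x x) (at_right x)" by (intro tendsto_intros)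
    then show "((\<lambda>t. gap x t) \<longlongrightarrow> 0) (at_right x)" by (simp add: gap_def)
    show "eventually (\<lambda>t. gap x t \<le> a') (at_right x)"
      using evr by eventually_elim (use le b0 in auto)
  qed simp
  have le': "gap x t \<le> a'" for t
    using le[of t] b0 a0 H_not_far[of x t] by (cases "far x t") (auto simp: gap_def)
  have eq: "gap x r = a'"
    using on[OF r(1)] r(2) c Y0_pos[OF r(1)] b0 by auto
  have M: "M x = a'"
    using M_is_max(1)[of x r] M_is_max(3)[of x, OF le'] eq by simp
  show "r \<in> A x" using M eq by (simp add: A_def)
  show "R p q = c * F x p q" unfolding R' b0 F_def M by simp
qed

lemma jet_conic:
  assumes far: "far s x"
  obtains c a b where "0 < c" "\<And>p q. eps * osc s p q + (gap s x - gap_slope s x * U s x + gap_bend s x / 2 * (U s x)\<^sup>2) * (Y s p q)\<^sup>2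
      + (gap_slope s x - gap_bend s x * U s x) * X s p q * Y s p q + gap_bend s x / 2 * (X s p q)\<^sup>2
    = eps * c * ((X x p q)\<^sup>2 / 2 - Y x p q) + a * (Y x p q)\<^sup>2 + b * X x p q * Y x p q"
proof -
  note pos = Y0_pos[OF far] N_pos[OF far]
  define V w where "V = Y1 s x / N s x" and "w = 1 / Y0 s x"
  show ?thesis
  proof (rule that)
    show "0 < Y0 s x * K s x / N s x" using pos K_pos[of s x] by simp
    fix p q
    have "eps * osc s p q + (gap s x - gap_slope s x * U s x + gap_bend s x / 2 * (U s x)\<^sup>2) * (Y s p q)\<^sup>2
        + (gap_slope s x - gap_bend s x * U s x) * X s p q * Y s p q + gap_bend s x / 2 * (X s p q)\<^sup>2
      = eps * ((Y s p q)\<^sup>2 * w - Y s p q + V * Y s p q * (X s p q - U s x * Y s p q)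
        + E s x / 2 * (X s p q - U s x * Y s p q)\<^sup>2)"
    proof -
      have *: "gap s x = eps * (w - ca s - cb s * U s x - (U s x)\<^sup>2 / 2)"
        "gap_slope s x = eps * (V - cb s - U s x)" "gap_bend s x = eps * (E s x - 1)"
        using far by (simp_all add: gap_def H_eq gap_slope_def gap_bend_def V_def w_def)
      show ?thesis unfolding osc_def *
        by (simp add: algebra_simps power2_eq_square add_divide_distrib diff_divide_distrib)
    qed
    also have "\<dots> = eps * ((Y s p q)\<^sup>2 / Y0 s x - Y s p q + Y1 s x / N s x * Y s p q * (X s p q - U s x * Y s p q)
        + E s x / 2 * (X s p q - U s x * Y s p q)\<^sup>2)"
      by (simp add: V_def w_def)
    also have "\<dots> = eps * ((Y0 s x * K s x / N s x) * ((X x p q)\<^sup>2 / 2 - Y x p q)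
        + (E s x / 2 * (X2 s x - U s x * Y2 s x)\<^sup>2 - K s x * Y2 s x / N s x) * (Y x p q)\<^sup>2
        + (- E s x * (N s x / Y0 s x) * (X2 s x - U s x * Y2 s x) - K s x * Y1 s x / N s x) * X x p q * Y x p q)"
      by (subst tangent_conic_algebra[OF _ _ N_def K_def U_def E_def change_frame[of s p q x]])
        (use pos in auto)
    finally show "eps * osc s p q + (gap s x - gap_slope s x * U s x + gap_bend s x / 2 * (U s x)\<^sup>2) * (Y s p q)\<^sup>2
        + (gap_slope s x - gap_bend s x * U s x) * X s p q * Y s p q + gap_bend s x / 2 * (X s p q)\<^sup>2
      = eps * (Y0 s x * K s x / N s x) * ((X x p q)\<^sup>2 / 2 - Y x p q)
        + (eps * (E s x / 2 * (X2 s x - U s x * Y2 s x)\<^sup>2 - K s x * Y2 s x / N s x)) * (Y x p q)\<^sup>2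
        + (eps * (- E s x * (N s x / Y0 s x) * (X2 s x - U s x * Y2 s x) - K s x * Y1 s x / N s x)) * X x p q * Y x p q"
      by (simp add: algebra_simps)
  qed
qed

text \<open>If the 2-jet of the gap of \<open>s\<close> at \<open>x\<close> dominates the gap, then the corresponding conic is the extremal conic
of \<open>x\<close>, and it touches the curve at \<open>s\<close>. The factor \<open>c\<close> accounts for the different normalisations at the
two points.\<close>

lemma dominating_jet:
  assumes far: "far s x"
    and dom: "\<And>t. far s t \<Longrightarrow> gap s t \<le> gap s x + gap_slope s x * (U s t - U s x) + gap_bend s x / 2 * (U s t - U s x)\<^sup>2"
  obtains c where "0 < c" "s \<in> A x"
    "\<And>p q. Y s p q \<noteq> 0 \<Longrightarrow> c * F x p q = F s p q + (Y s p q)\<^sup>2 *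
      (gap s x + gap_slope s x * (X s p q / Y s p q - U s x) + gap_bend s x / 2 * (X s p q / Y s p q - U s x)\<^sup>2 - M s)"
proof -
  obtain c a b where c: "0 < c" and R: "\<And>p q. eps * osc s p q + (gap s x - gap_slope s x * U s x + gap_bend s x / 2 * (U s x)\<^sup>2) * (Y s p q)\<^sup>2
      + (gap_slope s x - gap_bend s x * U s x) * X s p q * Y s p q + gap_bend s x / 2 * (X s p q)\<^sup>2
    = eps * c * ((X x p q)\<^sup>2 / 2 - Y x p q) + a * (Y x p q)\<^sup>2 + b * X x p q * Y x p q"
    using jet_conic[OF far] by blast
  define R where "R p q = eps * osc s p q + (gap s x - gap_slope s x * U s x + gap_bend s x / 2 * (U s x)\<^sup>2) * (Y s p q)\<^sup>2
      + (gap_slope s x - gap_bend s x * U s x) * X s p q * Y s p q + gap_bend s x / 2 * (X s p q)\<^sup>2" for p q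
  have form: "R p q = F s p q + (Y s p q)\<^sup>2 *
      (gap s x + gap_slope s x * (X s p q / Y s p q - U s x) + gap_bend s x / 2 * (X s p q / Y s p q - U s x)\<^sup>2 - M s)"
    if "Y s p q \<noteq> 0" for p q
  proof -
    define v where "v = X s p q / Y s p q"
    have Xv: "X s p q = v * Y s p q" using that by (simp add: v_def)
    show ?thesis unfolding R_def F_def v_def[symmetric] unfolding Xv
      by (simp add: field_simps power2_eq_square)
  qed
  have nonneg: "0 \<le> R (x0 t) (y0 t)" for t
  proof (cases "far s t")
    case True
    have "R (x0 t) (y0 t) = (Y0 s t)\<^sup>2 * (gap s x + gap_slope s x * (U s t - U s x) + gap_bend s x / 2 * (U s t - U s x)\<^sup>2 - gap s t)"
      using form[of "x0 t" "y0 t"] Y0_pos[OF True] unfolding F_on_curve U_def by (simp add: algebra_simps)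
    then show ?thesis using dom[OF True] by simp
  next
    case False
    then obtain n :: int where n: "t = s + 2 * pi * of_int n" by (rule not_farE)
    show ?thesis by (simp add: n curve_periodic R_def osc_contact)
  qed
  have zero: "R (x0 s) (y0 s) = 0" by (simp add: R_def osc_contact)
  have farx: "far x s" using far far_sym by blast
  note rec = recognise_F[of c R x a b s, OF c R[folded R_def] nonneg farx zero]
  show ?thesis
    using that[OF c rec(1)] form rec(2) by simp
qed

lemma far_reduce: "far s t \<Longrightarrow> \<exists>n::int. s < t + 2 * pi * of_int n \<and> t + 2 * pi * of_int n < s + 2 * pi"
proof -
  assume f: "far s t"
  obtain n :: int where n: "s \<le> t + 2 * pi * of_int n" "t + 2 * pi * of_int n < s + 2 * pi"
    using window_rep by blast
  moreover have "s \<noteq> t + 2 * pi * of_int n"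
    using f far_sym[of s t] by (auto simp: far_def)
  ultimately show ?thesis by (intro exI[of _ n]) auto
qed

lemma calculus_along_curve:
  assumes "far s t"
  shows "(U s has_real_derivative - N s t / (Y0 s t)\<^sup>2) (at t)" "- N s t / (Y0 s t)\<^sup>2 < 0"
    "(gap s has_real_derivative - N s t / (Y0 s t)\<^sup>2 * gap_slope s t) (at t)"
    "(gap_slope s has_real_derivative - N s t / (Y0 s t)\<^sup>2 * gap_bend s t) (at t)"
  using U_deriv[OF assms] gap_deriv[OF assms] gap_slope_deriv[OF assms] N_pos[OF assms] Y0_pos[OF assms]
  by (auto intro!: divide_neg_pos)

lemma gap_bend_continuous: "continuous_on S (gap_bend s)"
  by (intro continuous_at_imp_continuous_on ballI gap_bend_isCont)

text \<open>The points beyond \<open>p\<close> are no contacts of \<open>x\<close>. The last conclusion strengthens this from points of the curve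
to all points \<open>(q1, q2)\<close> of the plane that are seen from \<open>s\<close> in the direction of such a point.\<close>

lemma step_conic_right:
  assumes p: "p \<in> A s" "s < p" "p < s + 2 * pi" and m: "s < m" "m < p" "m \<notin> A s"
  obtains x c where "s < x" "x < p" "0 < c" "s \<in> A x" "\<And>t. p \<le> t \<Longrightarrow> t < s + 2 * pi \<Longrightarrow> t \<notin> A x"
    "\<And>t q1 q2. p \<le> t \<Longrightarrow> t < s + 2 * pi \<Longrightarrow> 0 < Y s q1 q2 \<Longrightarrow> X s q1 q2 / Y s q1 q2 = U s t \<Longrightarrow>
      F s q1 q2 < c * F x q1 q2"
proof -
  obtain B where B: "\<And>t. B \<le> gap s t" using gap_bounded by blast
  have fw: "far s t" if "t \<in> {s<..<s + 2 * pi}" for t using that by (intro far_window) auto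
  have mM: "gap s p = M s" "m \<in> {s<..<p}" "gap s m < M s"
    using p m M_is_max(1)[of s m] by (auto simp: A_def)
  obtain x where x': "x \<in> {s<..<p}"
    and P1: "\<And>t. t \<in> {s<..p} \<Longrightarrow> gap s t \<le> gap s x + gap_slope s x * (U s t - U s x) + gap_bend s x / 2 * (U s t - U s x)\<^sup>2"
    and P2: "\<And>v. v \<le> U s p \<Longrightarrow> M s < gap s x + gap_slope s x * (v - U s x) + gap_bend s x / 2 * (v - U s x)\<^sup>2"
    using jet_exceeding_right[OF calculus_along_curve[OF fw] p(2,3) gap_bend_continuous gap_bend_self U_at_right B M_is_max(1) mM]
    by blast
  from x' have x: "s < x" "x < p" by auto
  have Ule: "U s t \<le> U s p" if "p \<le> t" "t < s + 2 * pi" for t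
    using U_decreasing(1)[of s p t] that p by (cases "t = p") auto
  have farx: "far s x" using x p by (intro far_window) auto
  have dom: "gap s t \<le> gap s x + gap_slope s x * (U s t - U s x) + gap_bend s x / 2 * (U s t - U s x)\<^sup>2" if ft: "far s t" for t
  proof -
    obtain n :: int where n: "s < t + 2 * pi * of_int n" "t + 2 * pi * of_int n < s + 2 * pi"
      using far_reduce[OF ft] by blast
    define t' where "t' = t + 2 * pi * of_int n"
    have eq: "gap s t = gap s t'" "U s t = U s t'" by (simp_all add: t'_def gap_periodic U_periodic)
    show ?thesis
    proof (cases "t' \<le> p")
      case True then show ?thesis using P1[of t'] n by (simp add: eq t'_def)
    next
      case False
      then have "M s < gap s x + gap_slope s x * (U s t' - U s x) + gap_bend s x / 2 * (U s t' - U s x)\<^sup>2"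
        using P2 Ule n by (simp add: t'_def)
      then show ?thesis using M_is_max(1)[of s t'] unfolding eq by linarith
    qed
  qed
  from dominating_jet[OF farx dom] obtain c where c: "0 < c" "s \<in> A x"
    "\<And>p q. Y s p q \<noteq> 0 \<Longrightarrow> c * F x p q = F s p q + (Y s p q)\<^sup>2 *
      (gap s x + gap_slope s x * (X s p q / Y s p q - U s x) + gap_bend s x / 2 * (X s p q / Y s p q - U s x)\<^sup>2 - M s)"
    by blast
  have gt: "F s q1 q2 < c * F x q1 q2" if "p \<le> t" "t < s + 2 * pi" "0 < Y s q1 q2" "X s q1 q2 / Y s q1 q2 = U s t" for t q1 q2
    using P2[OF Ule[OF that(1,2)]] that(3,4) c(3)[of q1 q2] by simp
  have "t \<notin> A x" if t: "p \<le> t" "t < s + 2 * pi" for t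
  proof -
    have f: "far s t" "far x t" using t p x by (auto intro!: far_window)
    have "F s (x0 t) (y0 t) < c * F x (x0 t) (y0 t)"
      by (rule gt[OF t]) (use Y0_pos[OF f(1)] in \<open>auto simp: U_def\<close>)
    then have "F x (x0 t) (y0 t) \<noteq> 0" using F_nonneg[of s t] by auto
    then show ?thesis using F_zero_iff[OF f(2)] by blast
  qed
  then show ?thesis using that[OF x c(1,2)] gt by blast
qed

lemma step_conic_left:
  assumes p: "p \<in> A s" "s - 2 * pi < p" "p < s" and m: "p < m" "m < s" "m \<notin> A s"
  obtains x c where "p < x" "x < s" "0 < c" "s \<in> A x" "\<And>t. s - 2 * pi < t \<Longrightarrow> t \<le> p \<Longrightarrow> t \<notin> A x"
    "\<And>t q1 q2. s - 2 * pi < t \<Longrightarrow> t \<le> p \<Longrightarrow> 0 < Y s q1 q2 \<Longrightarrow> X s q1 q2 / Y s q1 q2 = U s t \<Longrightarrow>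
      F s q1 q2 < c * F x q1 q2"
proof -
  obtain B where B: "\<And>t. B \<le> gap s t" using gap_bounded by blast
  have fw: "far s t" if "t \<in> {s - 2 * pi<..<s}" for t using that by (intro far_window') auto
  have mM: "gap s p = M s" "m \<in> {p<..<s}" "gap s m < M s"
    using p m M_is_max(1)[of s m] by (auto simp: A_def)
  obtain x where x': "x \<in> {p<..<s}"
    and P1: "\<And>t. t \<in> {p..<s} \<Longrightarrow> gap s t \<le> gap s x + gap_slope s x * (U s t - U s x) + gap_bend s x / 2 * (U s t - U s x)\<^sup>2"
    and P2: "\<And>v. U s p \<le> v \<Longrightarrow> M s < gap s x + gap_slope s x * (v - U s x) + gap_bend s x / 2 * (v - U s x)\<^sup>2"
    using jet_exceeding_left[OF calculus_along_curve[OF fw] p(2,3) gap_bend_continuous gap_bend_self U_at_left B M_is_max(1) mM]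
    by blast
  from x' have x: "p < x" "x < s" by auto
  have Ule: "U s p \<le> U s t" if "t \<le> p" "s - 2 * pi < t" for t
    using U_decreasing(2)[of s t p] that p by (cases "t = p") auto
  have farx: "far s x" using x p by (intro far_window') auto
  have dom: "gap s t \<le> gap s x + gap_slope s x * (U s t - U s x) + gap_bend s x / 2 * (U s t - U s x)\<^sup>2" if ft: "far s t" for t
  proof -
    obtain n :: int where n: "s < t + 2 * pi * of_int n" "t + 2 * pi * of_int n < s + 2 * pi"
      using far_reduce[OF ft] by blast
    define t' where "t' = t + 2 * pi * of_int (n - 1)"
    have t': "s - 2 * pi < t'" "t' < s" using n by (simp_all add: t'_def algebra_simps)
    have eq: "gap s t = gap s t'" "U s t = U s t'" by (simp_all only: t'_def gap_periodic U_periodic)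
    show ?thesis
    proof (cases "p \<le> t'")
      case True then show ?thesis using P1[of t'] t' by (simp add: eq)
    next
      case False
      then have "M s < gap s x + gap_slope s x * (U s t' - U s x) + gap_bend s x / 2 * (U s t' - U s x)\<^sup>2"
        using P2 Ule t' by simp
      then show ?thesis using M_is_max(1)[of s t'] unfolding eq by linarith
    qed
  qed
  from dominating_jet[OF farx dom] obtain c where c: "0 < c" "s \<in> A x"
    "\<And>p q. Y s p q \<noteq> 0 \<Longrightarrow> c * F x p q = F s p q + (Y s p q)\<^sup>2 *
      (gap s x + gap_slope s x * (X s p q / Y s p q - U s x) + gap_bend s x / 2 * (X s p q / Y s p q - U s x)\<^sup>2 - M s)"
    by blast
  have gt: "F s q1 q2 < c * F x q1 q2" if "s - 2 * pi < t" "t \<le> p" "0 < Y s q1 q2" "X s q1 q2 / Y s q1 q2 = U s t" for t q1 q2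
    using P2[OF Ule[OF that(2,1)]] that(3,4) c(3)[of q1 q2] by simp
  have "t \<notin> A x" if t: "s - 2 * pi < t" "t \<le> p" for t
  proof -
    have f: "far s t" "far x t" using t p x by (auto intro!: far_window')
    have "F s (x0 t) (y0 t) < c * F x (x0 t) (y0 t)"
      by (rule gt[OF t]) (use Y0_pos[OF f(1)] in \<open>auto simp: U_def\<close>)
    then have "F x (x0 t) (y0 t) \<noteq> 0" using F_nonneg[of s t] by auto
    then show ?thesis using F_zero_iff[OF f(2)] by blast
  qed
  then show ?thesis using that[OF x c(1,2)] gt by blast
qed

text \<open>The second derivative of a nonconstant gap has a positive maximum over the whole line. The parabola with the
2-jet at such a maximum dominates the gap everywhere, so it is the extremal conic of that point.\<close>

lemma exists_conic_touching:
  assumes m: "m \<in> {s<..<s + 2 * pi}" "r \<in> {s<..<s + 2 * pi}" "gap s m \<noteq> gap s r"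
  obtains x where "s < x" "x < s + 2 * pi" "s \<in> A x"
proof -
  obtain B where B: "\<And>t. B \<le> gap s t" using gap_bounded by blast
  have fw: "far s t" if "t \<in> {s<..<s + 2 * pi}" for t using that by (intro far_window) auto
  have e2: "gap_bend s (s + 2 * pi) = 0" using gap_bend_periodic[of s s 1] by simp
  obtain x where x': "x \<in> {s<..<s + 2 * pi}"
    and P: "\<And>t. t \<in> {s<..<s + 2 * pi} \<Longrightarrow> gap s t \<le> gap s x + gap_slope s x * (U s t - U s x) + gap_bend s x / 2 * (U s t - U s x)\<^sup>2"
    using jet_dominates_globally[OF calculus_along_curve[OF fw] gap_bend_continuous gap_bend_self e2 U_at_right U_at_left_next B m]
    by blast
  from x' have x: "s < x" "x < s + 2 * pi" by auto
  have farx: "far s x" using x by (intro far_window) auto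
  have dom: "gap s t \<le> gap s x + gap_slope s x * (U s t - U s x) + gap_bend s x / 2 * (U s t - U s x)\<^sup>2" if ft: "far s t" for t
  proof -
    obtain n :: int where n: "s < t + 2 * pi * of_int n" "t + 2 * pi * of_int n < s + 2 * pi"
      using far_reduce[OF ft] by blast
    then show ?thesis using P[of "t + 2 * pi * of_int n"] by (simp add: gap_periodic U_periodic)
  qed
  show ?thesis using dominating_jet[OF farx dom] that x by blast
qed

end

section \<open>Shrinking the arc of contacts\<close>

lemma positive_under_small_perturbation:
  fixes g0 g1 :: "real \<Rightarrow> real"
  assumes "continuous_on {a..b} g0" "continuous_on {a..b} g1" and pos: "\<And>t. t \<in> {a..b} \<Longrightarrow> 0 < g0 t"
  shows "\<exists>d>0. \<forall>l. \<bar>l\<bar> < d \<longrightarrow> (\<forall>t\<in>{a..b}. 0 < g0 t + l * g1 t)"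
proof (cases "a \<le> b")
  case True
  then have ne: "{a..b} \<noteq> {}" by simp
  obtain u where u: "u \<in> {a..b}" "\<forall>t\<in>{a..b}. g0 u \<le> g0 t"
    using continuous_attains_inf[OF compact_Icc ne assms(1)] by blast
  have "continuous_on {a..b} (\<lambda>t. \<bar>g1 t\<bar>)" using assms(2) by (intro continuous_intros)
  from continuous_attains_sup[OF compact_Icc ne this]
  obtain v where v: "v \<in> {a..b}" "\<forall>t\<in>{a..b}. \<bar>g1 t\<bar> \<le> \<bar>g1 v\<bar>" by blast
  define d where "d = g0 u / (\<bar>g1 v\<bar> + 1)"
  have "0 < d" using pos[OF u(1)] by (simp add: d_def)
  moreover have "0 < g0 t + l * g1 t" if "\<bar>l\<bar> < d" "t \<in> {a..b}" for l t
  proof -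
    have "\<bar>l * g1 t\<bar> \<le> \<bar>l\<bar> * (\<bar>g1 v\<bar> + 1)"
      using v(2) that(2) by (auto simp: abs_mult intro!: mult_left_mono add_increasing2)
    also have "\<dots> < g0 u" using that(1) by (simp add: d_def pos_less_divide_eq)
    finally show ?thesis using u(2) that(2) by force
  qed
  ultimately show ?thesis by blast
qed (auto intro!: exI[of _ 1])

context signed_oval begin

lemma M_isCont: "isCont M s"
proof -
  have "\<exists>d>0. \<forall>s'. \<bar>s' - s\<bar> < d \<longrightarrow> \<bar>M s' - M s\<bar> < e" if e: "0 < e" for e
  proof -
    have cont: "continuous_on ({s - 1..s + 1} \<times> {0..2 * pi}) (\<lambda>(s, t). gap s t)"
      unfolding continuous_on_def case_prod_unfold by (intro ballI tendsto_intros)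
    have "uniformly_continuous_on ({s - 1..s + 1} \<times> {0..2 * pi}) (\<lambda>(s, t). gap s t)"
      by (rule compact_uniformly_continuous[OF cont compact_Times[OF compact_Icc compact_Icc]])
    then obtain d where d: "0 < d" "\<And>x x'. x \<in> {s - 1..s + 1} \<times> {0..2 * pi} \<Longrightarrow> x' \<in> {s - 1..s + 1} \<times> {0..2 * pi} \<Longrightarrow>
        dist x' x < d \<Longrightarrow> dist (case x' of (s, t) \<Rightarrow> gap s t) (case x of (s, t) \<Rightarrow> gap s t) < e / 2"
      unfolding uniformly_continuous_on_def using e half_gt_zero[OF e] by metis
    have near: "\<bar>gap s' t - gap s t\<bar> < e / 2" if s': "\<bar>s' - s\<bar> < min d 1" for s' t
    proof -
      obtain n :: int where n: "0 \<le> t + 2 * pi * of_int n" "t + 2 * pi * of_int n < 0 + 2 * pi"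
        using window_rep by blast
      have "dist (s', t + 2 * pi * of_int n) (s, t + 2 * pi * of_int n) < d"
        using s' by (simp add: dist_prod_def dist_real_def)
      moreover have "s - 1 \<le> s'" "s' \<le> s + 1" using s' by linarith+
      ultimately show ?thesis
        using d(2)[of "(s, t + 2 * pi * of_int n)" "(s', t + 2 * pi * of_int n)"] n
        by (auto simp: gap_periodic dist_real_def)
    qed
    have "\<bar>M s' - M s\<bar> < e" if s': "\<bar>s' - s\<bar> < min d 1" for s'
    proof -
      have "M s' \<le> M s + e / 2"
      proof (rule M_is_max(3))
        show "gap s' t \<le> M s + e / 2" for t
          using near[OF s', of t] M_is_max(1)[of s t] by linarith
      qed
      moreover have "M s \<le> M s' + e / 2"
      proof (rule M_is_max(3))
        show "gap s t \<le> M s' + e / 2" for t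
          using near[OF s', of t] M_is_max(1)[of s' t] by linarith
      qed
      ultimately show ?thesis using e by linarith
    qed
    then show ?thesis using d(1) by (intro exI[of _ "min d 1"]) auto
  qed
  then show ?thesis unfolding continuous_at_eps_delta by (auto simp: dist_real_def)
qed

lemma F_tendsto [tendsto_intros]:
  assumes "(a \<longlongrightarrow> s) G" "(f \<longlongrightarrow> p) G" "(g \<longlongrightarrow> q) G"
  shows "((\<lambda>n. F (a n) (f n) (g n)) \<longlongrightarrow> F s p q) G"
  unfolding F_def by (intro tendsto_intros assms isCont_tendsto_compose[OF M_isCont])

lemma A_closed: "closed (A s)"
proof -
  have "A s = {t. gap s t = M s}" by (simp add: A_def)
  then show ?thesis
    using continuous_closed_vimage[of "{M s}" "gap s"] gap_continuous[of UNIV s]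
    by (simp add: vimage_def continuous_on_eq_continuous_at)
qed

lemma A_nonempty: "\<exists>t. t \<in> A s"
  using M_is_max(2) by (auto simp: A_def)

lemma A_base_periodic: "A (s + 2 * pi * of_int n) = A s"
proof -
  have "gap (s + 2 * pi * of_int n) = gap s" by (intro ext) (simp add: gap_periodic)
  then show ?thesis by (simp add: A_def M_def)
qed

lemma A_not_far: "\<not> far s t \<Longrightarrow> t \<in> A r \<longleftrightarrow> s \<in> A r"
  by (erule not_farE) (simp add: A_periodic)

text \<open>The arc \<open>A s\<close> is described by a lift \<open>{a..b}\<close> to the line. If \<open>b - a \<ge> 2 * pi\<close>, it is the whole circle.\<close>

definition clean :: "real \<Rightarrow> bool" where
  "clean s \<longleftrightarrow> (\<exists>a b. a \<le> s \<and> s \<le> b \<and> A s = {t. \<exists>n::int. a \<le> t + 2 * pi * of_int n \<and> t + 2 * pi * of_int n \<le> b})"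

text \<open>Cutting the circle at a point \<open>c\<close> that is not a contact turns the contacts into a compact set of reals, and
the arc which they span together with \<open>s\<close> into an interval.\<close>

definition cut_at :: "real \<Rightarrow> real \<Rightarrow> bool" where
  "cut_at c s \<longleftrightarrow> c < s \<and> s < c + 2 * pi \<and> c \<notin> A s"

definition contacts :: "real \<Rightarrow> real \<Rightarrow> real set" where
  "contacts c s = insert s (A s \<inter> {c..c + 2 * pi})"

definition first_contact :: "real \<Rightarrow> real \<Rightarrow> real" where "first_contact c s = Inf (contacts c s)"
definition last_contact :: "real \<Rightarrow> real \<Rightarrow> real" where "last_contact c s = Sup (contacts c s)"

lemma contacts_compact: "compact (contacts c s)" "contacts c s \<noteq> {}" "bdd_below (contacts c s)" "bdd_above (contacts c s)"
proof -
  have "compact (A s \<inter> {c..c + 2 * pi})"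
    using A_closed compact_Icc by (rule closed_Int_compact)
  then show *: "compact (contacts c s)" unfolding contacts_def by (rule compact_insert)
  show "contacts c s \<noteq> {}" by (simp add: contacts_def)
  show "bdd_below (contacts c s)" "bdd_above (contacts c s)"
    using compact_imp_bounded[OF *] bounded_imp_bdd_below bounded_imp_bdd_above by auto
qed

lemma first_last_contact_in: "first_contact c s \<in> contacts c s" "last_contact c s \<in> contacts c s"
  unfolding first_contact_def last_contact_def using contacts_compact[of c s]
  by (auto intro!: closed_contains_Inf closed_contains_Sup compact_imp_closed)

lemma first_last_contact_bounds: "t \<in> contacts c s \<Longrightarrow> first_contact c s \<le> t" "t \<in> contacts c s \<Longrightarrow> t \<le> last_contact c s"
  unfolding first_contact_def last_contact_def using contacts_compact[of c s] by (auto intro: cInf_lower cSup_upper)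

lemma contact_bounds:
  assumes "cut_at c s"
  shows "c < first_contact c s" "first_contact c s \<le> s" "s \<le> last_contact c s" "last_contact c s < c + 2 * pi"
    "first_contact c s = s \<or> first_contact c s \<in> A s" "last_contact c s = s \<or> last_contact c s \<in> A s"
    "\<And>t. t \<in> A s \<Longrightarrow> c \<le> t \<Longrightarrow> t \<le> c + 2 * pi \<Longrightarrow> first_contact c s \<le> t \<and> t \<le> last_contact c s"
proof -
  have g: "c < s" "s < c + 2 * pi" "c \<notin> A s" "c + 2 * pi \<notin> A s"
    using assms A_periodic[of c 1 s] by (auto simp: cut_at_def)
  show "first_contact c s \<le> s" "s \<le> last_contact c s"
    by (auto intro!: first_last_contact_bounds simp: contacts_def)
  show "first_contact c s = s \<or> first_contact c s \<in> A s" "last_contact c s = s \<or> last_contact c s \<in> A s"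
    using first_last_contact_in[of c s] by (auto simp: contacts_def)
  show "c < first_contact c s" "last_contact c s < c + 2 * pi"
    using first_last_contact_in[of c s] g by (auto simp: contacts_def less_le)
  show "\<And>t. t \<in> A s \<Longrightarrow> c \<le> t \<Longrightarrow> t \<le> c + 2 * pi \<Longrightarrow> first_contact c s \<le> t \<and> t \<le> last_contact c s"
    using first_last_contact_bounds[of _ c s] by (auto simp: contacts_def)
qed

text \<open>These are the points which, from every base point in \<open>{a..b}\<close>, are seen in the direction of some point of the
complementary arc. The step compares two forms at such points, whichever base point is used, and the set
grows when \<open>{a..b}\<close> shrinks, so that comparisons can be chained.\<close>

definition outer_sector :: "real \<Rightarrow> real \<Rightarrow> (real \<times> real) set" where
  "outer_sector a b = {(p, q). \<forall>s\<in>{a..b}. 0 < Y s p q \<and> (\<exists>t. b < t \<and> t < a + 2 * pi \<and> X s p q / Y s p q = U s t)}"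

lemma outer_sector_mono: "a \<le> a' \<Longrightarrow> b' \<le> b \<Longrightarrow> outer_sector a b \<subseteq> outer_sector a' b'"
  unfolding outer_sector_def by force

text \<open>Near a point of the complementary arc the direction depends continuously on the base point, which ranges over
a compact interval; hence the sector contains a neighbourhood of that point on each line through it.\<close>

lemma outer_sector_nbhd:
  assumes ab: "a \<le> b" and t: "b < t" "t < a + 2 * pi"
  shows "\<exists>d>0. \<forall>l. \<bar>l\<bar> < d \<longrightarrow> (x0 t + l * v, y0 t + l * w) \<in> outer_sector a b"
proof -
  \<comment> \<open>\<open>t1\<close> and \<open>t2\<close> bound the directions from both sides; they are different from all base points\<close>
  define t1 t2 where "t1 = (b + t) / 2" and "t2 = (t + (a + 2 * pi)) / 2"
  have t12: "b < t1" "t1 < t" "t < t2" "t2 < a + 2 * pi"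
    using t unfolding t1_def t2_def by (auto simp: field_simps)
  define XX where "XX s l = X0 s t + l * cX s v w" for s l
  define YY where "YY s l = Y0 s t + l * cY s v w" for s l
  have XX: "X s (x0 t + l * v) (y0 t + l * w) = XX s l" for s l
    by (simp add: X_def XX_def cX_def algebra_simps add_divide_distrib diff_divide_distrib)
  have YY: "Y s (x0 t + l * v) (y0 t + l * w) = YY s l" for s l
    by (simp add: Y_def YY_def cY_def algebra_simps add_divide_distrib diff_divide_distrib)
  have far: "far s r" if "s \<in> {a..b}" "r \<in> {t1..t2}" for s r
    using that t12 by (intro far_window) auto
  have dec: "U s t < U s t1" "U s t2 < U s t" if "s \<in> {a..b}" for s
    using that t12 by (auto intro!: U_decreasing(1))
  have Yp: "0 < Y0 s r" if "s \<in> {a..b}" "r \<in> {t1..t2}" for s r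
    using Y0_pos[OF far[OF that]] .
  have cont: "continuous_on {a..b} (\<lambda>s. X s p q)" "continuous_on {a..b} (\<lambda>s. Y s p q)"
    "continuous_on {a..b} (\<lambda>s. cX s p q)" "continuous_on {a..b} (\<lambda>s. cY s p q)" for p q
    unfolding continuous_on_def by (intro ballI tendsto_intros)+
  have "\<exists>d>0. \<forall>l. \<bar>l\<bar> < d \<longrightarrow> (\<forall>s\<in>{a..b}. 0 < Y0 s t + l * cY s v w)"
    by (rule positive_under_small_perturbation[OF cont(2,4)]) (use Yp t12 in auto)
  then obtain d0 where d0: "0 < d0" "\<And>l s. \<bar>l\<bar> < d0 \<Longrightarrow> s \<in> {a..b} \<Longrightarrow> 0 < YY s l"
    unfolding YY_def by blast
  have "\<exists>d>0. \<forall>l. \<bar>l\<bar> < d \<longrightarrow> (\<forall>s\<in>{a..b}. 0 < (X0 s t1 * Y0 s t - X0 s t * Y0 s t1) + l * (X0 s t1 * cY s v w - cX s v w * Y0 s t1))"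
  proof (rule positive_under_small_perturbation)
    fix s assume s: "s \<in> {a..b}"
    show "0 < X0 s t1 * Y0 s t - X0 s t * Y0 s t1"
      using dec(1)[OF s] Yp[OF s, of t] Yp[OF s, of t1] t12 by (simp add: U_def divide_simps split: if_splits)
  qed (intro continuous_intros cont)+
  then obtain d1 where d1: "0 < d1" "\<And>l s. \<bar>l\<bar> < d1 \<Longrightarrow> s \<in> {a..b} \<Longrightarrow> 0 < X0 s t1 * YY s l - XX s l * Y0 s t1"
    unfolding XX_def YY_def by (auto simp: algebra_simps)
  have "\<exists>d>0. \<forall>l. \<bar>l\<bar> < d \<longrightarrow> (\<forall>s\<in>{a..b}. 0 < (X0 s t * Y0 s t2 - X0 s t2 * Y0 s t) + l * (cX s v w * Y0 s t2 - X0 s t2 * cY s v w))"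
  proof (rule positive_under_small_perturbation)
    fix s assume s: "s \<in> {a..b}"
    show "0 < X0 s t * Y0 s t2 - X0 s t2 * Y0 s t"
      using dec(2)[OF s] Yp[OF s, of t] Yp[OF s, of t2] t12 by (simp add: U_def divide_simps split: if_splits)
  qed (intro continuous_intros cont)+
  then obtain d2 where d2: "0 < d2" "\<And>l s. \<bar>l\<bar> < d2 \<Longrightarrow> s \<in> {a..b} \<Longrightarrow> 0 < XX s l * Y0 s t2 - X0 s t2 * YY s l"
    unfolding XX_def YY_def by (auto simp: algebra_simps)
  have "(x0 t + l * v, y0 t + l * w) \<in> outer_sector a b" if l: "\<bar>l\<bar> < min d0 (min d1 d2)" for l
  proof -
    have "0 < YY s l \<and> (\<exists>r. b < r \<and> r < a + 2 * pi \<and> XX s l / YY s l = U s r)" if s: "s \<in> {a..b}" for s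
    proof -
      have pos: "0 < YY s l" "0 < Y0 s t1" "0 < Y0 s t2" using d0 l s Yp[OF s] t12 by auto
      have "0 < X0 s t1 * YY s l - XX s l * Y0 s t1" "0 < XX s l * Y0 s t2 - X0 s t2 * YY s l"
        using d1 d2 l s by auto
      then have le: "U s t2 \<le> XX s l / YY s l" "XX s l / YY s l \<le> U s t1"
        using pos by (simp_all add: U_def divide_simps split: if_splits)
      have "continuous_on {t1..t2} (U s)"
        by (intro continuous_at_imp_continuous_on ballI DERIV_isCont[OF U_deriv] far[OF s])
      from IVT2'[OF le _ this] obtain r where "t1 \<le> r" "r \<le> t2" "U s r = XX s l / YY s l"
        using t12 by auto
      then show ?thesis using pos t12 by (intro conjI exI[of _ r]) auto
    qed
    then show ?thesis unfolding outer_sector_def by (auto simp: XX YY)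
  qed
  then show ?thesis using d0 d1 d2 by (intro exI[of _ "min d0 (min d1 d2)"]) auto
qed

text \<open>Comparing signs rather than values makes the relation independent of the normalisation of the forms, which
changes at each step.\<close>

definition improves :: "real \<Rightarrow> real \<Rightarrow> real \<Rightarrow> bool" where
  "improves c s x \<longleftrightarrow> cut_at c s \<and> cut_at c x \<and> first_contact c s \<le> first_contact c x \<and> last_contact c x \<le> last_contact c s \<and>
    (\<forall>(p, q)\<in>outer_sector (first_contact c s) (last_contact c s). 0 \<le> F s p q \<longrightarrow> 0 \<le> F x p q)"

lemma improves_refl: "cut_at c s \<Longrightarrow> improves c s s"
  by (auto simp: improves_def)

lemma improves_trans: "improves c s x \<Longrightarrow> improves c x z \<Longrightarrow> improves c s z"
  unfolding improves_def using outer_sector_mono[of "first_contact c s" "first_contact c x" "last_contact c x" "last_contact c s"] by fastforce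

text \<open>On the chord from a contact \<open>t\<close> to the base point \<open>s\<close> the form changes its sign at \<open>t\<close>: its first derivative
there is a nonzero multiple of \<open>Y s\<close>.\<close>

lemma F_along_chord:
  assumes F0: "F s (x0 t) (y0 t) = 0"
  shows "F s (x0 t + l * (x0 s - x0 t)) (y0 t + l * (y0 s - y0 t)) = - eps * l * (1 - l) * Y0 s t"
proof -
  have XY: "X s (x0 t + l * (x0 s - x0 t)) (y0 t + l * (y0 s - y0 t)) = (1 - l) * X0 s t"
    "Y s (x0 t + l * (x0 s - x0 t)) (y0 t + l * (y0 s - y0 t)) = (1 - l) * Y0 s t"
    by (simp_all add: X_def Y_def cX_def cY_def algebra_simps add_divide_distrib diff_divide_distrib)
  define T where "T = eps * (ca s * (Y0 s t)\<^sup>2 + cb s * X0 s t * Y0 s t + (X0 s t)\<^sup>2 / 2) + M s * (Y0 s t)\<^sup>2"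
  have T: "T = eps * Y0 s t" using F0 by (simp add: T_def F_def osc_def algebra_simps)
  have "F s (x0 t + l * (x0 s - x0 t)) (y0 t + l * (y0 s - y0 t)) = (1 - l)\<^sup>2 * T - (1 - l) * (eps * Y0 s t)"
    unfolding F_def osc_def XY T_def by (simp add: algebra_simps power2_eq_square)
  also have "\<dots> = - eps * l * (1 - l) * Y0 s t"
    unfolding T by (simp add: algebra_simps power2_eq_square)
  finally show ?thesis .
qed

text \<open>The limit \<open>y\<close> of a subsequence is an upper bound. The point is that contacts of \<open>y\<close> cannot appear outside the
earlier arcs: by \<open>F_along_chord\<close> the form of \<open>y\<close> would be negative arbitrarily close to such a contact \<open>t\<close>,
within the outer sector and where the form of \<open>f k\<close> is positive; but there the forms of all later
members of the sequence are nonnegative.\<close>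

lemma improving_sequence_bounded:
  fixes f :: "nat \<Rightarrow> real"
  assumes step: "\<And>n. improves c (f n) (f (Suc n))"
  shows "\<exists>y. \<forall>n. improves c (f n) y"
proof -
  have cut: "cut_at c (f n)" for n using step[of n] by (simp add: improves_def)
  have chain: "improves c (f n) (f m)" if "n \<le> m" for n m
    using that
  proof (induction m rule: dec_induct)
    case base show ?case by (rule improves_refl[OF cut])
  next
    case (step m) then show ?case using improves_trans assms by blast
  qed
  have in0: "f m \<in> {first_contact c (f n)..last_contact c (f n)}" if "n \<le> m" for n m
    using chain[OF that] contact_bounds(2,3)[OF cut[of m]] unfolding improves_def by auto
  have "seq_compact {first_contact c (f 0)..last_contact c (f 0)}" by (simp add: compact_imp_seq_compact)
  then obtain y r where y: "y \<in> {first_contact c (f 0)..last_contact c (f 0)}" and r: "strict_mono r" "(f \<circ> r) \<longlonglongrightarrow> y"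
    using in0[of 0] unfolding seq_compact_def by (meson le0)
  have lim: "(\<lambda>n. f (r n)) \<longlonglongrightarrow> y" using r(2) by (simp add: o_def)
  have big: "eventually (\<lambda>n. k \<le> r n) sequentially" for k
    using eventually_ge_at_top[of k] by eventually_elim (meson le_trans r(1) seq_suble)
  have yin: "y \<in> {first_contact c (f k)..last_contact c (f k)}" for k
  proof (rule Lim_in_closed_set[OF closed_real_atLeastAtMost _ _ lim])
    show "eventually (\<lambda>n. f (r n) \<in> {first_contact c (f k)..last_contact c (f k)}) sequentially"
      using big[of k] by eventually_elim (rule in0)
  qed simp
  have Fpos: "0 \<le> F y p q" if V: "(p, q) \<in> outer_sector (first_contact c (f k)) (last_contact c (f k))" "0 \<le> F (f k) p q" for k p q
  proof (rule tendsto_lowerbound)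
    show "(\<lambda>n. F (f (r n)) p q) \<longlonglongrightarrow> F y p q" by (intro tendsto_intros lim)
    show "eventually (\<lambda>n. 0 \<le> F (f (r n)) p q) sequentially"
      using big[of k]
    proof eventually_elim
      case (elim n)
      then show ?case using chain[OF elim] V unfolding improves_def by auto
    qed
  qed simp
  have noA: "t \<notin> A y" if t: "last_contact c (f k) < t" "t < first_contact c (f k) + 2 * pi" for k t
  proof
    assume tA: "t \<in> A y"
    note gb = contact_bounds[OF cut[of k]]
    have fy: "far y t" using yin[of k] t by (intro far_window) auto
    have fk: "far (f k) t" using gb t by (intro far_window) auto
    have Fy: "F y (x0 t) (y0 t) = 0" using F_zero_iff[OF fy] tA by simp
    have tk: "t \<notin> A (f k)"
    proof (cases "t \<le> c + 2 * pi")
      case True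
      then show ?thesis using gb t by force
    next
      case False
      have "t + 2 * pi * of_int (- 1) \<notin> A (f k)"
      proof
        assume "t + 2 * pi * of_int (- 1) \<in> A (f k)"
        from gb(7)[OF this] False t gb show False by auto
      qed
      then show ?thesis unfolding A_periodic .
    qed
    have Fk: "0 < F (f k) (x0 t) (y0 t)"
      using F_nonneg[of "f k" t] F_zero_iff[OF fk] tk by force
    define v w where "v = x0 y - x0 t" and "w = y0 y - y0 t"
    obtain d1 where d1: "0 < d1" "\<And>l. \<bar>l\<bar> < d1 \<Longrightarrow> (x0 t + l * v, y0 t + l * w) \<in> outer_sector (first_contact c (f k)) (last_contact c (f k))"
      using outer_sector_nbhd[of "first_contact c (f k)" "last_contact c (f k)" t v w] gb t by force
    have "((\<lambda>l. F (f k) (x0 t + l * v) (y0 t + l * w)) \<longlongrightarrow> F (f k) (x0 t + 0 * v) (y0 t + 0 * w)) (at 0)"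
      by (intro tendsto_intros)
    then have "eventually (\<lambda>l. 0 < F (f k) (x0 t + l * v) (y0 t + l * w)) (at 0)"
      using Fk by (intro order_tendstoD(1)) auto
    then obtain d2 where d2: "0 < d2" "\<And>l. l \<noteq> 0 \<Longrightarrow> \<bar>l\<bar> < d2 \<Longrightarrow> 0 < F (f k) (x0 t + l * v) (y0 t + l * w)"
      unfolding eventually_at by (auto simp: dist_real_def)
    define e where "e = min (min d1 d2) 1 / 2"
    have e: "0 < e" "e < d1" "e < d2" "e < 1" using d1 d2 by (auto simp: e_def)
    \<comment> \<open>the side of \<open>t\<close> on which the form of \<open>y\<close> is negative depends on \<open>eps\<close>\<close>
    define l where "l = eps * e"
    have l: "l \<noteq> 0" "\<bar>l\<bar> = e" "eps * l = e" using eps e by (auto simp: l_def)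
    have "0 \<le> F y (x0 t + l * v) (y0 t + l * w)"
      by (rule Fpos[OF d1(2)]) (use l e d2(2)[of l] in auto)
    moreover have "F y (x0 t + l * v) (y0 t + l * w) = - e * (1 - l) * Y0 y t"
      unfolding v_def w_def F_along_chord[OF Fy] using l by simp
    moreover have "0 < e * (1 - l) * Y0 y t"
      using e l Y0_pos[OF fy] by (intro mult_pos_pos) auto
    ultimately show False by simp
  qed
  have "improves c (f k) y" for k
  proof -
    note gb = contact_bounds[OF cut[of k]]
    have cy: "c < y" "y < c + 2 * pi" using gb yin[of k] by auto
    have "c + 2 * pi \<notin> A y" by (rule noA[of k]) (use gb in auto)
    then have gy: "cut_at c y" using cy A_periodic[of c 1 y] by (simp add: cut_at_def)
    have "t \<in> {first_contact c (f k)..last_contact c (f k)}" if "t \<in> contacts c y" for t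
    proof (cases "t = y")
      case False
      then have t: "t \<in> A y" "c \<le> t" "t \<le> c + 2 * pi" using that by (auto simp: contacts_def)
      have "t \<le> last_contact c (f k)" using noA[of k t] t gb by force
      moreover have "first_contact c (f k) \<le> t"
      proof (rule ccontr)
        assume "\<not> first_contact c (f k) \<le> t"
        then have "t + 2 * pi * of_int 1 \<notin> A y" using gb t by (intro noA[of k]) auto
        then show False using t unfolding A_periodic by simp
      qed
      ultimately show ?thesis by simp
    qed (use yin in auto)
    then have "first_contact c (f k) \<le> first_contact c y" "last_contact c y \<le> last_contact c (f k)"
      using first_last_contact_in[of c y] by auto
    then show ?thesis using cut gy Fpos unfolding improves_def by auto
  qed
  then show ?thesis by blast
qed

text \<open>If all points of the spanned arc are contacts, then \<open>s\<close> is clean. Otherwise a missing contact lies between \<open>s\<close>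
and one end of the arc, this end is itself a contact, and the step removes it.\<close>

lemma strict_improvement:
  assumes cut: "cut_at c s" and nc: "\<not> clean s"
  shows "\<exists>x. improves c s x \<and> last_contact c x - first_contact c x < last_contact c s - first_contact c s"
proof -
  note gb = contact_bounds[OF cut]
  define a b where "a = first_contact c s" and "b = last_contact c s"
  have "\<exists>m\<in>{a..b}. m \<noteq> s \<and> m \<notin> A s"
  proof (rule ccontr)
    assume "\<not> ?thesis"
    then have all: "m \<in> A s" if "m \<in> {a..b}" "m \<noteq> s" for m using that by blast
    have sA: "s \<in> A s"
    proof (cases "a = b")
      case True
      obtain t where "t \<in> A s" using A_nonempty by blast
      obtain n :: int where n: "c \<le> t + 2 * pi * of_int n" "t + 2 * pi * of_int n < c + 2 * pi"
        using window_rep by blast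
      then have "t + 2 * pi * of_int n \<in> A s" using \<open>t \<in> A s\<close> by (simp add: A_periodic)
      moreover from gb(7)[OF this] n True gb have "t + 2 * pi * of_int n = s" unfolding a_def b_def by auto
      ultimately show ?thesis by simp
    next
      case False
      have "s \<in> closure ({a..b} - {s})"
      proof -
        have "s islimpt {a..b}"
          using False gb islimpt_Icc[of a b s] unfolding a_def b_def by auto
        then show ?thesis by (simp add: islimpt_in_closure)
      qed
      also have "\<dots> \<subseteq> A s" by (rule closure_minimal[OF _ A_closed]) (use all in blast)
      finally show ?thesis .
    qed
    have "A s = {t. \<exists>n::int. a \<le> t + 2 * pi * of_int n \<and> t + 2 * pi * of_int n \<le> b}"
    proof (intro equalityI subsetI CollectI)
      fix t assume t: "t \<in> A s"
      obtain n :: int where n: "c \<le> t + 2 * pi * of_int n" "t + 2 * pi * of_int n < c + 2 * pi"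
        using window_rep by blast
      then have "t + 2 * pi * of_int n \<in> A s" using t by (simp add: A_periodic)
      from gb(7)[OF this] n show "\<exists>n::int. a \<le> t + 2 * pi * of_int n \<and> t + 2 * pi * of_int n \<le> b"
        unfolding a_def b_def by auto
    next
      fix t assume "t \<in> {t. \<exists>n::int. a \<le> t + 2 * pi * of_int n \<and> t + 2 * pi * of_int n \<le> b}"
      then obtain n :: int where "t + 2 * pi * of_int n \<in> {a..b}" by auto
      then have "t + 2 * pi * of_int n \<in> A s" using all sA by metis
      then show "t \<in> A s" by (simp add: A_periodic)
    qed
    then have "clean s" unfolding clean_def using gb(2,3) unfolding a_def b_def by blast
    then show False using nc by simp
  qed
  then obtain m where m: "a \<le> m" "m \<le> b" "m \<noteq> s" "m \<notin> A s" by auto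
  have win: "b < s + 2 * pi" "s - 2 * pi < a" "b < a + 2 * pi" "c < a" "b < c + 2 * pi" "c < s" "s < c + 2 * pi" "a \<le> s" "s \<le> b"
    using gb cut by (auto simp: a_def b_def cut_at_def)
  show ?thesis
  proof (cases "s < m")
    case True
    then have bA: "b \<in> A s" "m < b" using gb m by (auto simp: b_def less_le)
    obtain x k where x: "s < x" "x < b" "0 < k" "s \<in> A x"
      and nA: "\<And>t. b \<le> t \<Longrightarrow> t < s + 2 * pi \<Longrightarrow> t \<notin> A x"
      and FF: "\<And>t q1 q2. b \<le> t \<Longrightarrow> t < s + 2 * pi \<Longrightarrow> 0 < Y s q1 q2 \<Longrightarrow> X s q1 q2 / Y s q1 q2 = U s t \<Longrightarrow>
        F s q1 q2 < k * F x q1 q2"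
      using step_conic_right[of b s m] bA True m win by auto
    have "c + 2 * pi \<notin> A x" using nA[of "c + 2 * pi"] win by auto
    then have gx: "cut_at c x" using A_periodic[of c 1 x] x win by (simp add: cut_at_def)
    have "t \<in> {s..<b}" if t: "t \<in> contacts c x" for t
    proof (cases "t = x")
      case False
      then have t: "t \<in> A x" "c \<le> t" "t \<le> c + 2 * pi" using that by (auto simp: contacts_def)
      have "t < b" using nA[of t] t win by force
      moreover have "s \<le> t"
      proof (rule ccontr)
        assume "\<not> s \<le> t"
        then have "t + 2 * pi * of_int 1 \<notin> A x" using t win by (intro nA) auto
        then show False using t unfolding A_periodic by simp
      qed
      ultimately show ?thesis by simp
    qed (use x in auto)
    then have loc: "s \<le> first_contact c x" "last_contact c x < b" using first_last_contact_in[of c x] by auto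
    have "0 \<le> F x p q" if V: "(p, q) \<in> outer_sector a b" "0 \<le> F s p q" for p q
    proof -
      have "s \<in> {a..b}" using win by simp
      then obtain t where t: "0 < Y s p q" "b < t" "t < a + 2 * pi" "X s p q / Y s p q = U s t"
        using V(1) unfolding outer_sector_def by blast
      then have "F s p q < k * F x p q" using FF[of t p q] win by auto
      then have "0 < k * F x p q" using V(2) by simp
      then show ?thesis using x(3) by (simp add: zero_less_mult_iff)
    qed
    then have "improves c s x" using cut gx loc win unfolding improves_def a_def b_def by auto
    then show ?thesis using loc win unfolding a_def b_def by (intro exI[of _ x]) auto
  next
    case False
    then have aA: "a \<in> A s" "a < m" "m < s" using gb m by (auto simp: a_def less_le)
    obtain x k where x: "a < x" "x < s" "0 < k" "s \<in> A x"
      and nA: "\<And>t. s - 2 * pi < t \<Longrightarrow> t \<le> a \<Longrightarrow> t \<notin> A x"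
      and FF: "\<And>t q1 q2. s - 2 * pi < t \<Longrightarrow> t \<le> a \<Longrightarrow> 0 < Y s q1 q2 \<Longrightarrow> X s q1 q2 / Y s q1 q2 = U s t \<Longrightarrow>
        F s q1 q2 < k * F x q1 q2"
      using step_conic_left[of a s m] aA m win by auto
    have "c \<notin> A x" using nA[of c] win by auto
    then have gx: "cut_at c x" using x win by (simp add: cut_at_def)
    have "t \<in> {a<..s}" if t: "t \<in> contacts c x" for t
    proof (cases "t = x")
      case False
      then have t: "t \<in> A x" "c \<le> t" "t \<le> c + 2 * pi" using that by (auto simp: contacts_def)
      have "a < t" using nA[of t] t win by force
      moreover have "t \<le> s"
      proof (rule ccontr)
        assume "\<not> t \<le> s"
        then have "t + 2 * pi * of_int (- 1) \<notin> A x" using t win by (intro nA) auto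
        then show False using t unfolding A_periodic by simp
      qed
      ultimately show ?thesis by simp
    qed (use x in auto)
    then have loc: "a < first_contact c x" "last_contact c x \<le> s" using first_last_contact_in[of c x] by auto
    have "0 \<le> F x p q" if V: "(p, q) \<in> outer_sector a b" "0 \<le> F s p q" for p q
    proof -
      have "s \<in> {a..b}" using win by simp
      then obtain t where t: "0 < Y s p q" "b < t" "t < a + 2 * pi" "X s p q / Y s p q = U s t"
        using V(1) unfolding outer_sector_def by blast
      have "U s t = U s (t + 2 * pi * of_int (- 1))" by (simp only: U_periodic)
      then have "F s p q < k * F x p q" using FF[of "t + 2 * pi * of_int (- 1)" p q] t win by auto
      then have "0 < k * F x p q" using V(2) by simp
      then show ?thesis using x(3) by (simp add: zero_less_mult_iff)
    qed
    then have "improves c s x" using cut gx loc win unfolding improves_def a_def b_def by auto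
    then show ?thesis using loc win unfolding a_def b_def by (intro exI[of _ x]) auto
  qed
qed

lemma clean_in_window:
  assumes cut: "cut_at c s"
  obtains t where "clean t" "first_contact c s \<le> t" "t \<le> last_contact c s" "cut_at c t"
proof -
  \<comment> \<open>\<open>0\<close> is a default value that keeps \<open>l\<close> bounded below\<close>
  define l where "l x = (if cut_at c x then last_contact c x - first_contact c x else 0)" for x
  obtain y where y: "improves c s y" "\<And>x. improves c y x \<Longrightarrow> l y \<le> l x"
  proof (rule ordering_principle[of "cut_at c" "improves c" l 0 s])
    show "l y \<le> l x" if "improves c x y" for x y
      using that by (auto simp: l_def improves_def)
    show "0 \<le> l x" for x
      using contact_bounds(2,3)[of c x] by (auto simp: l_def)
    show "cut_at c y" if "improves c x y" for x y using that by (simp add: improves_def)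
  qed (use cut improves_refl improves_trans improving_sequence_bounded in blast)+
  have gy: "cut_at c y" using y(1) by (simp add: improves_def)
  have "clean y"
  proof (rule ccontr)
    assume "\<not> clean y"
    from strict_improvement[OF gy this] obtain x where
      x: "improves c y x" "last_contact c x - first_contact c x < last_contact c y - first_contact c y" by blast
    then show False using y(2)[OF x(1)] gy by (auto simp: l_def improves_def)
  qed
  moreover have "first_contact c s \<le> y" "y \<le> last_contact c s"
    using y(1) contact_bounds(2,3)[OF gy] by (auto simp: improves_def)
  ultimately show ?thesis using that gy by blast
qed

section \<open>Three clean points\<close>

lemma conic_in_frame:
  obtains f e c d b a where "\<And>p q. F s p q = f + e * X x p q + c * Y x p q + d * (X x p q)\<^sup>2
    + b * X x p q * Y x p q + a * (Y x p q)\<^sup>2"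
proof -
  define A0 B0 where "A0 = eps * ca s + M s" and "B0 = eps * cb s"
  have F: "F s p q = A0 * (Y s p q)\<^sup>2 + B0 * X s p q * Y s p q - eps * Y s p q + eps / 2 * (X s p q)\<^sup>2" for p q
    unfolding F_def osc_def A0_def B0_def by (simp add: algebra_simps)
  show ?thesis
  proof (rule that)
    fix p q
    show "F s p q = (A0 * (Y0 s x)\<^sup>2 + B0 * X0 s x * Y0 s x - eps * Y0 s x + eps / 2 * (X0 s x)\<^sup>2)
      + (2 * A0 * Y0 s x * Y1 s x + B0 * (X0 s x * Y1 s x + X1 s x * Y0 s x) - eps * Y1 s x + eps * X0 s x * X1 s x) * X x p q
      + (2 * A0 * Y0 s x * Y2 s x + B0 * (X0 s x * Y2 s x + X2 s x * Y0 s x) - eps * Y2 s x + eps * X0 s x * X2 s x) * Y x p q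
      + (A0 * (Y1 s x)\<^sup>2 + B0 * X1 s x * Y1 s x + eps / 2 * (X1 s x)\<^sup>2) * (X x p q)\<^sup>2
      + (2 * A0 * Y1 s x * Y2 s x + B0 * (X1 s x * Y2 s x + X2 s x * Y1 s x) + eps * X1 s x * X2 s x) * X x p q * Y x p q
      + (A0 * (Y2 s x)\<^sup>2 + B0 * X2 s x * Y2 s x + eps / 2 * (X2 s x)\<^sup>2) * (Y x p q)\<^sup>2"
      unfolding F change_frame[of s p q x] by (simp add: algebra_simps power2_eq_square)
  qed
qed

text \<open>If the extremal conic of \<open>s\<close> contains an arc of the curve, it is also the extremal conic of each
point \<open>x\<close> of this arc, so \<open>s\<close> and \<open>x\<close> have the same contacts. For the proof, the form is expanded in the
frame at \<open>x\<close>; vanishing on the arc, it has the 2-jet of a multiple of the osculating form.\<close>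

lemma contact_arc:
  assumes arc: "a < b" "{a..b} \<subseteq> A s" and x: "x \<in> {a..b}" and far: "far s x"
  shows "x \<in> A x" and "t \<in> A x \<longleftrightarrow> t \<in> A s \<or> \<not> far s t"
proof -
  obtain f e c a' b' d where R: "\<And>p q. F s p q = f + e * X x p q + c * Y x p q + d * (X x p q)\<^sup>2
    + b' * X x p q * Y x p q + a' * (Y x p q)\<^sup>2"
    by (rule conic_in_frame[of s x]) (rule that)
  have zero: "F s (x0 t) (y0 t) = 0" if "t \<in> {a..b}" for t
  proof -
    have "t \<in> A s" using that arc by blast
    then show ?thesis by (simp add: F_on_curve A_def)
  qed
  have f: "f = 0" using zero[OF x] unfolding R by simp
  \<comment> \<open>limits along the arc only, as \<open>x\<close> may be one of its ends\<close>
  define G where "G = at x within {a<..<b}"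
  have nt: "G \<noteq> bot"
    using x arc(1) limpt_of_closure[of x "{a<..<b}"] islimpt_Icc[OF arc(1), of x]
    unfolding G_def trivial_limit_within by simp
  have le: "G \<le> at x" unfolding G_def by (rule at_le) simp
  have evG: "eventually (\<lambda>t. t \<in> {a<..<b} \<and> t \<noteq> x) G"
    unfolding G_def by (auto simp: eventually_at_filter)
  have X1: "((\<lambda>t. X0 x t / (t - x)) \<longlongrightarrow> 1) G" and Y2: "((\<lambda>t. Y0 x t / (t - x)\<^sup>2) \<longlongrightarrow> 1 / 2) G"
    using tendsto_mono[OF le] X0_first_order Y0_second_order by blast+
  have id: "((\<lambda>t. t - x) \<longlongrightarrow> 0) G"
  proof -
    have "((\<lambda>t. t - x) \<longlongrightarrow> x - x) (at x)" by (intro tendsto_intros)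
    from tendsto_mono[OF le this] show ?thesis by simp
  qed
  have e: "e = 0"
  proof -
    have "((\<lambda>t. e * (X0 x t / (t - x)) + c * (Y0 x t / (t - x)\<^sup>2) * (t - x) + d * (X0 x t / (t - x))\<^sup>2 * (t - x)
        + b' * (X0 x t / (t - x)) * (Y0 x t / (t - x)\<^sup>2) * (t - x)\<^sup>2 + a' * (Y0 x t / (t - x)\<^sup>2)\<^sup>2 * (t - x) ^ 3)
      \<longlongrightarrow> e * 1 + c * (1 / 2) * 0 + d * 1\<^sup>2 * 0 + b' * 1 * (1 / 2) * 0\<^sup>2 + a' * (1 / 2)\<^sup>2 * 0 ^ 3) G"
      by (intro tendsto_intros X1 Y2 id)
    moreover have "eventually (\<lambda>t. e * (X0 x t / (t - x)) + c * (Y0 x t / (t - x)\<^sup>2) * (t - x) + d * (X0 x t / (t - x))\<^sup>2 * (t - x)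
        + b' * (X0 x t / (t - x)) * (Y0 x t / (t - x)\<^sup>2) * (t - x)\<^sup>2 + a' * (Y0 x t / (t - x)\<^sup>2)\<^sup>2 * (t - x) ^ 3 = 0) G"
      using evG
    proof eventually_elim
      case (elim t)
      define h u v where "h = t - x" and "u = X0 x t / h" and "v = Y0 x t / h\<^sup>2"
      have h: "h \<noteq> 0" using elim by (simp add: h_def)
      then have uv: "X0 x t = u * h" "Y0 x t = v * h\<^sup>2" by (simp_all add: u_def v_def)
      have "e * X0 x t + c * Y0 x t + d * (X0 x t)\<^sup>2 + b' * X0 x t * Y0 x t + a' * (Y0 x t)\<^sup>2 = 0"
        using zero[of t] elim unfolding R f by simp
      then have "h * (e * u + c * v * h + d * u\<^sup>2 * h + b' * u * v * h\<^sup>2 + a' * v\<^sup>2 * h ^ 3) = 0"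
        unfolding uv by (simp add: algebra_simps power2_eq_square power3_eq_cube)
      then show ?case using h unfolding u_def v_def unfolding h_def by simp
    qed
    ultimately have "((\<lambda>t. 0) \<longlongrightarrow> e * 1 + c * (1 / 2) * 0 + d * 1\<^sup>2 * 0 + b' * 1 * (1 / 2) * 0\<^sup>2 + a' * (1 / 2)\<^sup>2 * 0 ^ 3) G"
      by (rule Lim_transform_eventually)
    from tendsto_unique[OF nt this tendsto_const] show ?thesis by simp
  qed
  have d: "c / 2 + d = 0"
  proof -
    have "((\<lambda>t. c * (Y0 x t / (t - x)\<^sup>2) + d * (X0 x t / (t - x))\<^sup>2
        + b' * (X0 x t / (t - x)) * (Y0 x t / (t - x)\<^sup>2) * (t - x) + a' * (Y0 x t / (t - x)\<^sup>2)\<^sup>2 * (t - x)\<^sup>2)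
      \<longlongrightarrow> c * (1 / 2) + d * 1\<^sup>2 + b' * 1 * (1 / 2) * 0 + a' * (1 / 2)\<^sup>2 * 0\<^sup>2) G"
      by (intro tendsto_intros X1 Y2 id)
    moreover have "eventually (\<lambda>t. c * (Y0 x t / (t - x)\<^sup>2) + d * (X0 x t / (t - x))\<^sup>2
        + b' * (X0 x t / (t - x)) * (Y0 x t / (t - x)\<^sup>2) * (t - x) + a' * (Y0 x t / (t - x)\<^sup>2)\<^sup>2 * (t - x)\<^sup>2 = 0) G"
      using evG
    proof eventually_elim
      case (elim t)
      define h u v where "h = t - x" and "u = X0 x t / h" and "v = Y0 x t / h\<^sup>2"
      have h: "h \<noteq> 0" using elim by (simp add: h_def)
      then have uv: "X0 x t = u * h" "Y0 x t = v * h\<^sup>2" by (simp_all add: u_def v_def)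
      have "c * Y0 x t + d * (X0 x t)\<^sup>2 + b' * X0 x t * Y0 x t + a' * (Y0 x t)\<^sup>2 = 0"
        using zero[of t] elim unfolding R f e by simp
      then have "h\<^sup>2 * (c * v + d * u\<^sup>2 + b' * u * v * h + a' * v\<^sup>2 * h\<^sup>2) = 0"
        unfolding uv by (simp add: algebra_simps power2_eq_square)
      then show ?case using h unfolding u_def v_def unfolding h_def by simp
    qed
    ultimately have "((\<lambda>t. 0) \<longlongrightarrow> c * (1 / 2) + d * 1\<^sup>2 + b' * 1 * (1 / 2) * 0 + a' * (1 / 2)\<^sup>2 * 0\<^sup>2) G"
      by (rule Lim_transform_eventually)
    from tendsto_unique[OF nt this tendsto_const] show ?thesis by simp
  qed
  have fx: "far x s" using far far_sym by blast
  note pos = Y0_pos[OF far] Y0_pos[OF fx]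
  \<comment> \<open>the ratio of the normalisations at \<open>x\<close> and \<open>s\<close>, both read off on the chord that joins them\<close>
  define k where "k = Y0 s x / Y0 x s"
  have k: "0 < k" using pos by (simp add: k_def)
  have line: "l * (c * Y0 x s) + l\<^sup>2 * (d * (X0 x s)\<^sup>2 + b' * X0 x s * Y0 x s + a' * (Y0 x s)\<^sup>2)
      = - eps * l * (1 - l) * Y0 s x" for l
  proof -
    have XY: "X x (x0 x + l * (x0 s - x0 x)) (y0 x + l * (y0 s - y0 x)) = l * X0 x s"
      "Y x (x0 x + l * (x0 s - x0 x)) (y0 x + l * (y0 s - y0 x)) = l * Y0 x s"
      by (simp_all add: X_def Y_def cX_def cY_def algebra_simps add_divide_distrib diff_divide_distrib)
    show ?thesis
      unfolding F_along_chord[OF zero[OF x], of l, symmetric] R f e XY by (simp add: algebra_simps power2_eq_square)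
  qed
  have "c * Y0 x s = - eps * Y0 s x"
    using line[of 1] line[of "- 1"] by simp
  then have c: "c = - eps * k" using pos by (simp add: k_def field_simps)
  have d': "d = eps * k / 2" using d c by simp
  have form: "F s p q = eps * k * ((X x p q)\<^sup>2 / 2 - Y x p q) + a' * (Y x p q)\<^sup>2 + b' * X x p q * Y x p q" for p q
    unfolding R f e c d' by (simp add: algebra_simps)
  have zs: "F s (x0 s) (y0 s) = 0" by (simp add: F_on_curve)
  have Fk: "F s p q = k * F x p q" for p q
    by (rule recognise_F(2)[OF k form F_nonneg fx zs])
  have iff: "t \<in> A x \<longleftrightarrow> F s (x0 t) (y0 t) = 0" if "far x t" for t
    using F_zero_iff[OF that] k by (simp add: Fk)
  show xA: "x \<in> A x"
  proof (rule Lim_in_closed_set[OF A_closed _ nt])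
    have "eventually (far x) G"
    proof -
      have "eventually (\<lambda>t. t \<in> {x - pi<..<x + pi}) (at x)"
        by (rule eventually_at_in_open') auto
      then have "eventually (\<lambda>t. t \<in> {x - pi<..<x + pi}) G" using le filter_leD by blast
      then show ?thesis using evG
      proof eventually_elim
        case (elim t)
        then show ?case
          using far_window[of x t] far_window'[of x t] pi_gt_zero by (cases "x < t") auto
      qed
    qed
    then show "eventually (\<lambda>t. t \<in> A x) G"
      using evG by eventually_elim (use iff zero in auto)
    show "((\<lambda>t. t) \<longlongrightarrow> x) G" by (rule tendsto_mono[OF le tendsto_ident_at])
  qed
  have xs: "x \<in> A s" using x arc by auto
  show "t \<in> A x \<longleftrightarrow> t \<in> A s \<or> \<not> far s t"
  proof (cases "far x t")
    case True
    have "F s (x0 t) (y0 t) = 0 \<longleftrightarrow> t \<in> A s \<or> \<not> far s t"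
    proof (cases "far s t")
      case False
      then obtain n :: int where "t = s + 2 * pi * of_int n" by (rule not_farE)
      then show ?thesis using False zs by (simp add: curve_periodic)
    qed (simp add: F_zero_iff)
    then show ?thesis using iff[OF True] by simp
  next
    case False
    then show ?thesis using A_not_far[OF False] xA xs by simp
  qed
qed

lemma clean_arc:
  assumes "a \<le> s" "s \<le> b" and A: "A s = {t. \<exists>n::int. a \<le> t + 2 * pi * of_int n \<and> t + 2 * pi * of_int n \<le> b}"
    and "a < b" "x \<in> {a..b}"
  shows "clean x"
proof -
  have sub: "{a..b} \<subseteq> A s" unfolding A by (auto intro!: exI[of _ "0::int"])
  have "A x = A s"
  proof (cases "far s x")
    case True
    have "s \<in> A s" using sub assms by auto
    then show ?thesis
      using contact_arc(2)[OF \<open>a < b\<close> sub assms(5) True] A_not_far[of s _ s] by auto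
  next
    case False
    then obtain n :: int where "x = s + 2 * pi * of_int n" by (rule not_farE)
    then show ?thesis by (simp add: A_base_periodic)
  qed
  then show ?thesis unfolding clean_def A using assms(5) by (intro exI[of _ a] exI[of _ b]) auto
qed

text \<open>The circle can be cut at a point that is neither \<open>0\<close> nor a contact of \<open>0\<close>, unless the whole curve is a conic.\<close>

lemma exists_clean: "\<exists>s. clean s"
proof (cases "\<exists>c. c \<notin> A 0 \<and> far 0 c")
  case True
  then obtain c where c: "c \<notin> A 0" "far c 0" using far_sym by blast
  from far_reduce[OF c(2)] obtain n :: int where n: "c < 0 + 2 * pi * of_int n" "0 + 2 * pi * of_int n < c + 2 * pi" by blast
  have "A (2 * pi * of_int n) = A 0" using A_base_periodic[of 0 n] by simp
  then have "cut_at c (2 * pi * of_int n)" using n c by (simp add: cut_at_def)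
  from clean_in_window[OF this] show ?thesis by blast
next
  case False
  then have all: "t \<in> A 0" if "far 0 t" for t using that by blast
  have "0 \<in> closure {0<..<2 * pi}" by simp
  also have "\<dots> \<subseteq> A 0"
    by (rule closure_minimal[OF _ A_closed]) (auto intro!: all far_window)
  finally have "t \<in> A 0" for t using all[of t] A_not_far[of 0 t 0] by blast
  then have "A 0 = {t. \<exists>n::int. 0 \<le> t + 2 * pi * of_int n \<and> t + 2 * pi * of_int n \<le> 2 * pi}"
    using window_rep[of 0] by (auto simp: less_imp_le) (metis add_0 less_imp_le)
  then have "clean 0" unfolding clean_def by (intro exI[of _ 0] exI[of _ "2 * pi"]) auto
  then show ?thesis ..
qed

text \<open>Suppose that the contact set of a clean point \<open>p\<close> is just \<open>p\<close>, and let \<open>s\<close> be a point whose extremal conic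
touches the curve at \<open>p\<close>. Then neither arc between \<open>s\<close> and \<open>p\<close> consists of contacts of \<open>s\<close>, since these
would be contacts of \<open>p\<close> as well by \<open>contact_arc\<close>. So the step applies to \<open>s\<close> on both sides. The clean
points found differ from \<open>s\<close> because they do not have \<open>p\<close> as a contact.\<close>

lemma three_clean: "\<exists>t1 t2 t3. clean t1 \<and> clean t2 \<and> clean t3 \<and> t1 < t2 \<and> t2 < t3 \<and> t3 < t1 + 2 * pi"
proof -
  obtain p where p: "clean p" using exists_clean by blast
  then obtain a b where ab: "a \<le> p" "p \<le> b" and A: "A p = {t. \<exists>n::int. a \<le> t + 2 * pi * of_int n \<and> t + 2 * pi * of_int n \<le> b}"
    unfolding clean_def by blast
  show ?thesis
  proof (cases "a < b")
    case True
    define e where "e = min (b - a) pi / 3"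
    have e: "0 < e" "3 * e \<le> b - a" "3 * e \<le> pi" using True by (auto simp: e_def)
    have c: "clean x" if "x \<in> {a..b}" for x by (rule clean_arc[OF ab A True that])
    have "clean a" "clean (a + e)" "clean (a + 2 * e)" by (rule c, use e in simp)+
    moreover have "a < a + e" "a + e < a + 2 * e" "a + 2 * e < a + 2 * pi" using e pi_gt_zero by linarith+
    ultimately show ?thesis by blast
  next
    case False
    then have abp: "a = p" "b = p" using ab by auto
    have Ap: "t \<in> A p \<longleftrightarrow> \<not> far p t" for t
    proof
      assume "t \<in> A p"
      then obtain n :: int where "p \<le> t + 2 * pi * of_int n" "t + 2 * pi * of_int n \<le> p"
        unfolding A abp by blast
      then have "t = p + 2 * pi * of_int (- n)" by simp
      then show "\<not> far p t" unfolding far_def by blast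
    next
      assume "\<not> far p t"
      then obtain n :: int where n: "t = p + 2 * pi * of_int n" by (rule not_farE)
      have "t + 2 * pi * of_int (- n) = p" unfolding n by simp
      then have "p \<le> t + 2 * pi * of_int (- n) \<and> t + 2 * pi * of_int (- n) \<le> p" by simp
      then show "t \<in> A p" unfolding A abp by blast
    qed
    have noarc: "\<not> {l..r} \<subseteq> A s" if lr: "l < r" "far s x" "x \<in> {l..r}" "\<not> far p x" for s x l r
    proof
      assume sub: "{l..r} \<subseteq> A s"
      obtain n :: int where n: "x = p + 2 * pi * of_int n" using lr by (auto elim: not_farE)
      have Ax: "A x = A p" unfolding n by (rule A_base_periodic)
      have "t \<in> A p" if "t \<in> {l..r}" for t
        using contact_arc(2)[OF lr(1) sub lr(3,2), of t] that sub Ax by auto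
      then have nf: "\<not> far p t" if "t \<in> {l..r}" for t using that Ap by simp
      define e where "e = min ((r - l) / 2) pi"
      have e: "0 < e" "l + e \<in> {l..r}" "e < 2 * pi" using lr by (auto simp: e_def min_def field_simps)
      obtain i j :: int where "l = p + 2 * pi * of_int i" "l + e = p + 2 * pi * of_int j"
        using nf[of l] nf[of "l + e"] e lr by (auto elim!: not_farE)
      then have "\<not> far l (l + e)" by (auto simp: far_def algebra_simps intro!: exI[of _ "j - i"])
      then show False using far_window[of l "l + e"] e by auto
    qed
    have pA: "p \<in> A p" unfolding Ap by (auto simp: far_def intro!: exI[of _ "0::int"])
    then have M0: "M p = 0" by (simp add: A_def gap_def)
    define m where "m = p + pi"
    have fm: "far p m" unfolding m_def by (rule far_window) auto
    have hm: "gap p m < 0" using Ap[of m] fm M_is_max(1)[of p m] M0 by (auto simp: A_def)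
    have "((\<lambda>t. gap p t) \<longlongrightarrow> gap p p) (at_right p)" by (intro tendsto_intros)
    then have "eventually (\<lambda>t. gap p m < gap p t) (at_right p)"
      using hm by (intro order_tendstoD(1)) (auto simp: gap_def)
    moreover have "eventually (\<lambda>t. t \<in> {p<..<p + 2 * pi}) (at_right p)"
      by (rule eventually_at_right_real) simp
    ultimately have "eventually (\<lambda>t. gap p m < gap p t \<and> t \<in> {p<..<p + 2 * pi}) (at_right p)"
      by eventually_elim auto
    from eventually_happens'[OF trivial_limit_at_right_real this]
    obtain r where r: "gap p m < gap p r" "r \<in> {p<..<p + 2 * pi}" by blast
    obtain s where s: "p < s" "s < p + 2 * pi" "p \<in> A s"
      using exists_conic_touching[of m p r] r by (auto simp: m_def)
    have fs: "far s p" using s by (intro far_window') auto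
    have fs': "far s (p + 2 * pi)" using s by (intro far_window) auto
    have p2: "p + 2 * pi \<in> A s" using s A_periodic[of p 1 s] by simp
    have np: "\<not> far p p" "\<not> far p (p + 2 * pi)"
      unfolding far_def by (auto intro!: exI[of _ "0::int"] exI[of _ "1::int"])
    have "\<exists>m. s < m \<and> m < p + 2 * pi \<and> m \<notin> A s"
    proof (rule ccontr)
      assume "\<not> ?thesis"
      then have "{s<..<p + 2 * pi} \<subseteq> A s" by auto
      then have "closure {s<..<p + 2 * pi} \<subseteq> A s" by (rule closure_minimal[OF _ A_closed])
      then have "{s..p + 2 * pi} \<subseteq> A s" using s by simp
      then show False using noarc[of s "p + 2 * pi" s "p + 2 * pi"] s fs' np by auto
    qed
    then obtain m1 where m1: "s < m1" "m1 < p + 2 * pi" "m1 \<notin> A s" by blast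
    have "\<exists>m. p < m \<and> m < s \<and> m \<notin> A s"
    proof (rule ccontr)
      assume "\<not> ?thesis"
      then have "{p<..<s} \<subseteq> A s" by auto
      then have "closure {p<..<s} \<subseteq> A s" by (rule closure_minimal[OF _ A_closed])
      then have "{p..s} \<subseteq> A s" using s by simp
      then show False using noarc[of p s s p] s fs np by auto
    qed
    then obtain m2 where m2: "p < m2" "m2 < s" "m2 \<notin> A s" by blast
    obtain x where x: "s < x" "x < p + 2 * pi" and nA: "\<And>t. p + 2 * pi \<le> t \<Longrightarrow> t < s + 2 * pi \<Longrightarrow> t \<notin> A x"
    proof -
      have "s < p + 2 * pi" "p + 2 * pi < s + 2 * pi" using s by auto
      then show thesis by (rule step_conic_right[OF p2 _ _ m1]) (rule that, assumption+)
    qed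
    have gx: "cut_at p x" using nA[of "p + 2 * pi"] s x A_periodic[of p 1 x] by (auto simp: cut_at_def)
    have "s \<le> t" if "t \<in> contacts p x" for t
    proof (rule ccontr)
      assume "\<not> s \<le> t"
      then have "t \<in> A x" "p \<le> t" using that x by (auto simp: contacts_def)
      then show False using nA[of "t + 2 * pi * of_int 1"] \<open>\<not> s \<le> t\<close> A_periodic[of t 1 x] by auto
    qed
    then have lox: "s \<le> first_contact p x" using first_last_contact_in by blast
    obtain t where t: "clean t" "first_contact p x \<le> t" "cut_at p t"
      using clean_in_window[OF gx] by blast
    have ts: "t \<noteq> s" using t s by (auto simp: cut_at_def)
    obtain x' where x': "p < x'" "x' < s" and nA': "\<And>t. s - 2 * pi < t \<Longrightarrow> t \<le> p \<Longrightarrow> t \<notin> A x'"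
    proof -
      have "s - 2 * pi < p" "p < s" using s by auto
      then show thesis by (rule step_conic_left[OF s(3) _ _ m2]) (rule that, assumption+)
    qed
    have gx': "cut_at p x'" using nA'[of p] s x' by (auto simp: cut_at_def)
    have "t \<le> s" if "t \<in> contacts p x'" for t
    proof (rule ccontr)
      assume "\<not> t \<le> s"
      then have "t \<in> A x'" "t \<le> p + 2 * pi" using that x' by (auto simp: contacts_def)
      then show False using nA'[of "t + 2 * pi * of_int (- 1)"] \<open>\<not> t \<le> s\<close> A_periodic[of t "- 1" x'] by auto
    qed
    then have hix: "last_contact p x' \<le> s" using first_last_contact_in by blast
    obtain t' where t': "clean t'" "t' \<le> last_contact p x'" "cut_at p t'"
      using clean_in_window[OF gx'] by blast
    have ts': "t' \<noteq> s" using t' s by (auto simp: cut_at_def)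
    have "p < t'" "t' < t" "t < p + 2 * pi" using t t' ts ts' lox hix by (auto simp: cut_at_def)
    then show ?thesis using p t(1) t'(1) by blast
  qed
qed

lemma clean_shift: "clean s \<Longrightarrow> clean (s + 2 * pi * of_int n)"
proof -
  assume "clean s"
  then obtain a b where ab: "a \<le> s" "s \<le> b" and A: "A s = {t. \<exists>n::int. a \<le> t + 2 * pi * of_int n \<and> t + 2 * pi * of_int n \<le> b}"
    unfolding clean_def by blast
  have "(\<exists>i::int. a \<le> t + 2 * pi * of_int i \<and> t + 2 * pi * of_int i \<le> b) \<longleftrightarrow>
      (\<exists>i::int. a + 2 * pi * of_int n \<le> t + 2 * pi * of_int i \<and> t + 2 * pi * of_int i \<le> b + 2 * pi * of_int n)" for t
  proof
    assume "\<exists>i::int. a \<le> t + 2 * pi * of_int i \<and> t + 2 * pi * of_int i \<le> b"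
    then obtain i :: int where "a \<le> t + 2 * pi * of_int i \<and> t + 2 * pi * of_int i \<le> b" by blast
    then show "\<exists>i::int. a + 2 * pi * of_int n \<le> t + 2 * pi * of_int i \<and> t + 2 * pi * of_int i \<le> b + 2 * pi * of_int n"
      by (intro exI[of _ "i + n"]) (simp add: algebra_simps)
  next
    assume "\<exists>i::int. a + 2 * pi * of_int n \<le> t + 2 * pi * of_int i \<and> t + 2 * pi * of_int i \<le> b + 2 * pi * of_int n"
    then obtain i :: int where "a + 2 * pi * of_int n \<le> t + 2 * pi * of_int i \<and> t + 2 * pi * of_int i \<le> b + 2 * pi * of_int n" by blast
    then show "\<exists>i::int. a \<le> t + 2 * pi * of_int i \<and> t + 2 * pi * of_int i \<le> b"
      by (intro exI[of _ "i - n"]) (simp add: algebra_simps)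
  qed
  then show ?thesis
    unfolding clean_def A_base_periodic A using ab
    by (intro exI[of _ "a + 2 * pi * of_int n"] exI[of _ "b + 2 * pi * of_int n"]) auto
qed

lemma three_clean_in_period: "\<exists>T\<subseteq>{0..<2 * pi}. card T = 3 \<and> (\<forall>t\<in>T. clean t)"
proof -
  obtain t1 t2 t3 where t: "clean t1" "clean t2" "clean t3" "t1 < t2" "t2 < t3" "t3 < t1 + 2 * pi"
    using three_clean by blast
  have "\<exists>n::int. 0 \<le> t + 2 * pi * of_int n \<and> t + 2 * pi * of_int n < 2 * pi" for t
    using window_rep[of 0 t] by simp
  then obtain n where n: "\<And>t. 0 \<le> t + 2 * pi * of_int (n t :: int)" "\<And>t. t + 2 * pi * of_int (n t) < 2 * pi"
    by metis
  define r where "r t = t + 2 * pi * of_int (n t)" for t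
  have ne: "r t \<noteq> r t'" if "t < t'" "t' < t + 2 * pi" for t t'
  proof
    assume "r t = r t'"
    then have "t' = t + 2 * pi * of_int (n t - n t')" by (simp add: r_def algebra_simps)
    then show False using far_window[OF that] unfolding far_def by blast
  qed
  have "card {r t1, r t2, r t3} = 3" using ne[of t1 t2] ne[of t1 t3] ne[of t2 t3] t by auto
  moreover have "clean (r t)" if "clean t" for t unfolding r_def by (rule clean_shift[OF that])
  moreover have "r t \<in> {0..<2 * pi}" for t using n[of t] by (simp add: r_def)
  ultimately show ?thesis using t by (intro exI[of _ "{r t1, r t2, r t3}"]) auto
qed

end

section \<open>The projective plane\<close>

lemma proj_pt_eqD: "proj_pt u = proj_pt v \<Longrightarrow> \<exists>c. u = c *\<^sub>R v"
  unfolding proj_pt_def using span_base[of u "{u}"] by (auto simp: span_singleton)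

lemma proj_pt_scale: "c \<noteq> 0 \<Longrightarrow> proj_pt (c *\<^sub>R v) = proj_pt v"
proof -
  have "proj_pt (c *\<^sub>R v) \<subseteq> proj_pt v" for c v
    unfolding proj_pt_def by (auto simp: span_singleton)
  from this[of c v] this[of "inverse c" "c *\<^sub>R v"] show "c \<noteq> 0 \<Longrightarrow> proj_pt (c *\<^sub>R v) = proj_pt v"
    by auto
qed

text \<open>Two lines spanned by \<open>a\<close> and \<open>b\<close> are separated by comparing the angles that a line makes with them.\<close>

lemma Hausdorff_proj_plane: "Hausdorff_space proj_plane"
  unfolding Hausdorff_space_def
proof (intro allI impI, elim conjE)
  fix P Q assume P: "P \<in> topspace proj_plane" and Q: "Q \<in> topspace proj_plane" and ne: "P \<noteq> Q"
  obtain a b where a: "a \<noteq> 0" "P = proj_pt a" and b: "b \<noteq> 0" "Q = proj_pt b"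
    using P Q unfolding topspace_proj_plane by auto
  define g where "g a b v = (a \<bullet> v)\<^sup>2 * (b \<bullet> b) - (b \<bullet> v)\<^sup>2 * (a \<bullet> a)" for a b v :: "real^3"
  have hom: "g a b (c *\<^sub>R v) = c\<^sup>2 * g a b v" for a b c v
    by (simp add: g_def algebra_simps power2_eq_square)
  have op: "openin proj_plane (proj_pt ` {v. 0 < g a b v})" for a b
  proof -
    have nz: "v \<noteq> 0" if "0 < g a b v" for v using that by (auto simp: g_def)
    have "{v. v \<noteq> 0 \<and> proj_pt v \<in> proj_pt ` {v. 0 < g a b v}} = {v. 0 < g a b v}"
    proof (intro equalityI subsetI CollectI)
      fix v assume "v \<in> {v. v \<noteq> 0 \<and> proj_pt v \<in> proj_pt ` {v. 0 < g a b v}}"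
      then obtain w where w: "v \<noteq> 0" "0 < g a b w" "proj_pt v = proj_pt w" by auto
      obtain c where "v = c *\<^sub>R w" using proj_pt_eqD[OF w(3)] by blast
      then show "0 < g a b v" using w by (auto simp: hom)
    qed (use nz in auto)
    moreover have "open {v. 0 < g a b v}"
      unfolding g_def by (intro open_Collect_less continuous_intros)
    ultimately show ?thesis unfolding openin_proj_plane using nz by auto
  qed
  have strict: "(a \<bullet> b)\<^sup>2 < (a \<bullet> a) * (b \<bullet> b)"
  proof (rule ccontr)
    assume "\<not> ?thesis"
    then have "(a \<bullet> b)\<^sup>2 = (a \<bullet> a) * (b \<bullet> b)" using Cauchy_Schwarz_ineq[of a b] by simp
    then have "\<bar>a \<bullet> b\<bar> = norm a * norm b"
      by (metis norm_cauchy_schwarz_abs_eq power2_norm_eq_inner power_mult_distrib real_sqrt_abs abs_norm_cancel abs_mult)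
    then obtain c where "b = c *\<^sub>R a"
    proof -
      from \<open>\<bar>a \<bullet> b\<bar> = norm a * norm b\<close> have "norm a *\<^sub>R b = norm b *\<^sub>R a \<or> norm a *\<^sub>R b = - norm b *\<^sub>R a"
        unfolding norm_cauchy_schwarz_abs_eq .
      then obtain s where "norm a *\<^sub>R b = s *\<^sub>R a" by blast
      then have "b = (s / norm a) *\<^sub>R a"
        using a by (metis divide_inverse_commute norm_eq_zero real_vector_eq_affinity scaleR_scaleR vector_fraction_eq_iff)
      then show ?thesis using that by blast
    qed
    then show False using a b ne proj_pt_scale[of c a] by auto
  qed
  have "0 < g a b a" "0 < g b a b"
    using strict a b by (simp_all add: g_def power2_eq_square inner_commute algebra_simps)
  then have "P \<in> proj_pt ` {v. 0 < g a b v}" "Q \<in> proj_pt ` {v. 0 < g b a v}"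
    using a b by auto
  moreover have "disjnt (proj_pt ` {v. 0 < g a b v}) (proj_pt ` {v. 0 < g b a v})"
  proof -
    have False if vw: "0 < g a b v" "0 < g b a w" "proj_pt v = proj_pt w" for v w
    proof -
      obtain c where c: "v = c *\<^sub>R w" using proj_pt_eqD[OF vw(3)] by blast
      have "g a b w = - g b a w" by (simp add: g_def)
      then have "g a b v \<le> 0" using vw(2) unfolding c hom by (simp add: mult_nonneg_nonpos)
      then show False using vw(1) by simp
    qed
    then show ?thesis unfolding disjnt_def by force
  qed
  ultimately show "\<exists>U V. openin proj_plane U \<and> openin proj_plane V \<and> P \<in> U \<and> Q \<in> V \<and> disjnt U V"
    using op by blast
qed

lemma proj_pt_in_conic: "v \<noteq> 0 \<Longrightarrow> proj_pt v \<in> conic A \<longleftrightarrow> quad_form A v = 0"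
proof -
  have hom: "quad_form A (c *\<^sub>R w) = c\<^sup>2 * quad_form A w" for c w
    by (simp add: quad_form_def matrix_vector_mult_scaleR power2_eq_square)
  have "quad_form A v = 0" if "proj_pt v = proj_pt w" "quad_form A w = 0" for w
    using proj_pt_eqD[OF that(1)] that(2) hom by auto
  then show "v \<noteq> 0 \<Longrightarrow> proj_pt v \<in> conic A \<longleftrightarrow> quad_form A v = 0"
    unfolding conic_def by auto
qed

lemma homog_nth [simp]: "homog p $ 1 = p $ 1" "homog p $ 2 = p $ 2" "homog p $ 3 = 1"
  by (simp_all add: homog_def)

lemma homog_nonzero [simp]: "homog p \<noteq> 0"
  by (metis homog_nth(3) zero_index zero_neq_one)

text \<open>The symmetric matrix whose quadratic form is the product of the linear forms given by \<open>a\<close> and \<open>b\<close>.\<close>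

definition sym_outer :: "real^3 \<Rightarrow> real^3 \<Rightarrow> real^3^3" where
  "sym_outer a b = (\<chi> i j. (a $ i * b $ j + a $ j * b $ i) / 2)"

lemma sym_outer_form: "v \<bullet> (sym_outer a b *v w) = ((a \<bullet> v) * (b \<bullet> w) + (a \<bullet> w) * (b \<bullet> v)) / 2"
  by (simp add: sym_outer_def inner_vec_def matrix_vector_mult_def sum_3 algebra_simps add_divide_distrib)

lemma deriv_chain:
  fixes g0 g1 g2 g3 g4 :: "real \<Rightarrow> real"
  assumes "\<And>t. (g0 has_real_derivative g1 t) (at t)" "\<And>t. (g1 has_real_derivative g2 t) (at t)"
    "\<And>t. (g2 has_real_derivative g3 t) (at t)" "\<And>t. (g3 has_real_derivative g4 t) (at t)"
  shows "(\<forall>j<5. (deriv ^^ j) g0 t = 0) \<longleftrightarrow> g0 t = 0 \<and> g1 t = 0 \<and> g2 t = 0 \<and> g3 t = 0 \<and> g4 t = 0"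
proof -
  have d: "deriv g0 = g1" "deriv g1 = g2" "deriv g2 = g3" "deriv g3 = g4"
    using assms by (auto intro!: ext DERIV_imp_deriv)
  have "(\<forall>j<5. P j) \<longleftrightarrow> P 0 \<and> P 1 \<and> P 2 \<and> P 3 \<and> P 4" for P :: "nat \<Rightarrow> bool"
  proof
    assume P: "P 0 \<and> P 1 \<and> P 2 \<and> P 3 \<and> P 4"
    show "\<forall>j<5. P j"
    proof (intro allI impI)
      fix j :: nat assume "j < 5"
      then have "j = 0 \<or> j = 1 \<or> j = 2 \<or> j = 3 \<or> j = 4" by auto
      then show "P j" using P by auto
    qed
  qed auto
  then show ?thesis
    by (simp add: d eval_nat_numeral)
qed

section \<open>Identification of the osculating conic\<close>

locale oval_curve = oval +
  fixes g :: "real \<Rightarrow> real^2"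
  assumes g: "\<And>t. g t $ 1 = x0 t" "\<And>t. g t $ 2 = y0 t"
    and region: "convex (closed_region g)"
begin

text \<open>\<open>vxi s\<close> and \<open>veta s\<close> are the homogeneous versions of the affine functions \<open>X s\<close> and \<open>Y s\<close>. Together with the
third coordinate they form the basis dual to \<open>w1 s\<close>, \<open>w2 s\<close>, \<open>w0 s\<close>.\<close>

definition vxi :: "real \<Rightarrow> real^3" where "vxi s = vector [y2 s / k s, - x2 s / k s, (y0 s * x2 s - x0 s * y2 s) / k s]"
definition veta :: "real \<Rightarrow> real^3" where "veta s = vector [- y1 s / k s, x1 s / k s, (y1 s * x0 s - x1 s * y0 s) / k s]"
definition w0 :: "real \<Rightarrow> real^3" where "w0 s = vector [x0 s, y0 s, 1]"
definition w1 :: "real \<Rightarrow> real^3" where "w1 s = vector [x1 s, y1 s, 0]"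
definition w2 :: "real \<Rightarrow> real^3" where "w2 s = vector [x2 s, y2 s, 0]"

lemma dual_frame [simp]:
  "vxi s \<bullet> w0 s = 0" "vxi s \<bullet> w1 s = 1" "vxi s \<bullet> w2 s = 0"
  "veta s \<bullet> w0 s = 0" "veta s \<bullet> w1 s = 0" "veta s \<bullet> w2 s = 1"
  "w0 s $ 3 = 1" "w1 s $ 3 = 0" "w2 s $ 3 = 0"
proof -
  have k: "x1 s * y2 s - y1 s * x2 s = k s" by (simp add: k_def)
  have "y2 s * x1 s / k s - x2 s * y1 s / k s = 1" "x1 s * y2 s / k s - y1 s * x2 s / k s = 1"
    using k by (simp_all add: algebra_simps flip: diff_divide_distrib)
  then show "vxi s \<bullet> w0 s = 0" "vxi s \<bullet> w1 s = 1" "vxi s \<bullet> w2 s = 0"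
    "veta s \<bullet> w0 s = 0" "veta s \<bullet> w1 s = 0" "veta s \<bullet> w2 s = 1"
    "w0 s $ 3 = 1" "w1 s $ 3 = 0" "w2 s $ 3 = 0"
    by (simp_all add: vxi_def veta_def w0_def w1_def w2_def inner_vec_def sum_3 algebra_simps
      add_divide_distrib diff_divide_distrib)
qed

lemma frame_expansion: "v = (v $ 3) *\<^sub>R w0 s + (vxi s \<bullet> v) *\<^sub>R w1 s + (veta s \<bullet> v) *\<^sub>R w2 s"
proof -
  define p q where "p = v $ 1 - v $ 3 * x0 s" and "q = v $ 2 - v $ 3 * y0 s"
  have xi: "vxi s \<bullet> v = (p * y2 s - q * x2 s) / k s" "veta s \<bullet> v = (x1 s * q - y1 s * p) / k s"
    by (simp_all add: p_def q_def vxi_def veta_def inner_vec_def sum_3 algebra_simps add_divide_distrib diff_divide_distrib)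
  have "(p * y2 s - q * x2 s) * x1 s + (x1 s * q - y1 s * p) * x2 s = k s * p"
    "(p * y2 s - q * x2 s) * y1 s + (x1 s * q - y1 s * p) * y2 s = k s * q"
    by (simp_all add: k_def algebra_simps)
  then have "(vxi s \<bullet> v) * x1 s + (veta s \<bullet> v) * x2 s = p" "(vxi s \<bullet> v) * y1 s + (veta s \<bullet> v) * y2 s = q"
    unfolding xi by (simp_all flip: add_divide_distrib)
  then show ?thesis
    by (simp add: vec_eq_iff forall_3 w0_def w1_def w2_def p_def q_def)
qed

lemma homog_frame: "vxi s \<bullet> homog p = X s (p $ 1) (p $ 2)" "veta s \<bullet> homog p = Y s (p $ 1) (p $ 2)"
  by (simp_all add: vxi_def veta_def inner_vec_def sum_3 X_def Y_def cX_def cY_def algebra_simps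
    add_divide_distrib diff_divide_distrib)

definition osch :: "real \<Rightarrow> real^3 \<Rightarrow> real" where
  "osch s v = ca s * (veta s \<bullet> v)\<^sup>2 + cb s * (vxi s \<bullet> v) * (veta s \<bullet> v) - (veta s \<bullet> v) * v $ 3 + (vxi s \<bullet> v)\<^sup>2 / 2"

definition e3 :: "real^3" where "e3 = vector [0, 0, 1]"

definition oscM :: "real \<Rightarrow> real^3^3" where
  "oscM s = ca s *\<^sub>R sym_outer (veta s) (veta s) + cb s *\<^sub>R sym_outer (vxi s) (veta s)
    - sym_outer (veta s) e3 + (1 / 2) *\<^sub>R sym_outer (vxi s) (vxi s)"

lemma e3_inner: "e3 \<bullet> v = v $ 3"
  by (simp add: e3_def inner_vec_def sum_3)

lemma osch_homog: "osch s (homog p) = osc s (p $ 1) (p $ 2)"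
  by (simp add: osch_def osc_def homog_frame)

lemma oscM_bilinear: "v \<bullet> (oscM s *v w) = ca s * (veta s \<bullet> v) * (veta s \<bullet> w)
    + cb s / 2 * ((vxi s \<bullet> v) * (veta s \<bullet> w) + (vxi s \<bullet> w) * (veta s \<bullet> v))
    - ((veta s \<bullet> v) * w $ 3 + (veta s \<bullet> w) * v $ 3) / 2 + (vxi s \<bullet> v) * (vxi s \<bullet> w) / 2"
  unfolding oscM_def matrix_vector_mult_add_rdistrib matrix_vector_mult_diff_rdistrib
    scaleR_matrix_vector_assoc[symmetric] inner_add_right inner_diff_right inner_scaleR_right
    sym_outer_form e3_inner
  by (simp add: algebra_simps)

lemma quad_form_oscM: "quad_form (oscM s) v = osch s v"
  unfolding quad_form_def oscM_bilinear osch_def by (simp add: algebra_simps power2_eq_square)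

text \<open>A vector in the kernel is orthogonal for the bilinear form to \<open>w0 s\<close>, \<open>w1 s\<close> and \<open>w2 s\<close>, which kills its three
coordinates one after the other.\<close>

lemma oscM_nondegenerate: "nondegenerate_quadric (oscM s)"
  unfolding nondegenerate_quadric_def
proof
  show "transpose (oscM s) = oscM s"
    by (simp add: vec_eq_iff transpose_def oscM_def sym_outer_def algebra_simps)
  have "v = 0" if v: "oscM s *v v = 0" for v
  proof -
    have B: "w \<bullet> (oscM s *v v) = 0" for w using v by simp
    have eta: "veta s \<bullet> v = 0" using B[of "w0 s"] unfolding oscM_bilinear by simp
    have xi: "vxi s \<bullet> v = 0" using B[of "w1 s"] eta unfolding oscM_bilinear by simp
    have "v $ 3 = 0" using B[of "w2 s"] eta xi unfolding oscM_bilinear by simp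
    then show ?thesis using frame_expansion[of v s] eta xi by simp
  qed
  then show "invertible (oscM s)"
    by (simp add: invertible_left_inverse matrix_left_invertible_ker)
qed

text \<open>Contact of order five is a triangular system of linear equations, so it determines the form up to a factor.\<close>

lemma form_contact_iff:
  fixes s f e c d b a :: real
  defines "G \<equiv> \<lambda>t. f + e * X0 s t + c * Y0 s t + d * (X0 s t)\<^sup>2 + b * X0 s t * Y0 s t + a * (Y0 s t)\<^sup>2"
  shows "(\<forall>j<5. (deriv ^^ j) G s = 0) \<longleftrightarrow> f = 0 \<and> e = 0 \<and> d = - c / 2 \<and> b = - c * cb s \<and> a = - c * ca s"
proof -
  define G1 where "G1 t = e * X1 s t + c * Y1 s t + 2 * d * X0 s t * X1 s t + b * (X1 s t * Y0 s t + X0 s t * Y1 s t)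
    + 2 * a * Y0 s t * Y1 s t" for t
  define G2 where "G2 t = e * X2 s t + c * Y2 s t + 2 * d * (X0 s t * X2 s t + (X1 s t)\<^sup>2)
    + b * (X2 s t * Y0 s t + 2 * X1 s t * Y1 s t + X0 s t * Y2 s t)
    + 2 * a * (Y0 s t * Y2 s t + (Y1 s t)\<^sup>2)" for t
  define G3 where "G3 t = e * X3 s t + c * Y3 s t + 2 * d * (X0 s t * X3 s t + 3 * X1 s t * X2 s t)
    + b * (X3 s t * Y0 s t + 3 * X2 s t * Y1 s t + 3 * X1 s t * Y2 s t + X0 s t * Y3 s t)
    + 2 * a * (Y0 s t * Y3 s t + 3 * Y1 s t * Y2 s t)" for t
  define G4 where "G4 t = e * X4 s t + c * Y4 s t + 2 * d * (X0 s t * X4 s t + 4 * X1 s t * X3 s t + 3 * (X2 s t)\<^sup>2)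
    + b * (X4 s t * Y0 s t + 4 * X3 s t * Y1 s t + 6 * X2 s t * Y2 s t + 4 * X1 s t * Y3 s t + X0 s t * Y4 s t)
    + 2 * a * (Y0 s t * Y4 s t + 4 * Y1 s t * Y3 s t + 3 * (Y2 s t)\<^sup>2)" for t
  have "(G has_real_derivative G1 t) (at t)" "(G1 has_real_derivative G2 t) (at t)"
    "(G2 has_real_derivative G3 t) (at t)" "(G3 has_real_derivative G4 t) (at t)" for t
    unfolding G_def G1_def[abs_def] G2_def[abs_def] G3_def[abs_def] G4_def
    by (rule derivative_eq_intros refl | simp add: algebra_simps power2_eq_square)+
  from deriv_chain[OF this] have "(\<forall>j<5. (deriv ^^ j) G s = 0) \<longleftrightarrow>
    G s = 0 \<and> G1 s = 0 \<and> G2 s = 0 \<and> G3 s = 0 \<and> G4 s = 0" .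
  also have "\<dots> \<longleftrightarrow> f = 0 \<and> e = 0 \<and> d = - c / 2 \<and> b = - c * cb s \<and> a = - c * ca s"
  proof -
    have "G s = f" "G1 s = e" "G2 s = c + 2 * d" "G3 s = e * X3 s s + c * Y3 s s + 3 * b"
      "G4 s = e * X4 s s + c * Y4 s s + 8 * d * X3 s s + 4 * b * Y3 s s + 6 * a"
      by (simp_all add: G_def G1_def G2_def G3_def G4_def algebra_simps)
    moreover have "c * y4 + 8 * d * x3 + 4 * b * y3 + 6 * a = 0 \<longleftrightarrow> a = - c * (y4 / 6 - 2 * y3\<^sup>2 / 9 - 2 * x3 / 3)"
      if "d = - c / 2" "b = - c * (y3 / 3)" for y3 y4 x3
    proof -
      have "c * y4 + 8 * d * x3 + 4 * b * y3 + 6 * a = 6 * (a + c * (y4 / 6 - 2 * y3\<^sup>2 / 9 - 2 * x3 / 3))"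
        unfolding that by (simp add: algebra_simps power2_eq_square)
      then have "c * y4 + 8 * d * x3 + 4 * b * y3 + 6 * a = 0 \<longleftrightarrow> a + c * (y4 / 6 - 2 * y3\<^sup>2 / 9 - 2 * x3 / 3) = 0"
        by (simp only: mult_eq_0_iff) simp
      then show ?thesis by (simp only: eq_neg_iff_add_eq_0 mult_minus_left)
    qed
    moreover have "c + 2 * d = 0 \<longleftrightarrow> d = - c / 2" "c * y3 + 3 * b = 0 \<longleftrightarrow> b = - c * (y3 / 3)" for y3
      by (auto simp: field_simps)
    ultimately show ?thesis
      unfolding ca_def cb_def by auto
  qed
  finally show ?thesis .
qed

lemma meets_oscM: "meets_with_multiplicity (oscM s) g s 5"
proof -
  have eq: "affine_quadric (oscM s) \<circ> g = (\<lambda>t. 0 + 0 * X0 s t + (- 1) * Y0 s t + (1 / 2) * (X0 s t)\<^sup>2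
      + cb s * X0 s t * Y0 s t + ca s * (Y0 s t)\<^sup>2)"
    by (auto simp: affine_quadric_def quad_form_oscM osch_homog osc_def g)
  show ?thesis unfolding meets_with_multiplicity_def eq form_contact_iff by simp
qed

lemma osculating_form_unique:
  assumes nd: "nondegenerate_quadric A" and m: "meets_with_multiplicity A g s 5"
  shows "\<exists>c. c \<noteq> 0 \<and> (\<forall>v. quad_form A v = c * osch s v)"
proof -
  define B where "B v w = v \<bullet> (A *v w)" for v w :: "real^3"
  have sym: "B v w = B w v" for v w
  proof -
    have "B v w = (transpose A *v v) \<bullet> w" by (simp add: B_def dot_lmul_matrix[symmetric] transpose_matrix_vector)
    also have "\<dots> = B w v" using nd by (simp add: nondegenerate_quadric_def B_def inner_commute)
    finally show ?thesis .
  qed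
  have lin: "B (v + v') w = B v w + B v' w" "B (r *\<^sub>R v) w = r * B v w"
    "B w (v + v') = B w v + B w v'" "B w (r *\<^sub>R v) = r * B w v" for v v' w r
    by (simp_all add: B_def inner_add_left inner_add_right matrix_vector_right_distrib matrix_vector_mult_scaleR)
  have q: "quad_form A v = B (w0 s) (w0 s) * (v $ 3)\<^sup>2 + 2 * B (w0 s) (w1 s) * (vxi s \<bullet> v) * v $ 3
      + 2 * B (w0 s) (w2 s) * (veta s \<bullet> v) * v $ 3 + B (w1 s) (w1 s) * (vxi s \<bullet> v)\<^sup>2
      + 2 * B (w1 s) (w2 s) * (vxi s \<bullet> v) * (veta s \<bullet> v) + B (w2 s) (w2 s) * (veta s \<bullet> v)\<^sup>2" for v
  proof -
    have "quad_form A v = B v v" by (simp add: quad_form_def B_def)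
    also have "\<dots> = B ((v $ 3) *\<^sub>R w0 s + (vxi s \<bullet> v) *\<^sub>R w1 s + (veta s \<bullet> v) *\<^sub>R w2 s)
        ((v $ 3) *\<^sub>R w0 s + (vxi s \<bullet> v) *\<^sub>R w1 s + (veta s \<bullet> v) *\<^sub>R w2 s)"
      using frame_expansion[of v s] by simp
    also have "\<dots> = B (w0 s) (w0 s) * (v $ 3)\<^sup>2 + 2 * B (w0 s) (w1 s) * (vxi s \<bullet> v) * v $ 3
      + 2 * B (w0 s) (w2 s) * (veta s \<bullet> v) * v $ 3 + B (w1 s) (w1 s) * (vxi s \<bullet> v)\<^sup>2
      + 2 * B (w1 s) (w2 s) * (vxi s \<bullet> v) * (veta s \<bullet> v) + B (w2 s) (w2 s) * (veta s \<bullet> v)\<^sup>2"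
      unfolding lin sym[of "w1 s" "w0 s"] sym[of "w2 s" "w0 s"] sym[of "w2 s" "w1 s"]
      by (simp add: algebra_simps power2_eq_square)
    finally show ?thesis .
  qed
  define c where "c = - 2 * B (w0 s) (w2 s)"
  have eq: "affine_quadric A \<circ> g = (\<lambda>t. B (w0 s) (w0 s) + (2 * B (w0 s) (w1 s)) * X0 s t + (- c) * Y0 s t
      + B (w1 s) (w1 s) * (X0 s t)\<^sup>2 + (2 * B (w1 s) (w2 s)) * X0 s t * Y0 s t + B (w2 s) (w2 s) * (Y0 s t)\<^sup>2)"
    by (rule ext) (simp add: affine_quadric_def q homog_frame g c_def)
  from m have co: "B (w0 s) (w0 s) = 0" "2 * B (w0 s) (w1 s) = 0" "B (w1 s) (w1 s) = c / 2"
    "2 * B (w1 s) (w2 s) = c * cb s" "B (w2 s) (w2 s) = c * ca s"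
    unfolding meets_with_multiplicity_def eq form_contact_iff by simp_all
  have "quad_form A v = c * osch s v" for v
    unfolding q osch_def co using co(2,4) by (simp add: c_def algebra_simps)
  moreover have "c \<noteq> 0"
  proof
    assume c0: "c = 0"
    then have z: "B (w0 s) (w0 s) = 0" "B (w0 s) (w1 s) = 0" "B (w1 s) (w1 s) = 0"
      "B (w1 s) (w2 s) = 0" "B (w2 s) (w2 s) = 0" "B (w0 s) (w2 s) = 0"
      using co by (simp_all add: c_def)
    have "B v (w0 s) = 0" for v
      by (subst frame_expansion[of v s]) (simp add: lin z sym[of "w1 s" "w0 s"] sym[of "w2 s" "w0 s"])
    then have "A *v w0 s = 0" by (metis B_def inner_eq_zero_iff)
    moreover have "w0 s \<noteq> 0" by (metis dual_frame(7) zero_index zero_neq_one)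
    ultimately show False
      using nd by (auto simp: nondegenerate_quadric_def invertible_left_inverse matrix_left_invertible_ker)
  qed
  ultimately show ?thesis by blast
qed

lemma osculating_conic_eq: "osculating_conic g s = conic (oscM s)"
  unfolding osculating_conic_def
proof (rule the_equality)
  show "\<exists>A. nondegenerate_quadric A \<and> meets_with_multiplicity A g s 5 \<and> conic (oscM s) = conic A"
    using oscM_nondegenerate meets_oscM by blast
next
  fix C assume "\<exists>A. nondegenerate_quadric A \<and> meets_with_multiplicity A g s 5 \<and> C = conic A"
  then obtain A where A: "nondegenerate_quadric A" "meets_with_multiplicity A g s 5" "C = conic A" by blast
  obtain c where c: "c \<noteq> 0" "\<And>v. quad_form A v = c * osch s v"
    using osculating_form_unique[OF A(1,2)] by blast
  show "C = conic (oscM s)" unfolding A(3) conic_def quad_form_oscM c(2) using c(1) by simp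
qed

lemma curve_on_osculating_conic: "affine_pt (g r) \<in> osculating_conic g s \<longleftrightarrow> osc s (x0 r) (y0 r) = 0"
  unfolding osculating_conic_eq affine_pt_def
  by (simp add: proj_pt_in_conic quad_form_oscM osch_homog g)

lemma U_surj: "\<exists>t. far s t \<and> U s t = u"
proof -
  have "eventually (\<lambda>t. u < U s t) (at_right s)" using U_at_right by (simp add: filterlim_at_top_dense)
  moreover have "eventually (\<lambda>t. t \<in> {s<..<s + pi}) (at_right s)" by (rule eventually_at_right_real) simp
  ultimately have "eventually (\<lambda>t. u < U s t \<and> t \<in> {s<..<s + pi}) (at_right s)" by eventually_elim auto
  from eventually_happens'[OF trivial_limit_at_right_real this] obtain t1 where t1: "u < U s t1" "s < t1" "t1 < s + pi" by auto
  have "eventually (\<lambda>t. U s t < u) (at_left (s + 2 * pi))" using U_at_left_next by (simp add: filterlim_at_bot_dense)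
  moreover have "eventually (\<lambda>t. t \<in> {s + pi<..<s + 2 * pi}) (at_left (s + 2 * pi))" by (rule eventually_at_left_real) simp
  ultimately have "eventually (\<lambda>t. U s t < u \<and> t \<in> {s + pi<..<s + 2 * pi}) (at_left (s + 2 * pi))" by eventually_elim auto
  from eventually_happens'[OF trivial_limit_at_left_real this] obtain t2 where t2: "U s t2 < u" "s + pi < t2" "t2 < s + 2 * pi" by auto
  have far: "far s t" if "t \<in> {t1..t2}" for t using that t1 t2 by (intro far_window) auto
  have "continuous_on {t1..t2} (U s)"
    by (intro continuous_at_imp_continuous_on ballI DERIV_isCont[OF U_deriv] far)
  from IVT2'[OF _ _ _ this, of u] obtain t where "t1 \<le> t" "t \<le> t2" "U s t = u" using t1 t2 by auto
  then show ?thesis using far[of t] by auto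
qed

text \<open>In the picture at \<open>s\<close> each point of the conic other than \<open>g s\<close> lies vertically above a point \<open>t\<close> of the curve, that is, on the
line through \<open>g s\<close> and \<open>g t\<close> and between these points. In particular it is not at infinity.\<close>

lemma inscribed_if:
  assumes H: "\<And>t. H s t \<le> 0"
  shows "inscribed (osculating_conic g s) g"
  unfolding inscribed_def osculating_conic_eq
proof
  fix P assume "P \<in> conic (oscM s)"
  then obtain v where v: "v \<noteq> 0" "P = proj_pt v" "osch s v = 0"
    unfolding conic_def quad_form_oscM by blast
  define a b c where "a = vxi s \<bullet> v" and "b = veta s \<bullet> v" and "c = v $ 3"
  have osch: "ca s * b\<^sup>2 + cb s * a * b - b * c + a\<^sup>2 / 2 = 0"
    using v(3) by (simp add: osch_def a_def b_def c_def)
  have vexp: "v = c *\<^sub>R w0 s + a *\<^sub>R w1 s + b *\<^sub>R w2 s" unfolding a_def b_def c_def by (rule frame_expansion)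
  have on: "g t \<in> closed_region g" for t by (simp add: closed_region_def)
  show "P \<in> affine_pt ` closed_region g"
  proof (cases "b = 0")
    case True
    then have "a = 0" using osch by simp
    then have v': "v = c *\<^sub>R w0 s" using True vexp by simp
    have "w0 s = homog (g s)" by (simp add: w0_def homog_def g)
    then have "P = affine_pt (g s)" using v v' proj_pt_scale[of c "w0 s"] by (auto simp: affine_pt_def)
    then show ?thesis using on by blast
  next
    case False
    obtain t where t: "far s t" "U s t = a / b" using U_surj by blast
    define w where "w = c / b"
    have w: "w = ca s + cb s * (a / b) + (a / b)\<^sup>2 / 2"
      using osch False by (simp add: w_def field_simps power2_eq_square)
    note pos = Y0_pos[OF t(1)]
    have w1: "1 / Y0 s t \<le> w" using H[of t] H_eq[OF t(1)] unfolding w t(2) by linarith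
    then have wpos: "0 < w" using pos by (meson less_le_trans zero_less_divide_1_iff)
    then have c0: "c \<noteq> 0" by (auto simp: w_def)
    define l where "l = 1 / (w * Y0 s t)"
    have l: "0 \<le> l" "l \<le> 1" using wpos pos w1 by (simp_all add: l_def field_simps)
    define p where "p = (1 - l) *\<^sub>R g s + l *\<^sub>R g t"
    have pD: "p \<in> closed_region g"
      unfolding p_def by (rule convexD_alt[OF region on on l])
    have lY: "l * Y0 s t = b / c" using wpos pos by (simp add: l_def w_def field_simps)
    have lX: "l * X0 s t = a / c"
    proof -
      have "X0 s t = a / b * Y0 s t" using t(2) pos by (simp add: U_def field_simps)
      then have "l * X0 s t = a / b * (l * Y0 s t)" by simp
      then show ?thesis unfolding lY using False by simp
    qed
    have px: "p $ 1 = x0 s + (a / c) * x1 s + (b / c) * x2 s" "p $ 2 = y0 s + (a / c) * y1 s + (b / c) * y2 s"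
    proof -
      have "p $ 1 = x0 s + l * (x0 t - x0 s)" "p $ 2 = y0 s + l * (y0 t - y0 s)"
        by (simp_all add: p_def g algebra_simps)
      moreover have "x0 t - x0 s = X0 s t * x1 s + Y0 s t * x2 s" "y0 t - y0 s = X0 s t * y1 s + Y0 s t * y2 s"
        using point_in_frame(1)[of "x0 t" s "y0 t"] point_in_frame(2)[of "y0 t" s "x0 t"] by linarith+
      ultimately show "p $ 1 = x0 s + (a / c) * x1 s + (b / c) * x2 s" "p $ 2 = y0 s + (a / c) * y1 s + (b / c) * y2 s"
        unfolding lX[symmetric] lY[symmetric] by (simp_all add: algebra_simps)
    qed
    have "v = c *\<^sub>R homog p"
      using c0 by (subst vexp) (simp add: vec_eq_iff forall_3 w0_def w1_def w2_def px field_simps)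
    then have "P = affine_pt p" using v(2) proj_pt_scale[OF c0] by (simp add: affine_pt_def)
    then show ?thesis using pD by blast
  qed
qed

text \<open>The linear map \<open>T\<close> brings the osculating form to the shape \<open>x\<^sup>2 + y\<^sup>2 - 1\<close>, so the unit disc is mapped onto
the part of the projective plane where the form is nonpositive. This disc may meet the line at infinity.\<close>

lemma circumscribed_if:
  assumes H: "\<And>t. 0 \<le> H s t"
  shows "circumscribed (osculating_conic g s) g"
proof -
  \<comment> \<open>completing squares: the form is \<open>(X + cb s * Y)\<^sup>2 / 2 - Y * (Z - m * Y)\<close>\<close>
  define m where "m = ca s - (cb s)\<^sup>2 / 2"
  define T where "T z = (1 + z $ 2 + m * (1 - z $ 2)) *\<^sub>R w0 s + (sqrt 2 * z $ 1 - cb s * (1 - z $ 2)) *\<^sub>R w1 s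
    + (1 - z $ 2) *\<^sub>R w2 s" for z :: "real^2"
  have Tc: "vxi s \<bullet> T z = sqrt 2 * z $ 1 - cb s * (1 - z $ 2)" "veta s \<bullet> T z = 1 - z $ 2"
    "T z $ 3 = 1 + z $ 2 + m * (1 - z $ 2)" for z
    by (simp_all add: T_def inner_add_right)
  have oT: "osch s (T z) = (norm z)\<^sup>2 - 1" for z
  proof -
    have "(norm z)\<^sup>2 = (z $ 1)\<^sup>2 + (z $ 2)\<^sup>2"
      by (simp add: norm_vec_def L2_set_def sum_2 real_sqrt_pow2)
    moreover have s2: "sqrt 2 * sqrt 2 = (2::real)" by simp
    have "osch s (T z) = (z $ 1)\<^sup>2 + (z $ 2)\<^sup>2 - 1"
    proof -
      have "m' = a - b\<^sup>2 / 2 \<Longrightarrow> r * r = 2 \<Longrightarrow> a * (1 - y)\<^sup>2 + b * (r * x - b * (1 - y)) * (1 - y)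
          - (1 - y) * (1 + y + m' * (1 - y)) + (r * x - b * (1 - y))\<^sup>2 / 2 = x\<^sup>2 + y\<^sup>2 - 1" for a b m' r x y :: real
      proof -
        assume m': "m' = a - b\<^sup>2 / 2" and r: "r * r = 2"
        have "(r * x - b * (1 - y))\<^sup>2 = (r * r) * x\<^sup>2 - 2 * r * x * b * (1 - y) + b\<^sup>2 * (1 - y)\<^sup>2"
          by (simp add: power2_eq_square algebra_simps)
        then show ?thesis unfolding m' r by (simp add: power2_eq_square algebra_simps add_divide_distrib diff_divide_distrib)
      qed
      from this[OF m_def s2] show ?thesis unfolding osch_def Tc by simp
    qed
    ultimately show ?thesis by simp
  qed
  have Tnz: "T z \<noteq> 0" for z
  proof
    assume "T z = 0"
    then have "1 - z $ 2 = 0" "1 + z $ 2 + m * (1 - z $ 2) = 0" using Tc(2,3)[of z] by simp_all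
    then show False by simp
  qed
  \<comment> \<open>the half-sum of the two factors in \<open>Y * (Z - m * Y)\<close> is \<open>1\<close> at \<open>T z\<close>, which gives the scalar \<open>r\<close>\<close>
  have surj: "\<exists>z. (norm z)\<^sup>2 - 1 = osch s v / r\<^sup>2 \<and> r \<noteq> 0 \<and> v = r *\<^sub>R T z"
    if v: "v \<noteq> 0" "osch s v \<le> 0" and r: "r = (veta s \<bullet> v + v $ 3 - m * (veta s \<bullet> v)) / 2" for v r
  proof -
    define a b c where "a = vxi s \<bullet> v" and "b = veta s \<bullet> v" and "c = v $ 3 - m * b"
    have o: "osch s v = (a + cb s * b)\<^sup>2 / 2 - b * c"
      unfolding osch_def c_def m_def a_def b_def by (simp add: algebra_simps power2_eq_square add_divide_distrib)
    have rr: "2 * r = b + c" by (simp add: r b_def c_def)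
    have r0: "r \<noteq> 0"
    proof
      assume "r = 0"
      then have c: "c = - b" using rr by simp
      have "(a + cb s * b)\<^sup>2 / 2 + b\<^sup>2 \<le> 0" using v(2) unfolding o c by (simp add: power2_eq_square)
      moreover have "0 \<le> b\<^sup>2" "0 \<le> (a + cb s * b)\<^sup>2" by simp_all
      ultimately have "b\<^sup>2 \<le> 0" "(a + cb s * b)\<^sup>2 \<le> 0" by linarith+
      then have "b = 0" "a = 0" by auto
      then have "v $ 3 = 0" using c by (simp add: c_def)
      then show False using v(1) frame_expansion[of v s] \<open>a = 0\<close> \<open>b = 0\<close> by (simp add: a_def b_def)
    qed
    define z :: "real^2" where "z = vector [(a + cb s * b) / (r * sqrt 2), 1 - b / r]"
    have z1: "r * (1 - z $ 2) = b" "r * (1 + z $ 2) = c" "r * (sqrt 2 * z $ 1 - cb s * (1 - z $ 2)) = a"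
    proof -
      show b: "r * (1 - z $ 2) = b" using r0 by (simp add: z_def)
      show "r * (1 + z $ 2) = c" using r0 rr by (simp add: z_def algebra_simps)
      have "r * (sqrt 2 * z $ 1) = a + cb s * b" using r0 by (simp add: z_def)
      moreover have "r * (sqrt 2 * z $ 1 - cb s * (1 - z $ 2)) = r * (sqrt 2 * z $ 1) - cb s * (r * (1 - z $ 2))"
        by (simp add: algebra_simps)
      ultimately show "r * (sqrt 2 * z $ 1 - cb s * (1 - z $ 2)) = a" unfolding b by simp
    qed
    have vT: "v = r *\<^sub>R T z"
    proof -
      have "r * (1 + z $ 2 + m * (1 - z $ 2)) = v $ 3"
      proof -
        have "r * (1 + z $ 2 + m * (1 - z $ 2)) = r * (1 + z $ 2) + m * (r * (1 - z $ 2))"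
          by (simp add: algebra_simps)
        then show ?thesis unfolding z1 by (simp add: c_def)
      qed
      then show ?thesis using frame_expansion[of v s] z1
        unfolding T_def scaleR_add_right scaleR_scaleR a_def b_def by simp
    qed
    have "osch s v = r\<^sup>2 * osch s (T z)"
      unfolding osch_def by (subst (1 2 3 4 5 6) vT) (simp add: algebra_simps power2_eq_square)
    then have "(norm z)\<^sup>2 - 1 = osch s v / r\<^sup>2" using r0 by (simp add: oT)
    then show ?thesis using r0 vT by blast
  qed
  define f where "f z = proj_pt (T z)" for z
  have emb: "embedding_map (top_of_set (cball (0 :: real^2) 1)) proj_plane f"
  proof (rule injective_closed_imp_embedding_map)
    have "continuous_on (cball 0 1) T"
      unfolding T_def by (intro continuous_intros)
    then have "continuous_map (top_of_set (cball 0 1)) (top_of_set (- {0})) T"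
      using Tnz by (auto simp: continuous_map_in_subtopology)
    from continuous_map_compose[OF this quotient_imp_continuous_map[OF quotient_map_proj_pt]]
    show cont: "continuous_map (top_of_set (cball 0 1)) proj_plane f"
      by (simp add: f_def[abs_def] o_def)
    show "closed_map (top_of_set (cball (0 :: real^2) 1)) proj_plane f"
    proof (rule continuous_imp_closed_map_gen[OF _ _ cont])
      show "compact_space (top_of_set (cball (0 :: real^2) 1))"
        by (simp add: compact_space_subtopology)
      show "kc_space proj_plane" by (rule Hausdorff_imp_kc_space[OF Hausdorff_proj_plane])
    qed
    have "z = z'" if eq: "f z = f z'" for z z'
    proof -
      obtain c where c: "T z = c *\<^sub>R T z'" using eq proj_pt_eqD unfolding f_def by blast
      have 1: "1 - z $ 2 = c * (1 - z' $ 2)" using Tc(2)[of z] unfolding c by (simp add: Tc)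
      have "1 + z $ 2 + m * (1 - z $ 2) = c * (1 + z' $ 2 + m * (1 - z' $ 2))"
        using Tc(3)[of z] unfolding c by (simp add: Tc)
      then have "1 + z $ 2 = c * (1 + z' $ 2)" unfolding 1 by (simp add: algebra_simps)
      with 1 have "c = 1" by (simp add: algebra_simps)
      then have z2: "z $ 2 = z' $ 2" using 1 by simp
      have "sqrt 2 * z $ 1 - cb s * (1 - z $ 2) = sqrt 2 * z' $ 1 - cb s * (1 - z' $ 2)"
        using Tc(1)[of z] unfolding c \<open>c = 1\<close> by (simp add: Tc)
      then have "z $ 1 = z' $ 1" unfolding z2 by simp
      then show ?thesis using z2 by (simp add: vec_eq_iff forall_2)
    qed
    then show "inj_on f (topspace (top_of_set (cball 0 1)))" by (auto simp: inj_on_def)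
  qed
  have sph: "f ` sphere 0 1 = conic (oscM s)"
  proof (intro equalityI subsetI)
    fix P assume "P \<in> f ` sphere 0 1"
    then obtain z where "norm z = 1" "P = proj_pt (T z)" by (auto simp: f_def)
    then show "P \<in> conic (oscM s)" using Tnz by (simp add: proj_pt_in_conic quad_form_oscM oT)
  next
    fix P assume "P \<in> conic (oscM s)"
    then obtain v where v: "v \<noteq> 0" "P = proj_pt v" "osch s v = 0"
      unfolding conic_def quad_form_oscM by blast
    have "osch s v \<le> 0" using v(3) by simp
    then obtain z r where zr: "(norm z)\<^sup>2 - 1 = osch s v / r\<^sup>2" "r \<noteq> 0" "v = r *\<^sub>R T z"
      using surj[OF v(1) _ refl] by blast
    have "(norm z)\<^sup>2 - 1 = 0" using zr(1) v(3) by simp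
    then have "norm z = 1" using norm_ge_zero[of z] by (auto simp: power2_eq_1_iff)
    moreover have "P = f z" using v(2) zr(2,3) by (simp add: f_def proj_pt_scale)
    ultimately show "P \<in> f ` sphere 0 1" by auto
  qed
  have "affine_pt (g t) \<in> f ` cball 0 1" for t
  proof -
    have "osch s (homog (g t)) \<le> 0"
    proof (cases "far s t")
      case True
      then show ?thesis using H[of t] Y0_pos[OF True] unfolding osch_homog g H_def by (auto simp: divide_le_0_iff)
    next
      case False
      then obtain n :: int where "t = s + 2 * pi * of_int n" by (rule not_farE)
      then show ?thesis unfolding osch_homog g by (simp add: curve_periodic osc_contact)
    qed
    note le = this
    obtain z r where z: "(norm z)\<^sup>2 - 1 = osch s (homog (g t)) / r\<^sup>2" "r \<noteq> 0" "homog (g t) = r *\<^sub>R T z"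
      using surj[OF homog_nonzero le refl] by blast
    have "osch s (homog (g t)) / r\<^sup>2 \<le> 0" using le by (simp add: divide_nonpos_nonneg)
    then have "(norm z)\<^sup>2 \<le> 1\<^sup>2" using z(1) by simp
    then have "norm z \<le> 1" by (rule power2_le_imp_le) simp
    moreover have "affine_pt (g t) = f z" using z by (simp add: affine_pt_def f_def proj_pt_scale)
    ultimately show ?thesis by auto
  qed
  then show ?thesis
    unfolding circumscribed_def closed_disc_bounded_by_def osculating_conic_eq
    using emb sph by (intro exI[of _ "f ` cball 0 1"]) (auto intro!: exI[of _ f])
qed

end

locale signed_oval_curve = oval_curve + signed_oval
begin

lemma clean_sextactic:
  assumes "clean s"
  shows "gap s t \<le> 0" and "connected_on_circle {r. affine_pt (g r) \<in> osculating_conic g s}"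
proof -
  obtain a b where ab: "a \<le> s" "s \<le> b" and A: "A s = {t. \<exists>n::int. a \<le> t + 2 * pi * of_int n \<and> t + 2 * pi * of_int n \<le> b}"
    using assms unfolding clean_def by blast
  have sA: "s \<in> A s" unfolding A using ab by (auto intro!: exI[of _ "0::int"])
  then have M0: "M s = 0" by (simp add: A_def gap_def)
  then show "gap s t \<le> 0" using M_is_max(1)[of s t] by simp
  have "affine_pt (g r) \<in> osculating_conic g s \<longleftrightarrow> r \<in> A s" for r
  proof (cases "far s r")
    case True
    have "F s (x0 r) (y0 r) = eps * osc s (x0 r) (y0 r)" by (simp add: F_def M0)
    then have "osc s (x0 r) (y0 r) = 0 \<longleftrightarrow> r \<in> A s" using F_zero_iff[OF True] eps by auto
    then show ?thesis by (simp add: curve_on_osculating_conic)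
  next
    case False
    then have "r \<in> A s" using A_not_far sA by blast
    moreover have "osc s (x0 r) (y0 r) = 0"
      using False by (elim not_farE) (simp add: curve_periodic osc_contact)
    ultimately show ?thesis by (simp add: curve_on_osculating_conic)
  qed
  then have eq: "{r. affine_pt (g r) \<in> osculating_conic g s} = A s" by auto
  have "cis ` A s = cis ` {a..b}"
  proof (intro equalityI subsetI)
    fix z assume "z \<in> cis ` A s"
    then obtain t n where t: "z = cis t" "a \<le> t + 2 * pi * of_int (n::int)" "t + 2 * pi * of_int n \<le> b"
      unfolding A by auto
    have "cis t = cis (t + 2 * pi * of_int n)" by (simp add: cis_mult[symmetric] cis_multiple_2pi)
    then show "z \<in> cis ` {a..b}" using t by auto
  next
    fix z assume "z \<in> cis ` {a..b}"
    then show "z \<in> cis ` A s" unfolding A by (auto intro!: image_eqI exI[of _ "0::int"])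
  qed
  moreover have "connected (cis ` {a..b})"
    by (intro connected_continuous_image connected_Icc continuous_on_cis continuous_on_id)
  ultimately show "connected_on_circle {r. affine_pt (g r) \<in> osculating_conic g s}"
    by (simp add: connected_on_circle_def eq)
qed

lemma clean_imp_clean_maximal_sextactic:
  assumes e: "eps = 1" and c: "clean s"
  shows "clean_maximal_sextactic g s"
proof -
  have "H s t \<le> 0" for t
    using clean_sextactic(1)[OF c, of t, unfolded gap_def] unfolding e by simp
  then show ?thesis
    unfolding clean_maximal_sextactic_def using inscribed_if clean_sextactic(2)[OF c] by blast
qed

lemma clean_imp_clean_minimal_sextactic:
  assumes e: "eps = - 1" and c: "clean s"
  shows "clean_minimal_sextactic g s"
proof -
  have "0 \<le> H s t" for t
    using clean_sextactic(1)[OF c, of t, unfolded gap_def] unfolding e by simp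
  then show ?thesis
    unfolding clean_minimal_sextactic_def using circumscribed_if clean_sextactic(2)[OF c] by blast
qed

end

section \<open>A convex curve lies on one side of its tangents\<close>

text \<open>By the Jordan curve theorem every point of the curve is a limit of outer points. The linear isomorphism \<open>L\<close>
carries outer points in the complex plane back to outer points in \<open>\<real>\<^sup>2\<close>.\<close>

lemma curve_not_interior:
  fixes g :: "real \<Rightarrow> real^2"
  assumes cont: "continuous_on UNIV g" and closed_curve: "simple_closed_curve g"
  shows "g t \<notin> interior (closed_region g)"
proof
  assume int: "g t \<in> interior (closed_region g)"
  have per: "g (t + 2 * pi * of_int n) = g t" for t and n :: int
    using closed_curve by (intro periodic_int) (simp add: simple_closed_curve_def)
  have inj: "inj_on g {0..<2 * pi}" using closed_curve by (simp add: simple_closed_curve_def)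
  define L :: "real^2 \<Rightarrow> complex" where "L v = Complex (v $ 1) (v $ 2)" for v
  define J :: "complex \<Rightarrow> real^2" where "J z = vector [Re z, Im z]" for z
  have LJ: "L (J z) = z" "J (L v) = v" for z v
    by (simp_all add: L_def J_def complex_eq_iff vec_eq_iff forall_2)
  have linL: "linear L" by (rule linearI) (simp_all add: L_def complex_eq_iff)
  have linJ: "linear J" by (rule linearI) (simp_all add: J_def vec_eq_iff forall_2)
  have contL: "continuous_on S L" and contJ: "continuous_on S' J" for S S'
    using linL linJ by (auto intro: linear_continuous_on linear_conv_bounded_linear[THEN iffD1])
  define c where "c u = L (g (2 * pi * u))" for u
  have img: "path_image c = L ` range g"
  proof (intro equalityI subsetI)
    fix z assume "z \<in> L ` range g"
    then obtain r where r: "z = L (g r)" by blast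
    obtain n :: int where n: "0 \<le> r + 2 * pi * of_int n" "r + 2 * pi * of_int n < 0 + 2 * pi"
      using window_rep by blast
    define u where "u = (r + 2 * pi * of_int n) / (2 * pi)"
    have "z = c u" unfolding c_def u_def using per[of r n] by (simp add: r)
    moreover have "u \<in> {0..1}" using n by (simp add: u_def)
    ultimately show "z \<in> path_image c" by (auto simp: path_image_def)
  qed (auto simp: path_image_def c_def)
  have "path c"
    unfolding path_def c_def
    by (intro continuous_on_compose2[OF contL] continuous_on_compose2[OF cont] continuous_intros) auto
  moreover have "loop_free c"
    unfolding loop_free_def
  proof (intro ballI impI)
    fix u v :: real assume uv: "u \<in> {0..1}" "v \<in> {0..1}" and "c u = c v"
    then have eq: "g (2 * pi * u) = g (2 * pi * v)" by (metis LJ(2) c_def)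
    have g0: "g (2 * pi) = g 0" using per[of 0 1] by simp
    have in1: "w = 0" if "w \<in> {0..<1}" "g (2 * pi * w) = g 0" for w
      using inj_onD[OF inj that(2)] that(1) by auto
    show "u = v \<or> u = 0 \<and> v = 1 \<or> u = 1 \<and> v = 0"
    proof (cases "u = 1 \<or> v = 1")
      case True
      then consider "u = 1" "v = 1" | "u = 1" "v < 1" | "v = 1" "u < 1"
        using uv by fastforce
      then show ?thesis
      proof cases
        case 2
        then show ?thesis using in1[of v] eq uv g0 by simp
      next
        case 3
        then show ?thesis using in1[of u] eq uv g0 by simp
      qed simp
    next
      case False
      then have "2 * pi * u = 2 * pi * v" using uv by (intro inj_onD[OF inj eq]) (auto simp: less_le)
      then show ?thesis by simp
    qed
  qed
  ultimately have "simple_path c" by (simp add: simple_path_def)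
  moreover have "pathfinish c = pathstart c"
    using per[of 0 1] by (simp add: pathfinish_def pathstart_def c_def)
  ultimately have fr: "frontier (outside (path_image c)) = path_image c"
    using Jordan_inside_outside by blast
  have out: "J z \<notin> closed_region g" if z: "z \<in> outside (path_image c)" for z
  proof
    assume D: "J z \<in> closed_region g"
    have zn: "z \<notin> path_image c" and unb: "\<not> bounded (connected_component_set (- path_image c) z)"
      using z by (auto simp: outside_def)
    have "J z \<notin> range g"
    proof
      assume "J z \<in> range g"
      then have "L (J z) \<in> L ` range g" by (rule imageI)
      then show False using zn by (simp add: LJ img)
    qed
    then have "J z \<in> inside (range g)" using D by (simp add: closed_region_def)
    then have bd: "bounded (connected_component_set (- range g) (J z))" by (simp add: inside_def)
    define C where "C = connected_component_set (- path_image c) z"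
    have "connected C" unfolding C_def by (rule connected_connected_component)
    have "z \<in> C" unfolding C_def using zn by (simp add: connected_component_refl_eq)
    have "C \<subseteq> - path_image c" unfolding C_def by (rule connected_component_subset)
    have "connected (J ` C)" using contJ \<open>connected C\<close> by (rule connected_continuous_image)
    moreover have "J ` C \<subseteq> - range g"
    proof
      fix v assume "v \<in> J ` C"
      then obtain w where w: "w \<in> C" "v = J w" by blast
      then have "L v \<notin> L ` range g" using \<open>C \<subseteq> - path_image c\<close> by (auto simp: img LJ)
      then show "v \<in> - range g" by blast
    qed
    ultimately have "J ` C \<subseteq> connected_component_set (- range g) (J z)"
      using \<open>z \<in> C\<close> by (intro connected_component_maximal) auto
    then have "bounded (J ` C)" using bd bounded_subset by blast
    then have "bounded (L ` J ` C)"
      by (rule bounded_linear_image) (use linL in \<open>simp add: linear_conv_bounded_linear\<close>)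
    then have "bounded C" by (simp add: image_image LJ)
    then show False using unb by (simp add: C_def)
  qed
  define V where "V = J -` interior (closed_region g)"
  have "open V" unfolding V_def using contJ[of UNIV] by (intro open_vimage) auto
  moreover have "L (g t) \<in> V" using int by (simp add: V_def LJ)
  moreover have "L (g t) \<in> closure (outside (path_image c))"
    using fr img frontier_def[of "outside (path_image c)"] by blast
  ultimately have "V \<inter> outside (path_image c) \<noteq> {}"
    using open_Int_closure_eq_empty[of V "outside (path_image c)"] by blast
  then show False using out interior_subset unfolding V_def by blast
qed

lemma supporting_line:
  fixes D :: "'a::euclidean_space set"
  assumes "convex D" "x \<in> D" "x \<notin> interior D"
  obtains a where "a \<noteq> 0" "\<And>y. y \<in> D \<Longrightarrow> a \<bullet> x \<le> a \<bullet> y"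
proof (cases "interior D = {}")
  case True
  obtain a b where ab: "a \<noteq> 0" "D \<subseteq> {x. a \<bullet> x = b}"
    by (rule empty_interior_subset_hyperplane[OF assms(1) True])
  have eq: "a \<bullet> y = b" if "y \<in> D" for y using ab(2) that by blast
  show ?thesis
    by (rule that[OF ab(1)]) (simp add: eq assms(2))
next
  case False
  then have "x \<notin> rel_interior D" using assms(3) rel_interior_nonempty_interior[of D] by simp
  from assms(1,2) this show ?thesis
    by (rule supporting_hyperplane_rel_boundary) (rule that)
qed

text \<open>A supporting line at \<open>g s\<close> is the tangent, and the sign of the curvature tells on which side the curve lies.
If another point \<open>g r\<close> were on the tangent, the segment from \<open>g s\<close> to \<open>g r\<close> would consist of boundary points,
hence of points of the curve; but near \<open>s\<close> the curve leaves its tangent at once.\<close>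

lemma curve_above_tangent:
  fixes g :: "real \<Rightarrow> real^2" and x1 x2 y1 y2 :: "real \<Rightarrow> real"
  assumes closed_curve: "simple_closed_curve g" and conv: "convex (closed_region g)"
    and d: "\<And>t. ((\<lambda>t. g t $ 1) has_real_derivative x1 t) (at t)" "\<And>t. (x1 has_real_derivative x2 t) (at t)"
      "\<And>t. ((\<lambda>t. g t $ 2) has_real_derivative y1 t) (at t)" "\<And>t. (y1 has_real_derivative y2 t) (at t)"
    and c2: "isCont x2 s" "isCont y2 s"
    and k: "x1 s * y2 s - y1 s * x2 s \<noteq> 0"
    and far: "\<forall>n::int. r \<noteq> s + 2 * pi * of_int n"
  shows "0 < (x1 s * (g r $ 2 - g s $ 2) - y1 s * (g r $ 1 - g s $ 1)) / (x1 s * y2 s - y1 s * x2 s)"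
proof -
  define k where "k = x1 s * y2 s - y1 s * x2 s"
  define D where "D = closed_region g"
  define l where "l p = (x1 s * (p $ 2 - g s $ 2) - y1 s * (p $ 1 - g s $ 1)) / k" for p :: "real^2"
  have k0: "k \<noteq> 0" using k by (simp add: k_def)
  have cont: "continuous_on UNIV g"
  proof -
    have "isCont (\<lambda>t. g t $ i) t" for i t
      using exhaust_2[of i] DERIV_isCont[OF d(1)] DERIV_isCont[OF d(3)] by auto
    then have "isCont (\<lambda>t. \<chi> i. g t $ i) t" for t
      unfolding isCont_def by (intro tendsto_vec_lambda) auto
    then show ?thesis by (simp add: continuous_on_eq_continuous_at)
  qed
  have on: "g t \<in> D" for t by (simp add: D_def closed_region_def)
  obtain a where a: "a \<noteq> 0" "\<And>y. y \<in> D \<Longrightarrow> a \<bullet> g s \<le> a \<bullet> y"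
    using supporting_line[OF conv[folded D_def] on[of s]] curve_not_interior[OF cont closed_curve] unfolding D_def by metis
  define f where "f t = a $ 1 * (g t $ 1 - g s $ 1) + a $ 2 * (g t $ 2 - g s $ 2)" for t
  define f1 where "f1 t = a $ 1 * x1 t + a $ 2 * y1 t" for t
  define f2 where "f2 t = a $ 1 * x2 t + a $ 2 * y2 t" for t
  have inn: "a \<bullet> v = a $ 1 * v $ 1 + a $ 2 * v $ 2" for v
    by (simp add: inner_vec_def sum_2)
  have f0: "0 \<le> f t" for t using a(2)[OF on[of t]] by (simp add: inn f_def algebra_simps)
  have df: "(f has_real_derivative f1 t) (at t)" "(f1 has_real_derivative f2 t) (at t)" for t
    unfolding f_def f1_def[abs_def] f2_def by (auto intro!: derivative_eq_intros d)
  have f1s: "f1 s = 0"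
    by (rule DERIV_local_min[OF df(1)[of s] zero_less_one]) (use f0 in \<open>auto simp: f_def\<close>)
  have lim: "((\<lambda>t. f t / (t - s)\<^sup>2) \<longlongrightarrow> f2 s / 2) (at s)"
    by (rule second_order_limit[OF df _ f1s]) (use c2 in \<open>auto simp: f_def f2_def[abs_def] intro!: continuous_intros\<close>)
  have f2s: "0 \<le> f2 s"
    using tendsto_lowerbound[OF lim, of 0] f0 by simp
  have rel: "k * (a \<bullet> (p - g s)) = f2 s * (k * l p)" if "True" for p
  proof -
    have "k * (a $ 1 * u + a $ 2 * v) = f2 s * (x1 s * v - y1 s * u) + f1 s * (y2 s * u - x2 s * v)" for u v
      by (simp add: k_def f1_def f2_def algebra_simps)
    from this[of "p $ 1 - g s $ 1" "p $ 2 - g s $ 2"] show ?thesis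
      using k0 by (simp add: f1s inn l_def)
  qed
  have al: "a \<bullet> (p - g s) = f2 s * l p" for p using rel k0 by simp
  have f2p: "0 < f2 s"
  proof (rule ccontr)
    assume "\<not> 0 < f2 s"
    then have "a \<bullet> (p - g s) = 0" for p using f2s al by simp
    from this[of "a + g s"] show False using a(1) by simp
  qed
  have lD: "0 \<le> l p" if "p \<in> D" for p
  proof -
    have "0 \<le> f2 s * l p" using a(2)[OF that] by (simp flip: al add: inner_diff_right)
    then show ?thesis using f2p by (simp add: zero_le_mult_iff)
  qed
  have "l (g r) \<noteq> 0"
  proof
    assume lr: "l (g r) = 0"
    have per: "g (t + 2 * pi * of_int n) = g t" for t and n :: int
      using closed_curve by (intro periodic_int) (simp add: simple_closed_curve_def)
    have congr: "\<exists>n::int. t' = t + 2 * pi * of_int n" if eq: "g t = g t'" for t t'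
    proof -
      obtain n m :: int where nm: "0 \<le> t + 2 * pi * of_int n" "t + 2 * pi * of_int n < 0 + 2 * pi"
        "0 \<le> t' + 2 * pi * of_int m" "t' + 2 * pi * of_int m < 0 + 2 * pi"
        using window_rep by metis
      have inj: "inj_on g {0..<2 * pi}" using closed_curve by (simp add: simple_closed_curve_def)
      have "t + 2 * pi * of_int n = t' + 2 * pi * of_int m"
        by (rule inj_onD[OF inj]) (use nm eq in \<open>auto simp: per\<close>)
      then show ?thesis by (intro exI[of _ "n - m"]) (simp add: algebra_simps)
    qed
    have ne: "g r \<noteq> g s" using congr[of s r] far by auto
    have clS: "closed (range g)"
    proof -
      have "range g = g ` {0..2 * pi}"
      proof (intro equalityI subsetI)
        fix v assume "v \<in> range g"
        then obtain t where t: "v = g t" by blast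
        obtain n :: int where "0 \<le> t + 2 * pi * of_int n" "t + 2 * pi * of_int n < 0 + 2 * pi"
          using window_rep by blast
        then show "v \<in> g ` {0..2 * pi}" using per[of t n] t by (intro image_eqI[of _ _ "t + 2 * pi * of_int n"]) auto
      qed auto
      then show ?thesis
        using compact_continuous_image[of "{0..2 * pi}" g] cont by (auto intro!: compact_imp_closed continuous_on_subset)
    qed
    have inside_int: "inside (range g) \<subseteq> interior D"
      using open_inside[OF clS] by (intro interior_maximal) (auto simp: D_def closed_region_def)
    have not_int: "p \<notin> interior D" if "l p = 0" for p
    proof
      assume "p \<in> interior D"
      then obtain e where e: "0 < e" "ball p e \<subseteq> D" by (meson mem_interior)
      \<comment> \<open>moving against the normal \<open>a\<close> leaves the half-plane\<close>
      define q where "q = p - (e / (2 * norm a)) *\<^sub>R a"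
      have "dist p q < e" using e a(1) by (simp add: q_def dist_norm)
      then have "0 \<le> l q" using e lD by auto
      moreover have "f2 s * l q = a \<bullet> (p - g s) - e / (2 * norm a) * (a \<bullet> a)"
        unfolding al[symmetric] q_def by (simp add: inner_diff_right)
      then have "f2 s * l q < 0" using that e a(1) unfolding al by (simp add: divide_pos_pos)
      ultimately show False using f2p by (simp add: mult_less_0_iff)
    qed
    have "\<exists>t. s - pi \<le> t \<and> t < s + pi \<and> g t = g s + (1 / real (Suc n)) *\<^sub>R (g r - g s)" for n
    proof -
      define p where "p = g s + (1 / real (Suc n)) *\<^sub>R (g r - g s)"
      have "p = (1 - 1 / real (Suc n)) *\<^sub>R g s + (1 / real (Suc n)) *\<^sub>R g r"
        by (simp add: p_def algebra_simps)
      then have pD: "p \<in> D" using convexD_alt[OF conv[folded D_def] on on, of "1 / real (Suc n)" s r] by simp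
      have "f2 s * l p = 1 / real (Suc n) * (f2 s * l (g r))"
        unfolding al[symmetric] p_def by simp
      then have "l p = 0" using lr f2p by simp
      then have "p \<in> range g" using not_int pD inside_int by (auto simp: D_def closed_region_def)
      then obtain t where t: "p = g t" by blast
      obtain m :: int where "s - pi \<le> t + 2 * pi * of_int m" "t + 2 * pi * of_int m < s - pi + 2 * pi"
        using window_rep by blast
      then show ?thesis using per[of t m] t p_def by (intro exI[of _ "t + 2 * pi * of_int m"]) auto
    qed
    then obtain t where t: "\<And>n. s - pi \<le> t n" "\<And>n. t n < s + pi"
      "\<And>n. g (t n) = g s + (1 / real (Suc n)) *\<^sub>R (g r - g s)" by metis
    have "seq_compact {s - pi..s + pi}" by (simp add: compact_imp_seq_compact)
    moreover have "\<forall>n. t n \<in> {s - pi..s + pi}" using t by (auto intro: less_imp_le)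
    ultimately obtain y h where y: "y \<in> {s - pi..s + pi}" and h: "strict_mono h" "(t \<circ> h) \<longlonglongrightarrow> y"
      unfolding seq_compact_def by blast
    have th: "(\<lambda>n. t (h n)) \<longlonglongrightarrow> y" using h(2) by (simp add: o_def)
    have "(\<lambda>n. g (t (h n))) \<longlonglongrightarrow> g y"
      using cont th by (intro isCont_tendsto_compose[of y g]) (auto simp: continuous_on_eq_continuous_at)
    moreover have "(\<lambda>n. g s + (1 / real (Suc n)) *\<^sub>R (g r - g s)) \<longlonglongrightarrow> g s + 0 *\<^sub>R (g r - g s)"
      by (intro tendsto_intros LIMSEQ_Suc[OF lim_1_over_n])
    then have "(\<lambda>n. g (t (h n))) \<longlonglongrightarrow> g s"
      using LIMSEQ_subseq_LIMSEQ[OF _ h(1), of "\<lambda>n. g s + (1 / real (Suc n)) *\<^sub>R (g r - g s)"] by (simp add: o_def t(3))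
    ultimately have "g s = g y" by (rule LIMSEQ_unique[symmetric])
    then obtain n :: int where n: "y = s + 2 * pi * of_int n" using congr by blast
    have "n = 0"
    proof -
      have "pi * (- 1) \<le> pi * (2 * of_int n)" "pi * (2 * of_int n) \<le> pi * 1" using y n by auto
      then have "(- 1 :: real) \<le> 2 * of_int n" "2 * of_int n \<le> (1 :: real)"
        by (simp_all only: mult_le_cancel_left_pos[OF pi_gt_zero])
      then show ?thesis by linarith
    qed
    then have ys: "y = s" using n by simp
    have tne: "t n \<noteq> s" for n
      using t(3)[of n] ne by auto
    have "eventually (\<lambda>t. f t / (t - s)\<^sup>2 > 0) (at s)"
      using order_tendstoD(1)[OF lim] f2p by simp
    then have "eventually (\<lambda>n. f (t (h n)) / (t (h n) - s)\<^sup>2 > 0) sequentially"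
      by (rule eventually_compose_filterlim) (use th ys tne in \<open>auto simp: filterlim_at\<close>)
    then obtain n where "f (t (h n)) / (t (h n) - s)\<^sup>2 > 0" using eventually_happens sequentially_bot by blast
    moreover have "f (t (h n)) = 0"
    proof -
      have "f (t (h n)) = a \<bullet> (g (t (h n)) - g s)" by (simp add: f_def inn)
      also have "\<dots> = 1 / real (Suc (h n)) * (a \<bullet> (g r - g s))" by (simp add: t(3))
      also have "\<dots> = 0" unfolding al lr by simp
      finally show ?thesis .
    qed
    ultimately show False by simp
  qed
  then have "0 < l (g r)" using lD[OF on[of r]] by simp
  then show ?thesis by (simp add: l_def k_def)
qed

section \<open>Clean sextactic points\<close>

theorem theorem1p2:
  fixes \<gamma> :: "real \<Rightarrow> real^2"
  assumes "C_k_regular 4 \<gamma>" and "strictly_convex \<gamma>"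
  shows "(\<exists>T \<subseteq> {0..<2 * pi}. card T = 3 \<and> (\<forall>t\<in>T. clean_maximal_sextactic \<gamma> t)) \<and>
         (\<exists>T \<subseteq> {0..<2 * pi}. card T = 3 \<and> (\<forall>t\<in>T. clean_minimal_sextactic \<gamma> t))"
proof -
  define D where "D j = (vderiv ^^ j) \<gamma>" for j
  have D0: "D 0 = \<gamma>" and DS: "D (Suc j) = vderiv (D j)" for j by (simp_all add: D_def)
  have C: "\<And>j t. j < 4 \<Longrightarrow> D j differentiable (at t)" "continuous_on UNIV (D 4)"
    using assms(1) by (auto simp: C_k_regular_def C_k_curve_def D_def)
  have closed_curve: "simple_closed_curve \<gamma>" and conv: "convex (closed_region \<gamma>)" and curv: "\<And>t. curvature \<gamma> t \<noteq> 0"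
    using assms(2) by (auto simp: strictly_convex_def)
  have vd: "(D j has_vector_derivative D (Suc j) t) (at t)" if "j < 4" for j t
    using C(1)[OF that] unfolding DS vderiv_def vector_derivative_works .
  have dc: "((\<lambda>t. D j t $ i) has_real_derivative D (Suc j) t $ i) (at t)" if "j < 4" for i j t
    using bounded_linear.has_vector_derivative[OF bounded_linear_vec_nth vd[OF that]]
    unfolding has_real_derivative_iff_has_vector_derivative .
  have d: "((\<lambda>t. D 0 t $ i) has_real_derivative D 1 t $ i) (at t)"
    "((\<lambda>t. D 1 t $ i) has_real_derivative D 2 t $ i) (at t)"
    "((\<lambda>t. D 2 t $ i) has_real_derivative D 3 t $ i) (at t)"
    "((\<lambda>t. D 3 t $ i) has_real_derivative D 4 t $ i) (at t)" for i t
    using dc[of 0 i t] dc[of 1 i t] dc[of 2 i t] dc[of 3 i t] by (simp_all add: eval_nat_numeral)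
  have perS: "f' (t + 2 * pi) = f' t"
    if "\<And>t. f (t + 2 * pi) = f t" "\<And>t. (f has_real_derivative f' t) (at t)" for f f' :: "real \<Rightarrow> real" and t
  proof -
    have "((\<lambda>t. f (t + 2 * pi)) has_real_derivative f' (t + 2 * pi)) (at t)"
      using that(2)[of "t + 2 * pi"] by (simp add: DERIV_shift)
    then have "(f has_real_derivative f' (t + 2 * pi)) (at t)" by (simp add: that(1))
    then show ?thesis using that(2) by (rule DERIV_unique)
  qed
  have per0: "D 0 (t + 2 * pi) $ i = D 0 t $ i" for t i
    using closed_curve by (simp add: D0 simple_closed_curve_def)
  note per1 = perS[OF per0 d(1)]
  note per2 = perS[OF per1 d(2)]
  note per3 = perS[OF per2 d(3)]
  note per4 = perS[OF per3 d(4)]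
  have k: "D 1 s $ 1 * D 2 s $ 2 - D 1 s $ 2 * D 2 s $ 1 \<noteq> 0" for s
    using curv[of s] DS[of 0] DS[of 1] D0 by (auto simp: curvature_def eval_nat_numeral)
  interpret oval_curve "\<lambda>t. D 0 t $ 1" "\<lambda>t. D 1 t $ 1" "\<lambda>t. D 2 t $ 1" "\<lambda>t. D 3 t $ 1" "\<lambda>t. D 4 t $ 1"
    "\<lambda>t. D 0 t $ 2" "\<lambda>t. D 1 t $ 2" "\<lambda>t. D 2 t $ 2" "\<lambda>t. D 3 t $ 2" "\<lambda>t. D 4 t $ 2" \<gamma>
  proof unfold_locales
    show "0 < (D 1 s $ 1 * (D 0 t $ 2 - D 0 s $ 2) - D 1 s $ 2 * (D 0 t $ 1 - D 0 s $ 1)) /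
        (D 1 s $ 1 * D 2 s $ 2 - D 1 s $ 2 * D 2 s $ 1)" if "\<forall>n::int. t \<noteq> s + 2 * pi * of_int n" for s t
      using curve_above_tangent[OF closed_curve conv d(1,2)[of 1, unfolded D0] d(1,2)[of 2, unfolded D0] _ _ k that]
        DERIV_isCont[OF d(3)] by (simp add: D0)
    show "continuous_on UNIV (\<lambda>t. D 4 t $ 1)" "continuous_on UNIV (\<lambda>t. D 4 t $ 2)"
      using C(2) by (auto intro!: continuous_intros)
  qed (use d per0 per1 per2 per3 per4 k conv in \<open>simp_all add: D0\<close>)
  interpret max: signed_oval_curve "\<lambda>t. D 0 t $ 1" "\<lambda>t. D 1 t $ 1" "\<lambda>t. D 2 t $ 1" "\<lambda>t. D 3 t $ 1" "\<lambda>t. D 4 t $ 1"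
    "\<lambda>t. D 0 t $ 2" "\<lambda>t. D 1 t $ 2" "\<lambda>t. D 2 t $ 2" "\<lambda>t. D 3 t $ 2" "\<lambda>t. D 4 t $ 2" \<gamma> 1
    by unfold_locales simp
  interpret min: signed_oval_curve "\<lambda>t. D 0 t $ 1" "\<lambda>t. D 1 t $ 1" "\<lambda>t. D 2 t $ 1" "\<lambda>t. D 3 t $ 1" "\<lambda>t. D 4 t $ 1"
    "\<lambda>t. D 0 t $ 2" "\<lambda>t. D 1 t $ 2" "\<lambda>t. D 2 t $ 2" "\<lambda>t. D 3 t $ 2" "\<lambda>t. D 4 t $ 2" \<gamma> "- 1"
    by unfold_locales simp
  show ?thesis
    using max.three_clean_in_period max.clean_imp_clean_maximal_sextactic[OF refl]
      min.three_clean_in_period min.clean_imp_clean_minimal_sextactic[OF refl] by meson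
qed

end
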